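(* Let $n\ge 2$ be an integer and let $B$ be a finite Blaschke product of degree $2^n-1$. Put $\widehat{B}(z)=zB(z)$ and $N=2^n$. Suppose that the numerical range $W(S_B)$ is a (closed) elliptical disk. Then every lower-degree curve $K_2,\dots,K_{N/2}$ in the Poncelet package of $\widehat{B}$ is an ellipse or a point, and $\widehat{B}$ is a composition of $n$ Blaschke products of degree $2$.
   Context: A finite Blaschke product of degree $d$ is a function $B(z)=\gamma\prod_{j=1}^d \frac{z-a_j}{1-\overline{a_j}z}$ with $a_j\in\mathbb{D}$ (the open unit disk) and $|\gamma|=1$. Let $H^2$ be the Hardy space of the disk, $S$ the shift operator (multiplication by $z$), $K_B=H^2\ominus BH^2$ the model space, $P_B$ the orthogonal projection of $H^2$ onto $K_B$, and $S_B=P_BS|_{K_B}$ the compressed shift. The numerical range of an operator $A$ on a finite-dimensional space is $W(A)=\{\langle Ax,x\rangle:\|x\|=1\}$. Poncelet package of $\widehat{B}$ (of degree $N$): for each $\lambda\in\mathbb{T}$, let $z_0,\dots,z_{N-1}$ be the $N$ distinct solutions on the unit circle $\mathbb{T}$ of $\widehat{B}(z)=\widehat{B}(\lambda)$, ordered by increasing argument, indices taken mod $N$. $K_1$ is the envelope (over all $\lambda$) of the sides $[z_{k-1},z_k]$ of these polygons, and for $m=1,\dots,[N/2]-1$, $K_{m+1}$ is the envelope (over all $\lambda$ and $k$) of the diagonals joining $z_{k-1}$ to $z_{k+m}$. The curves $K_2,\dots,K_{[N/2]}$ are called the lower-degree curves. *)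

theory Defs
  imports "HOL-Analysis.Analysis"
begin

definition blaschke :: "complex \<Rightarrow> complex list \<Rightarrow> complex \<Rightarrow> complex" where
  "blaschke \<gamma> as z = \<gamma> * (\<Prod>a\<leftarrow>as. (z - a) / (1 - cnj a * z))"

definition is_fbp :: "nat \<Rightarrow> (complex \<Rightarrow> complex) \<Rightarrow> bool" where
  "is_fbp d f \<longleftrightarrow> (\<exists>\<gamma> as. cmod \<gamma> = 1 \<and> length as = d \<and> (\<forall>a\<in>set as. cmod a < 1)
                      \<and> f = blaschke \<gamma> as)"

section \<open>Hardy space H^2 (coefficient model), model space, compressed shift\<close>

definition H2 :: "(nat \<Rightarrow> complex) set" where
  "H2 = {f. summable (\<lambda>k. (cmod (f k))\<^sup>2)}"

definition h2_inner :: "(nat \<Rightarrow> complex) \<Rightarrow> (nat \<Rightarrow> complex) \<Rightarrow> complex" where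
  "h2_inner f g = (\<Sum>k. f k * cnj (g k))"

definition shift_op :: "(nat \<Rightarrow> complex) \<Rightarrow> (nat \<Rightarrow> complex)" where
  "shift_op f = (\<lambda>k. if k = 0 then 0 else f (k - 1))"

definition taylor_coeff :: "(complex \<Rightarrow> complex) \<Rightarrow> nat \<Rightarrow> complex" where
  "taylor_coeff f k = (deriv ^^ k) f 0 / of_nat (fact k)"

definition mult_seq :: "(nat \<Rightarrow> complex) \<Rightarrow> (nat \<Rightarrow> complex) \<Rightarrow> (nat \<Rightarrow> complex)" where
  "mult_seq b h = (\<lambda>k. \<Sum>j\<le>k. b j * h (k - j))"

definition BH2 :: "(complex \<Rightarrow> complex) \<Rightarrow> (nat \<Rightarrow> complex) set" where
  "BH2 B = mult_seq (taylor_coeff B) ` H2"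

definition model_space :: "(complex \<Rightarrow> complex) \<Rightarrow> (nat \<Rightarrow> complex) set" where
  "model_space B = {f \<in> H2. \<forall>g\<in>BH2 B. h2_inner f g = 0}"

definition proj_model :: "(complex \<Rightarrow> complex) \<Rightarrow> (nat \<Rightarrow> complex) \<Rightarrow> (nat \<Rightarrow> complex)" where
  "proj_model B f = (THE g. g \<in> model_space B \<and> (\<forall>h\<in>model_space B. h2_inner (f - g) h = 0))"

definition compressed_shift :: "(complex \<Rightarrow> complex) \<Rightarrow> (nat \<Rightarrow> complex) \<Rightarrow> (nat \<Rightarrow> complex)" where
  "compressed_shift B x = proj_model B (shift_op x)"

definition num_range_SB :: "(complex \<Rightarrow> complex) \<Rightarrow> complex set" where
  "num_range_SB B = {h2_inner (compressed_shift B x) x | x. x \<in> model_space B \<and> h2_inner x x = 1}"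

definition is_elliptical_disk :: "complex set \<Rightarrow> bool" where
  "is_elliptical_disk E \<longleftrightarrow> (\<exists>f1 f2 a. cmod (f1 - f2) < 2 * a \<and>
      E = {z. cmod (z - f1) + cmod (z - f2) \<le> 2 * a})"

definition is_ellipse :: "complex set \<Rightarrow> bool" where
  "is_ellipse E \<longleftrightarrow> (\<exists>f1 f2 a. cmod (f1 - f2) < 2 * a \<and>
      E = {z. cmod (z - f1) + cmod (z - f2) = 2 * a})"

definition ccw_angle :: "complex \<Rightarrow> complex \<Rightarrow> real" where
  "ccw_angle w z = (if Arg (z / w) < 0 then Arg (z / w) + 2 * pi else Arg (z / w))"

definition circle_fibre :: "(complex \<Rightarrow> complex) \<Rightarrow> complex \<Rightarrow> complex set" where
  "circle_fibre Bh w = {z. cmod z = 1 \<and> Bh z = Bh w}"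

text \<open>the point j steps after w (counterclockwise, i.e. by increasing argument)
  among the solutions of Bh z = Bh w on the unit circle\<close>
definition fibre_step :: "(complex \<Rightarrow> complex) \<Rightarrow> complex \<Rightarrow> nat \<Rightarrow> complex" where
  "fibre_step Bh w j = (THE z. z \<in> circle_fibre Bh w \<and>
      card {u \<in> circle_fibre Bh w. ccw_angle w u < ccw_angle w z} = j)"

text \<open>K_j: envelope of the family of lines through z_{k-1} and z_{k-1+j}, i.e. through
  w = cis t and fibre_step Bh w j, t real.  The envelope of the family of lines
  F(x,t) = 0 is the set of points x with F(x,t) = 0 and dF/dt(x,t) = 0 for some t.\<close>
definition poncelet_curve :: "(complex \<Rightarrow> complex) \<Rightarrow> nat \<Rightarrow> complex set" where
  "poncelet_curve Bh j = {x. \<exists>t.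
      (let F = (\<lambda>s. Im ((x - cis s) * cnj (fibre_step Bh (cis s) j - cis s)))
       in F t = 0 \<and> (F has_real_derivative 0) (at t))}"

end

theory Submission
  imports Defs "HOL-Computational_Algebra.Polynomial_FPS"
begin

text \<open>
  Let \<open>F(z) = z B(z)\<close>. Clark's orthogonal basis of the model space of \<open>F\<close>, indexed by a fibre of
  \<open>F\<close> on the circle, shows that every side of every fibre polygon supports \<open>W(S\<^sub>B)\<close>; hence, if this is
  an elliptical disk, all sides touch one ellipse. In the coordinates \<open>z, w\<close> of the end points of a
  chord, tangency to a conic is a symmetric biquadratic relation. A disc automorphism takes
  the centre of the ellipse to the origin, and then the relation reads
  \<open>cos \<theta> cos \<eta> + sin \<theta> sin \<eta> dn c = cn c\<close>: passing to the next vertex is translation by a constant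
  \<open>c\<close> for the addition law of Jacobi's elliptic functions on the circle. So passing to the \<open>j\<close>-th
  vertex is translation by \<open>j c\<close>, and the \<open>j\<close>-th diagonals satisfy a relation of the same shape, i.e.
  they envelop a conic. The translation by \<open>(N / 2) c\<close> is the only one of order two, \<open>z \<mapsto> -z\<close>; its
  chords pass through one point, and \<open>F\<close> is a function of \<open>z\<^sup>2\<close> in these coordinates. The quotient has degree
  \<open>N / 2\<close>, and its polygons satisfy the relation obtained by squaring, so the argument repeats.
\<close>

section \<open>Jacobi addition on the unit circle\<close>

text \<open>The elliptic functions are never constructed. A point z of the circle stands for cn u +
  i sn u, and only the addition formulas occur, so that associativity is a polynomial identity in
  cn, sn and dn. The obstacle in the induction is that nothing provides an elliptical numerical
  range for the quotient by z -> -z. The induction therefore carries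
  \<open>has_poncelet_conic\<close>, which speaks only of closed polygons tangent to one conic;
  squaring preserves this, because the normal form without the coefficient B squares to a
  \<open>chord_form\<close> again. The new form has a coefficient B once more, so every stage
  normalizes afresh. The parameter k is dictated by dn c = \<delta> and cn c = \<eta>, which give k
  = (1 - \<delta>^2) / (1 - \<eta>^2); that every point of the circle has two tangents gives
  |\<eta>| < \<delta> and hence k < 1. The envelopes are treated through support functions: a chord
  is recorded by its normal angle and its signed distance from the origin, where tangency is a
  quadratic equation for the distance.\<close>

definition ell_delta :: "real \<Rightarrow> complex \<Rightarrow> real" where
  "ell_delta k z = sqrt (1 - k * (Im z)\<^sup>2)"

text \<open>For z = cn u + i sn u the value \<open>ell_delta k z\<close> is dn u, and these are the
  addition formulas of cn and sn; k is the square of the modulus.\<close>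

definition ell_add :: "real \<Rightarrow> complex \<Rightarrow> complex \<Rightarrow> complex" where
  "ell_add k z w =
     Complex ((Re z * Re w - Im z * Im w * ell_delta k z * ell_delta k w) / (1 - k * (Im z)\<^sup>2 * (Im w)\<^sup>2))
             ((Im z * Re w * ell_delta k w + Im w * Re z * ell_delta k z) / (1 - k * (Im z)\<^sup>2 * (Im w)\<^sup>2))"

primrec ell_mul :: "real \<Rightarrow> nat \<Rightarrow> complex \<Rightarrow> complex" where
  "ell_mul k 0 c = 1"
| "ell_mul k (Suc j) c = ell_add k (ell_mul k j c) c"

locale elliptic_circle =
  fixes k :: real
  assumes k0: "0 \<le> k" and k1: "k < 1"
begin

abbreviation \<Delta> where "\<Delta> \<equiv> ell_delta k"
abbreviation mul where "mul \<equiv> ell_mul k"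
abbreviation ell_plus (infixl "\<oplus>" 65) where "z \<oplus> w \<equiv> ell_add k z w"

lemma circle_sq: "cmod z = 1 \<Longrightarrow> (Re z)\<^sup>2 = 1 - (Im z)\<^sup>2"
  using cmod_power2[of z] by simp

lemma Im_sq_le: "cmod z = 1 \<Longrightarrow> (Im z)\<^sup>2 \<le> 1"
  using circle_sq[of z] zero_le_power2[of "Re z"] by linarith

lemma k_Im_less: assumes "cmod z = 1" shows "k * (Im z)\<^sup>2 < 1"
proof -
  have "k * (Im z)\<^sup>2 \<le> k * 1" by (rule mult_left_mono) (use Im_sq_le[OF assms] k0 in auto)
  then show ?thesis using k1 by simp
qed

lemma delta_pos: "cmod z = 1 \<Longrightarrow> \<Delta> z > 0"
  unfolding ell_delta_def using k_Im_less[of z] by simp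

lemma delta_sq: "cmod z = 1 \<Longrightarrow> (\<Delta> z)\<^sup>2 = 1 - k * (Im z)\<^sup>2"
  unfolding ell_delta_def using k_Im_less[of z] by simp

lemma den_pos: assumes "cmod z = 1" "cmod w = 1" shows "1 - k * (Im z)\<^sup>2 * (Im w)\<^sup>2 > 0"
proof -
  have "k * (Im z)\<^sup>2 * (Im w)\<^sup>2 \<le> k * (Im z)\<^sup>2 * 1"
    by (rule mult_left_mono) (use Im_sq_le[OF assms(2)] k0 in auto)
  then show ?thesis using k_Im_less[OF assms(1)] by simp
qed

lemma norm_add: assumes "cmod z = 1" "cmod w = 1" shows "cmod (z \<oplus> w) = 1"
proof -
  define s1 c1 d1 s2 c2 d2 n where "s1 = Im z" "c1 = Re z" "d1 = \<Delta> z" "s2 = Im w" "c2 = Re w" "d2 = \<Delta> w"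
    and n: "n = 1 - k * s1\<^sup>2 * s2\<^sup>2"
  note defs = this
  have h: "c1\<^sup>2 = 1 - s1\<^sup>2" "c2\<^sup>2 = 1 - s2\<^sup>2" "d1\<^sup>2 = 1 - k * s1\<^sup>2" "d2\<^sup>2 = 1 - k * s2\<^sup>2"
    using circle_sq delta_sq assms by (auto simp: defs)
  have n0: "n > 0" using den_pos[OF assms] by (simp add: defs)
  have "(c1 * c2 - s1 * s2 * d1 * d2)\<^sup>2 + (s1 * c2 * d2 + s2 * c1 * d1)\<^sup>2 = n\<^sup>2"
    unfolding n using h by algebra
  then have "(Re (z \<oplus> w))\<^sup>2 + (Im (z \<oplus> w))\<^sup>2 = 1"
    unfolding ell_add_def complex.sel defs[symmetric] power_divide add_divide_distrib[symmetric] using n0 by simp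
  then show ?thesis by (simp add: cmod_def)
qed

text \<open>The addition formula of dn. Squaring reduces it to a polynomial identity; the sign
  requires a nonnegative numerator.\<close>

lemma delta_add: assumes "cmod z = 1" "cmod w = 1"
  shows "\<Delta> (z \<oplus> w) = (\<Delta> z * \<Delta> w - k * Im z * Im w * Re z * Re w) / (1 - k * (Im z)\<^sup>2 * (Im w)\<^sup>2)"
proof -
  define s1 c1 d1 s2 c2 d2 n where "s1 = Im z" "c1 = Re z" "d1 = \<Delta> z" "s2 = Im w" "c2 = Re w" "d2 = \<Delta> w"
    and n: "n = 1 - k * s1\<^sup>2 * s2\<^sup>2"
  note defs = this
  have h: "c1\<^sup>2 = 1 - s1\<^sup>2" "c2\<^sup>2 = 1 - s2\<^sup>2" "d1\<^sup>2 = 1 - k * s1\<^sup>2" "d2\<^sup>2 = 1 - k * s2\<^sup>2"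
    using circle_sq delta_sq assms by (auto simp: defs)
  have n0: "n > 0" using den_pos[OF assms] by (simp add: defs)
  have dp: "d1 > 0" "d2 > 0" using delta_pos assms by (auto simp: defs)
  \<comment> \<open>Holds since d^2 - k s^2 c^2 = (1 - k) + k (1 - s^2)^2. Multiplied over both
    points, it bounds the subtracted term of the numerator.\<close>
  have aux: "\<bar>sqrt k * s * c\<bar> \<le> d" if "c\<^sup>2 = 1 - s\<^sup>2" "d\<^sup>2 = 1 - k * s\<^sup>2" "d > 0" for s c d
  proof (rule power2_le_imp_le)
    have "s\<^sup>2 \<le> 1" using that(1) zero_le_power2[of c] by linarith
    have "\<bar>sqrt k * s * c\<bar>\<^sup>2 = k * s\<^sup>2 * c\<^sup>2" using k0 by (simp add: power_mult_distrib)
    also have "\<dots> = d\<^sup>2 - (1 - k) - k * (1 - s\<^sup>2)\<^sup>2" using that by algebra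
    also have "\<dots> \<le> d\<^sup>2" using k1 mult_nonneg_nonneg[OF k0, of "(1-s\<^sup>2)\<^sup>2"] by simp
    finally show "\<bar>sqrt k * s * c\<bar>\<^sup>2 \<le> d\<^sup>2" .
  qed (use that in auto)
  have "\<bar>sqrt k * s1 * c1\<bar> * \<bar>sqrt k * s2 * c2\<bar> \<le> d1 * d2"
    by (rule mult_mono) (use aux h dp in auto)
  then have "\<bar>k * s1 * s2 * c1 * c2\<bar> \<le> d1 * d2" using k0
    by (simp add: abs_mult mult.commute mult.left_commute)
  then have nn: "(d1 * d2 - k * s1 * s2 * c1 * c2) / n \<ge> 0" using n0 by (intro divide_nonneg_pos) auto
  have "n\<^sup>2 - k * (s1 * c2 * d2 + s2 * c1 * d1)\<^sup>2 = (d1 * d2 - k * s1 * s2 * c1 * c2)\<^sup>2"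
    unfolding n using h by algebra
  then have "1 - k * (Im (z \<oplus> w))\<^sup>2 = ((d1 * d2 - k * s1 * s2 * c1 * c2) / n)\<^sup>2"
    unfolding ell_add_def complex.sel defs[symmetric] power_divide using n0 by (simp add: divide_simps)
  then have "\<Delta> (z \<oplus> w) = sqrt (((d1 * d2 - k * s1 * s2 * c1 * c2) / n)\<^sup>2)"
    unfolding ell_delta_def by simp
  then show ?thesis using nn by (simp only: real_sqrt_abs abs_of_nonneg) (simp add: defs)
qed

lemma add_commute: "z \<oplus> w = w \<oplus> z"
  unfolding ell_add_def by (simp add: mult_ac add_ac)

lemma add_one: "z \<oplus> 1 = z"
  unfolding ell_add_def by (simp add: ell_delta_def complex_eq_iff)

lemma add_minus_one: "z \<oplus> (-1) = - z"
  unfolding ell_add_def by (simp add: ell_delta_def complex_eq_iff)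

lemma delta_cnj: "\<Delta> (cnj z) = \<Delta> z"
  unfolding ell_delta_def by simp

lemma add_cnj: assumes "cmod z = 1" shows "z \<oplus> cnj z = 1"
proof -
  have h: "(Re z)\<^sup>2 = 1 - (Im z)\<^sup>2" "(\<Delta> z)\<^sup>2 = 1 - k * (Im z)\<^sup>2"
    using circle_sq delta_sq assms by auto
  have n0: "1 - k * (Im z)\<^sup>2 * (Im z)\<^sup>2 > 0" using den_pos[OF assms assms] .
  have "Re z * Re z + Im z * Im z * \<Delta> z * \<Delta> z = 1 - k * (Im z)\<^sup>2 * (Im z)\<^sup>2" using h by algebra
  then show ?thesis using n0 unfolding ell_add_def by (simp add: complex_eq_iff delta_cnj)
qed

text \<open>Associativity of the imaginary part, with the fractions of \<open>Re_add_divide\<close>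
  cross-multiplied: modulo the six relations it is a polynomial identity. \<open>cn_assoc\<close>
  does the same for the real part.\<close>

lemma sn_assoc:
  fixes s1 c1 d1 s2 c2 d2 s3 c3 d3 :: real
  assumes "c1\<^sup>2 = 1 - s1\<^sup>2" "c2\<^sup>2 = 1 - s2\<^sup>2" "c3\<^sup>2 = 1 - s3\<^sup>2"
    "d1\<^sup>2 = 1 - k * s1\<^sup>2" "d2\<^sup>2 = 1 - k * s2\<^sup>2" "d3\<^sup>2 = 1 - k * s3\<^sup>2"
  shows "((s1 * c2 * d2 + s2 * c1 * d1) * (1 - k * s1\<^sup>2 * s2\<^sup>2) * c3 * d3
       + s3 * (c1 * c2 - s1 * s2 * d1 * d2) * (d1 * d2 - k * s1 * s2 * c1 * c2))
     * ((1 - k * s2\<^sup>2 * s3\<^sup>2)\<^sup>2 - k * s1\<^sup>2 * (s2 * c3 * d3 + s3 * c2 * d2)\<^sup>2)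
   = ((s2 * c3 * d3 + s3 * c2 * d2) * (1 - k * s2\<^sup>2 * s3\<^sup>2) * c1 * d1
       + s1 * (c2 * c3 - s2 * s3 * d2 * d3) * (d2 * d3 - k * s2 * s3 * c2 * c3))
     * ((1 - k * s1\<^sup>2 * s2\<^sup>2)\<^sup>2 - k * s3\<^sup>2 * (s1 * c2 * d2 + s2 * c1 * d1)\<^sup>2)"
  using assms by algebra

lemma cn_assoc:
  fixes s1 c1 d1 s2 c2 d2 s3 c3 d3 :: real
  assumes "c1\<^sup>2 = 1 - s1\<^sup>2" "c2\<^sup>2 = 1 - s2\<^sup>2" "c3\<^sup>2 = 1 - s3\<^sup>2"
    "d1\<^sup>2 = 1 - k * s1\<^sup>2" "d2\<^sup>2 = 1 - k * s2\<^sup>2" "d3\<^sup>2 = 1 - k * s3\<^sup>2"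
  shows "((c1 * c2 - s1 * s2 * d1 * d2) * (1 - k * s1\<^sup>2 * s2\<^sup>2) * c3
       - (s1 * c2 * d2 + s2 * c1 * d1) * s3 * (d1 * d2 - k * s1 * s2 * c1 * c2) * d3)
     * ((1 - k * s2\<^sup>2 * s3\<^sup>2)\<^sup>2 - k * s1\<^sup>2 * (s2 * c3 * d3 + s3 * c2 * d2)\<^sup>2)
   = (c1 * (c2 * c3 - s2 * s3 * d2 * d3) * (1 - k * s2\<^sup>2 * s3\<^sup>2)
       - s1 * (s2 * c3 * d3 + s3 * c2 * d2) * d1 * (d2 * d3 - k * s2 * s3 * c2 * c3))
     * ((1 - k * s1\<^sup>2 * s2\<^sup>2)\<^sup>2 - k * s3\<^sup>2 * (s1 * c2 * d2 + s2 * c1 * d1)\<^sup>2)"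
  using assms by algebra


text \<open>Clears the inner fraction of a double sum, so that each coordinate is a single quotient
  with a denominator of known sign.\<close>

lemma Re_add_divide:
  assumes "cmod z = 1" "cmod w = 1" "cmod v = 1"
  defines "n \<equiv> 1 - k * (Im z)\<^sup>2 * (Im w)\<^sup>2"
  defines "S \<equiv> Im z * Re w * \<Delta> w + Im w * Re z * \<Delta> z"
  defines "C \<equiv> Re z * Re w - Im z * Im w * \<Delta> z * \<Delta> w"
  defines "D \<equiv> \<Delta> z * \<Delta> w - k * Im z * Im w * Re z * Re w"
  shows "Re ((z \<oplus> w) \<oplus> v) = (C * n * Re v - S * Im v * D * \<Delta> v) / (n\<^sup>2 - k * (Im v)\<^sup>2 * S\<^sup>2)"
    and "Im ((z \<oplus> w) \<oplus> v) = (S * n * Re v * \<Delta> v + Im v * C * D) / (n\<^sup>2 - k * (Im v)\<^sup>2 * S\<^sup>2)"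
    and "n\<^sup>2 - k * (Im v)\<^sup>2 * S\<^sup>2 > 0"
proof -
  have n0: "n > 0" using den_pos assms by simp
  have Im: "Im (z \<oplus> w) = S / n" and Re: "Re (z \<oplus> w) = C / n" by (simp_all add: ell_add_def S_def C_def n_def)
  have De: "\<Delta> (z \<oplus> w) = D / n" using delta_add assms by (simp add: D_def n_def)
  have d: "1 - k * (Im (z \<oplus> w))\<^sup>2 * (Im v)\<^sup>2 = (n\<^sup>2 - k * (Im v)\<^sup>2 * S\<^sup>2) / n\<^sup>2"
    unfolding Im using n0 by (simp add: divide_simps)
  have p: "1 - k * (Im (z \<oplus> w))\<^sup>2 * (Im v)\<^sup>2 > 0" by (rule den_pos) (use assms norm_add in auto)
  then show "n\<^sup>2 - k * (Im v)\<^sup>2 * S\<^sup>2 > 0" unfolding d using n0 by (simp add: zero_less_divide_iff)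
  have d': "1 - k * (S / n)\<^sup>2 * (Im v)\<^sup>2 = (n\<^sup>2 - k * (Im v)\<^sup>2 * S\<^sup>2) / n\<^sup>2"
    using d unfolding Im .
  have "Re ((z \<oplus> w) \<oplus> v) = (C / n * Re v - S / n * Im v * (D / n) * \<Delta> v) / ((n\<^sup>2 - k * (Im v)\<^sup>2 * S\<^sup>2) / n\<^sup>2)"
    unfolding ell_add_def[of k "z \<oplus> w" v] complex.sel De Im Re d' ..
  also have "C / n * Re v - S / n * Im v * (D / n) * \<Delta> v = (C * n * Re v - S * Im v * D * \<Delta> v) / n\<^sup>2"
    using n0 by (simp add: field_simps power2_eq_square)
  finally show "Re ((z \<oplus> w) \<oplus> v) = (C * n * Re v - S * Im v * D * \<Delta> v) / (n\<^sup>2 - k * (Im v)\<^sup>2 * S\<^sup>2)"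
    using n0 by simp
  have "Im ((z \<oplus> w) \<oplus> v) = (S / n * Re v * \<Delta> v + Im v * (C / n) * (D / n)) / ((n\<^sup>2 - k * (Im v)\<^sup>2 * S\<^sup>2) / n\<^sup>2)"
    unfolding ell_add_def[of k "z \<oplus> w" v] complex.sel De Im Re d' ..
  also have "S / n * Re v * \<Delta> v + Im v * (C / n) * (D / n) = (S * n * Re v * \<Delta> v + Im v * C * D) / n\<^sup>2"
    using n0 by (simp add: field_simps power2_eq_square)
  finally show "Im ((z \<oplus> w) \<oplus> v) = (S * n * Re v * \<Delta> v + Im v * C * D) / (n\<^sup>2 - k * (Im v)\<^sup>2 * S\<^sup>2)"
    using n0 by simp
qed

lemma add_assoc:
  assumes "cmod z = 1" "cmod w = 1" "cmod v = 1"
  shows "(z \<oplus> w) \<oplus> v = z \<oplus> (w \<oplus> v)"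
proof -
  \<comment> \<open>By commutativity both sides are nested to the left, so
    \<open>Re_add_divide\<close> serves for both.\<close>
  have comm: "z \<oplus> (w \<oplus> v) = (v \<oplus> w) \<oplus> z" using add_commute by metis
  note h = circle_sq[OF assms(1)] circle_sq[OF assms(2)] circle_sq[OF assms(3)]
    delta_sq[OF assms(1)] delta_sq[OF assms(2)] delta_sq[OF assms(3)]
  note f = Re_add_divide[OF assms] and g = Re_add_divide[OF assms(3,2,1)]
  show ?thesis unfolding comm
  proof (rule complex_eqI)
    show "Re (z \<oplus> w \<oplus> v) = Re (v \<oplus> w \<oplus> z)"
      unfolding f(1) g(1)
      apply (subst frac_eq_eq)
      subgoal using f(3) by simp
      subgoal using g(3) by simp
      using cn_assoc[OF h] by (simp only: mult.commute mult.left_commute add.commute)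
    show "Im (z \<oplus> w \<oplus> v) = Im (v \<oplus> w \<oplus> z)"
      unfolding f(2) g(2)
      apply (subst frac_eq_eq)
      subgoal using f(3) by simp
      subgoal using g(3) by simp
      using sn_assoc[OF h] by (simp only: mult.commute mult.left_commute add.commute)
  qed
qed

text \<open>The classical relation cn u cn(u + c) + sn u sn(u + c) dn c = cn c: translation by a
  fixed c keeps chords tangent to one conic.\<close>

lemma add_relation:
  assumes "cmod z = 1" "cmod c = 1"
  shows "Re z * Re (z \<oplus> c) + Im z * Im (z \<oplus> c) * \<Delta> c = Re c"
proof -
  have h: "(Re z)\<^sup>2 = 1 - (Im z)\<^sup>2" "(\<Delta> z)\<^sup>2 = 1 - k * (Im z)\<^sup>2" "(Re c)\<^sup>2 = 1 - (Im c)\<^sup>2" "(\<Delta> c)\<^sup>2 = 1 - k * (Im c)\<^sup>2"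
    using circle_sq delta_sq assms by auto
  define n where "n = 1 - k * (Im z)\<^sup>2 * (Im c)\<^sup>2"
  have n0: "n > 0" using den_pos[OF assms] n_def by simp
  have "Re z * (Re z * Re c - Im z * Im c * \<Delta> z * \<Delta> c) + Im z * (Im z * Re c * \<Delta> c + Im c * Re z * \<Delta> z) * \<Delta> c = Re c * n"
    unfolding n_def using h by algebra
  then have "(Re z * (Re z * Re c - Im z * Im c * \<Delta> z * \<Delta> c) + Im z * (Im z * Re c * \<Delta> c + Im c * Re z * \<Delta> z) * \<Delta> c) / n = Re c"
    using n0 by (simp add: nonzero_divide_eq_eq)
  then show ?thesis unfolding ell_add_def complex.sel n_def[symmetric]
    by (simp only: add_divide_distrib[symmetric] times_divide_eq_right times_divide_eq_left)
qed

lemma add_cancel_cnj: "cmod z = 1 \<Longrightarrow> cmod c = 1 \<Longrightarrow> (z \<oplus> c) \<oplus> cnj c = z"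
  by (simp add: add_assoc add_cnj add_one)

lemma add_eq_iff: assumes "cmod z = 1" "cmod c = 1" "cmod d = 1" shows "z \<oplus> c = z \<oplus> d \<longleftrightarrow> c = d"
  by (metis add_cancel_cnj add_commute assms)

lemma norm_mul: "cmod c = 1 \<Longrightarrow> cmod (mul j c) = 1"
  by (induction j) (auto simp: norm_add)

lemma mul_add: "cmod c = 1 \<Longrightarrow> mul (i + j) c = mul i c \<oplus> mul j c"
  by (induction j) (auto simp: add_one add_assoc norm_mul)

text \<open>Doubling \<open>\<plusminus>\<i>\<close> gives \<open>-1\<close>, so \<open>-1\<close> is the only element of order two.\<close>
lemma double_eq_one: assumes "cmod c = 1" "c \<oplus> c = 1" "c \<noteq> 1" shows "c = -1"
proof -
  have "c = cnj c" using assms add_cancel_cnj[of c c] add_commute[of 1 "cnj c"] add_one by simp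
  then have "Im c = 0" by (simp add: complex_eq_iff)
  then show ?thesis using assms(1,3) circle_sq[of c] by (auto simp: complex_eq_iff power2_eq_1_iff)
qed

text \<open>For fixed \<open>z\<close> the relation is the equation of a line in \<open>w\<close>, which meets the circle at most twice.\<close>
lemma relation_solutions:
  assumes z: "cmod z = 1" and c: "cmod c = 1" and w: "cmod w = 1" and Im_c: "Im c \<noteq> 0"
    and rel: "Re z * Re w + Im z * Im w * \<Delta> c = Re c"
  shows "w = z \<oplus> c \<or> w = z \<oplus> cnj c"
proof (rule ccontr)
  assume nn: "\<not> ?thesis"
  define a b where "a = Re z" "b = Im z * \<Delta> c"
  note ab = this
  have ab0: "a \<noteq> 0 \<or> b \<noteq> 0" using z delta_pos[OF c] circle_sq[OF z] by (auto simp: ab)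
  have l: "a * Re (z \<oplus> c) + b * Im (z \<oplus> c) = Re c" "a * Re (z \<oplus> cnj c) + b * Im (z \<oplus> cnj c) = Re c"
      "a * Re w + b * Im w = Re c"
    using add_relation[OF z, of c] add_relation[OF z, of "cnj c"] c rel by (auto simp: ab delta_cnj mult_ac)
  have ne: "z \<oplus> c \<noteq> z \<oplus> cnj c" using add_eq_iff[OF z c, of "cnj c"] c Im_c by (auto simp: complex_eq_iff)
  have circ: "(Re (z \<oplus> c))\<^sup>2 + (Im (z \<oplus> c))\<^sup>2 = 1" "(Re (z \<oplus> cnj c))\<^sup>2 + (Im (z \<oplus> cnj c))\<^sup>2 = 1"
    "(Re w)\<^sup>2 + (Im w)\<^sup>2 = 1"
    using circle_sq[of "z \<oplus> c"] circle_sq[of "z \<oplus> cnj c"] circle_sq[OF w] norm_add[OF z, of c] norm_add[OF z, of "cnj c"] c by auto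
  have two: "p = q \<or> p = r \<or> q = r" if
      "a * Re p + b * Im p = g" "a * Re q + b * Im q = g" "a * Re r + b * Im r = g"
      "(Re p)\<^sup>2 + (Im p)\<^sup>2 = 1" "(Re q)\<^sup>2 + (Im q)\<^sup>2 = 1" "(Re r)\<^sup>2 + (Im r)\<^sup>2 = 1" for p q r g
  proof (rule ccontr)
    assume ne3: "\<not> ?thesis"
    define s where "s = a\<^sup>2 + b\<^sup>2"
    have s0: "s > 0" using ab0 by (simp add: s_def sum_power2_gt_zero_iff)
    \<comment> \<open>\<open>T\<close> is the coordinate along the line; on the circle its square is
      fixed, so it takes at most two values.\<close>
    define T where "T x = b * Re x - a * Im x" for x
    have T: "s * Re x = a * g + b * T x" "s * Im x = b * g - a * T x" if "a * Re x + b * Im x = g" for x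
      unfolding T_def s_def that[symmetric] by algebra+
    have T2: "(T x)\<^sup>2 = s - g\<^sup>2" if "a * Re x + b * Im x = g" "(Re x)\<^sup>2 + (Im x)\<^sup>2 = 1" for x
      unfolding T_def s_def that(1)[symmetric] using that(2) by algebra
    have inj: "x = y" if "T x = T y" "a * Re x + b * Im x = g" "a * Re y + b * Im y = g" for x y
      using T[OF that(2)] T[OF that(3)] that(1) s0 by (auto simp: complex_eq_iff) (metis less_irrefl mult_cancel_left)+
    have "T p \<noteq> T q" "T p \<noteq> T r" "T q \<noteq> T r" using ne3 inj that by blast+
    moreover have "(T p)\<^sup>2 = (T q)\<^sup>2" "(T p)\<^sup>2 = (T r)\<^sup>2" using T2 that by simp_all
    ultimately show False by (auto simp: power2_eq_iff)
  qed
  show False using two[OF l circ] ne nn by auto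
qed

text \<open>Each step is a translation by c or by its inverse \<open>cnj c\<close>. Changing the
  choice would lead straight back, which \<open>ne\<close> forbids, so the first choice
  persists.\<close>

lemma orbit_eq_mul:
  assumes circ: "\<And>j. cmod (y j) = 1" and c: "cmod c = 1" and Im_c: "Im c \<noteq> 0"
    and rel: "\<And>j. Re (y j) * Re (y (Suc j)) + Im (y j) * Im (y (Suc j)) * \<Delta> c = Re c"
    and ne: "\<And>j. y (Suc (Suc j)) \<noteq> y j"
  obtains c' where "c' = c \<or> c' = cnj c" "\<And>j. y j = y 0 \<oplus> mul j c'"
proof -
  have "y (Suc 0) = y 0 \<oplus> c \<or> y (Suc 0) = y 0 \<oplus> cnj c"
    by (rule relation_solutions) (use assms in auto)
  then obtain c' where c': "c' = c \<or> c' = cnj c" "y (Suc 0) = y 0 \<oplus> c'" by auto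
  then have nc': "cmod c' = 1" using c by auto
  have step: "y (Suc j) = y j \<oplus> c'" for j
  proof (induction j)
    case (Suc j)
    have "y (Suc (Suc j)) = y (Suc j) \<oplus> c \<or> y (Suc (Suc j)) = y (Suc j) \<oplus> cnj c"
      by (rule relation_solutions) (use assms in auto)
    moreover have "y (Suc j) \<oplus> cnj c' = y j" unfolding Suc using add_cancel_cnj circ nc' by simp
    ultimately show ?case using ne[of j] c'(1) by auto
  qed (use c' in auto)
  have "y j = y 0 \<oplus> mul j c'" for j
    by (induction j) (auto simp: add_one step add_assoc norm_mul nc' circ)
  with c'(1) show ?thesis using that by blast
qed

lemma add_cnj_cnj: "cnj z \<oplus> cnj w = cnj (z \<oplus> w)"
  unfolding ell_add_def by (simp add: complex_eq_iff delta_cnj) (simp add: divide_simps)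

lemma mul_cnj: "mul j (cnj c) = cnj (mul j c)"
  by (induction j) (auto simp: add_cnj_cnj)

end

section \<open>Chord conics and disc automorphisms\<close>

text \<open>The disc automorphism taking 0 to x, with inverse \<open>moeb (- x)\<close>.\<close>

definition moeb :: "complex \<Rightarrow> complex \<Rightarrow> complex" where
  "moeb x z = (z + x) / (1 + cnj x * z)"

text \<open>The line through points \<open>z, w\<close> of the circle is \<open>x + p * cnj x = s\<close> with \<open>p = z * w\<close> and
  \<open>s = z + w\<close>, and \<open>chord_form\<close> is a general real quadratic form in \<open>(1, s, p)\<close>. So its zeros are the
  chords tangent to a conic. Up to the factor \<open>(cnj x)\<^sup>2\<close>, \<open>gauge_form\<close> is its value at
  \<open>z = x\<close>, \<open>w = 1 / cnj x\<close>; it is positive on the circle iff no tangent of the circle touches the conic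
  and the sign is normalized.\<close>
definition chord_form :: "complex \<Rightarrow> complex \<Rightarrow> real \<Rightarrow> real \<Rightarrow> complex \<Rightarrow> complex \<Rightarrow> complex" where
  "chord_form A B C D z w = A * z\<^sup>2 * w\<^sup>2 + B * z * w * (z + w) + of_real C * (z\<^sup>2 + w\<^sup>2)
     + of_real D * z * w + cnj B * (z + w) + cnj A"

definition gauge_form :: "complex \<Rightarrow> complex \<Rightarrow> real \<Rightarrow> real \<Rightarrow> complex \<Rightarrow> real" where
  "gauge_form A B C D x = 2 * Re (A * x\<^sup>2) + 2 * (1 + (cmod x)\<^sup>2) * Re (B * x)
     + C * (1 + (cmod x)^4) + D * (cmod x)\<^sup>2"

lemma one_plus_cnj_mult_nonzero: assumes "cmod x < 1" "cmod z \<le> 1" shows "1 + cnj x * z \<noteq> 0"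
proof
  assume "1 + cnj x * z = 0"
  then have "cnj x * z = -1" by (simp add: add_eq_0_iff)
  then have "cmod x * cmod z = 1" by (metis complex_mod_cnj norm_mult norm_minus_cancel norm_one)
  moreover have "cmod x * cmod z \<le> cmod x * 1" by (rule mult_left_mono) (use assms in auto)
  ultimately show False using assms by linarith
qed

text \<open>Together with the factor |1 + cnj x z|^4 in \<open>chord_form_moebius\<close> this makes
  the quotient of \<open>gauge_form\<close> by (1 - |z|^2)^2 Moebius covariant.\<close>

lemma moeb_norm_sq:
  assumes "1 + cnj x * z \<noteq> 0"
  shows "1 - (cmod (moeb x z))\<^sup>2 = (1 - (cmod x)\<^sup>2) * (1 - (cmod z)\<^sup>2) / (cmod (1 + cnj x * z))\<^sup>2"
proof -
  have "(cmod (1 + cnj x * z))\<^sup>2 - (cmod (z + x))\<^sup>2 = (1 - (cmod x)\<^sup>2) * (1 - (cmod z)\<^sup>2)"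
    unfolding cmod_power2 by (simp add: power2_eq_square algebra_simps)
  then show ?thesis using assms
    by (simp add: moeb_def norm_divide power_divide divide_simps)
qed

lemma moeb_circle: assumes "cmod x < 1" "cmod z = 1" shows "cmod (moeb x z) = 1"
  using moeb_norm_sq[OF one_plus_cnj_mult_nonzero[of x z]] assms norm_ge_zero[of "moeb x z"]
  by (auto simp: power2_eq_1_iff)

lemma moeb_disc: assumes "cmod x < 1" "cmod z < 1" shows "cmod (moeb x z) < 1"
proof -
  have n: "1 + cnj x * z \<noteq> 0" using assms one_plus_cnj_mult_nonzero by simp
  have "(cmod x)\<^sup>2 < 1" "(cmod z)\<^sup>2 < 1" using assms by (simp_all add: power_less_one_iff)
  then have "1 - (cmod (moeb x z))\<^sup>2 > 0"
    unfolding moeb_norm_sq[OF n] using n by (intro divide_pos_pos mult_pos_pos) auto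
  then show ?thesis by (simp add: power_less_one_iff)
qed

lemma moeb_inverse: assumes "cmod x < 1" "cmod z \<le> 1" shows "moeb (- x) (moeb x z) = z"
proof -
  have n: "1 + cnj x * z \<noteq> 0" using assms one_plus_cnj_mult_nonzero by simp
  have c: "1 - cnj x * x \<noteq> 0" using one_plus_cnj_mult_nonzero[of "-x" x] assms by simp
  have 1: "moeb x z - x = z * (1 - cnj x * x) / (1 + cnj x * z)" using n by (simp add: moeb_def field_simps)
  have 2: "1 - cnj x * moeb x z = (1 - cnj x * x) / (1 + cnj x * z)" using n by (simp add: moeb_def field_simps)
  show ?thesis unfolding moeb_def[of "-x"] using 1 2 n c by simp
qed

lemma moeb_inverse': "cmod x < 1 \<Longrightarrow> cmod z \<le> 1 \<Longrightarrow> moeb x (moeb (- x) z) = z"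
  using moeb_inverse[of "-x" z] by simp

lemma chord_form_commute: "chord_form A B C D z w = chord_form A B C D w z"
  by (simp add: chord_form_def algebra_simps)

text \<open>With x and \<open>cnj x\<close> treated as independent, later identities about
  \<open>gauge_form\<close> become polynomial ones.\<close>

lemma of_real_gauge_form:
  "of_real (gauge_form A B C D x) = A * x\<^sup>2 + B * x * (1 + x * cnj x) + of_real C * (1 + (x * cnj x)\<^sup>2)
     + of_real D * (x * cnj x) + cnj B * cnj x * (1 + x * cnj x) + cnj A * (cnj x)\<^sup>2"
proof -
  have 1: "complex_of_real (2 * Re (A * x\<^sup>2)) = A * x\<^sup>2 + cnj A * (cnj x)\<^sup>2"
    using complex_add_cnj[of "A * x\<^sup>2"] by simp
  have 2: "complex_of_real (2 * Re (B * x)) = B * x + cnj B * cnj x"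
    using complex_add_cnj[of "B * x"] by simp
  have 3: "complex_of_real ((cmod x)\<^sup>2) = x * cnj x" by (rule complex_norm_square)
  have 4: "complex_of_real ((cmod x)^4) = (x * cnj x)\<^sup>2"
    unfolding 3[symmetric] by (simp flip: of_real_power)
  have "complex_of_real (gauge_form A B C D x) = complex_of_real (2 * Re (A * x\<^sup>2))
     + (1 + complex_of_real ((cmod x)\<^sup>2)) * complex_of_real (2 * Re (B * x))
     + of_real C * (1 + complex_of_real ((cmod x)^4)) + of_real D * complex_of_real ((cmod x)\<^sup>2)"
    unfolding of_real_mult[symmetric] of_real_add[symmetric] of_real_1[symmetric, where 'a = complex] of_real_eq_iff gauge_form_def by algebra
  then show ?thesis unfolding 1 2 3 4 by (simp only: algebra_simps power2_eq_square)
qed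

lemma chord_form_diag: assumes "cmod z = 1"
  shows "chord_form A B C D z z = z\<^sup>2 * of_real (gauge_form A B C D z)"
proof -
  have "z * cnj z = 1" using assms complex_norm_square[of z] by simp
  then show ?thesis unfolding of_real_gauge_form chord_form_def by algebra
qed

text \<open>Moebius substitution preserves this family of real forms once the denominators are
  cleared; the witnesses are the coefficients of the expansion.\<close>

lemma chord_form_moebius:
  obtains A' B' C' D' where
    "\<And>z w. 1 + cnj x * z \<noteq> 0 \<Longrightarrow> 1 + cnj x * w \<noteq> 0 \<Longrightarrow>
       chord_form A' B' C' D' z w = chord_form A B C D (moeb x z) (moeb x w) * (1 + cnj x * z)\<^sup>2 * (1 + cnj x * w)\<^sup>2"
    "\<And>z. 1 + cnj x * z \<noteq> 0 \<Longrightarrow>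
       gauge_form A' B' C' D' z = gauge_form A B C D (moeb x z) * (cmod (1 + cnj x * z))^4"
proof
  define q where "q = 1 + (cmod x)\<^sup>2"
  have q: "complex_of_real q = 1 + x * cnj x" by (simp add: q_def complex_norm_square[symmetric] del: of_real_power)
  define A' where "A' = A + 2 * B * cnj x + 2 * of_real C * (cnj x)\<^sup>2 + of_real D * (cnj x)\<^sup>2 + 2 * cnj B * (cnj x)^3 + cnj A * (cnj x)^4"
  define B' where "B' = 2 * A * x + B * (1 + 3 * x * cnj x) + 2 * of_real C * (cnj x + x * (cnj x)\<^sup>2)
    + of_real D * cnj x * (1 + x * cnj x) + cnj B * (3 * (cnj x)\<^sup>2 + (cnj x)^3 * x) + 2 * cnj A * (cnj x)^3"
  \<comment> \<open>A gauge form takes the value of its coefficient C at 0, and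
    \<open>moeb x 0 = x\<close>.\<close>
  define C' where "C' = gauge_form A B C D x"
  define D' where "D' = 8 * Re (A * x\<^sup>2) + 8 * q * Re (B * x) + 8 * C * (cmod x)\<^sup>2 + D * q\<^sup>2"
  have D': "complex_of_real D' = 4 * (A * x\<^sup>2 + cnj A * (cnj x)\<^sup>2) + 4 * (1 + x * cnj x) * (B * x + cnj B * cnj x)
     + 8 * of_real C * (x * cnj x) + of_real D * (1 + x * cnj x)\<^sup>2"
  proof -
    have 1: "complex_of_real (2 * Re (A * x\<^sup>2)) = A * x\<^sup>2 + cnj A * (cnj x)\<^sup>2"
      using complex_add_cnj[of "A * x\<^sup>2"] by simp
    have 2: "complex_of_real (2 * Re (B * x)) = B * x + cnj B * cnj x"
      using complex_add_cnj[of "B * x"] by simp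
    have "complex_of_real D' = 4 * complex_of_real (2 * Re (A * x\<^sup>2)) + 4 * of_real q * complex_of_real (2 * Re (B * x))
       + 8 * of_real C * of_real ((cmod x)\<^sup>2) + of_real D * (of_real q)\<^sup>2"
      unfolding D'_def by simp
    then show ?thesis unfolding 1 2 q complex_norm_square .
  qed
  note C' = of_real_gauge_form[of A B C D x, folded C'_def]
  show "chord_form A' B' C' D' z w = chord_form A B C D (moeb x z) (moeb x w) * (1 + cnj x * z)\<^sup>2 * (1 + cnj x * w)\<^sup>2"
    if "1 + cnj x * z \<noteq> 0" "1 + cnj x * w \<noteq> 0" for z w
  proof -
    define n m where "n = 1 + cnj x * z" "m = 1 + cnj x * w"
    note nm = this
    define Z W where "Z = moeb x z" "W = moeb x w"
    note ZW = this
    have ZW': "Z * n = z + x" "W * m = w + x" using that by (simp_all add: ZW moeb_def nm)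
    \<comment> \<open>Homogenized: \<open>Z\<close> and \<open>W\<close> occur only in the products
      \<open>Z * n\<close> and \<open>W * m\<close>, which are polynomials, so no division
      remains.\<close>
    have "chord_form A B C D Z W * n\<^sup>2 * m\<^sup>2
       = A * (Z * n)\<^sup>2 * (W * m)\<^sup>2 + B * (Z * n) * (W * m) * ((Z * n) * m + (W * m) * n) + of_real C * ((Z * n)\<^sup>2 * m\<^sup>2 + (W * m)\<^sup>2 * n\<^sup>2)
     + of_real D * (Z * n) * (W * m) * n * m + cnj B * n * m * ((Z * n) * m + (W * m) * n) + cnj A * n\<^sup>2 * m\<^sup>2"
      unfolding chord_form_def by algebra
    also have "\<dots> = chord_form A' B' C' D' z w"
      unfolding ZW' unfolding nm chord_form_def C' D' A'_def B'_def complex_cnj_add complex_cnj_mult complex_cnj_power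
        complex_cnj_cnj complex_cnj_complex_of_real complex_cnj_numeral complex_cnj_one
      by algebra
    finally show ?thesis by (simp add: ZW nm)
  qed
  show "gauge_form A' B' C' D' z = gauge_form A B C D (moeb x z) * (cmod (1 + cnj x * z))^4"
    if "1 + cnj x * z \<noteq> 0" for z
  proof -
    define n m where "n = 1 + cnj x * z" "m = 1 + x * cnj z"
    note nm = this
    define Z W where "Z = moeb x z" "W = cnj (moeb x z)"
    note ZW = this
    have cZ: "cnj Z = W" by (simp add: ZW)
    have "m \<noteq> 0" using that by (metis nm(2) complex_cnj_add complex_cnj_mult complex_cnj_one complex_cnj_cnj complex_cnj_zero_iff)
    then have ZW': "Z * n = z + x" "W * m = cnj z + cnj x" using that by (simp_all add: ZW moeb_def nm)
    have "complex_of_real ((cmod (1 + cnj x * z))^4) = (of_real ((cmod (1 + cnj x * z))\<^sup>2))\<^sup>2"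
      by simp
    also have "\<dots> = n\<^sup>2 * m\<^sup>2" unfolding complex_norm_square nm by (simp add: power_mult_distrib)
    finally have "complex_of_real (gauge_form A B C D (moeb x z) * (cmod (1 + cnj x * z))^4)
       = of_real (gauge_form A B C D Z) * n\<^sup>2 * m\<^sup>2" by (simp add: ZW)
    also have "\<dots> = A * (Z * n)\<^sup>2 * m\<^sup>2 + B * (Z * n) * m * (n * m + (Z * n) * (W * m)) + of_real C * (n\<^sup>2 * m\<^sup>2 + (Z * n)\<^sup>2 * (W * m)\<^sup>2)
     + of_real D * (Z * n) * (W * m) * n * m + cnj B * (W * m) * n * (n * m + (Z * n) * (W * m)) + cnj A * (W * m)\<^sup>2 * n\<^sup>2"
      unfolding of_real_gauge_form cZ by algebra
    also have "\<dots> = of_real (gauge_form A' B' C' D' z)"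
      unfolding ZW' unfolding nm of_real_gauge_form C' D' A'_def B'_def complex_cnj_add complex_cnj_mult complex_cnj_power
        complex_cnj_cnj complex_cnj_complex_of_real complex_cnj_numeral complex_cnj_one
      by algebra
    finally show ?thesis by (simp only: of_real_eq_iff)
  qed
qed

lemma chord_form_rotate:
  assumes "cmod e = 1"
  shows "chord_form A B C D (e * z) (e * w) = e\<^sup>2 * chord_form (A * e\<^sup>2) (B * e) C D z w"
    and "gauge_form A B C D (e * z) = gauge_form (A * e\<^sup>2) (B * e) C D z"
proof -
  have "e * cnj e = 1" using assms complex_norm_square[of e] by simp
  then show "chord_form A B C D (e * z) (e * w) = e\<^sup>2 * chord_form (A * e\<^sup>2) (B * e) C D z w"
    unfolding chord_form_def complex_cnj_mult complex_cnj_power by algebra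
  show "gauge_form A B C D (e * z) = gauge_form (A * e\<^sup>2) (B * e) C D z"
    unfolding gauge_form_def using assms by (simp add: norm_mult power_mult_distrib mult_ac)
qed

text \<open>On the circle 1 / z = cnj z, and z w and z cnj w enter only through their real parts;
  the bilinear relation in cos and sin arises here.\<close>

lemma chord_form_axial:
  assumes "cmod z = 1" "cmod w = 1"
  shows "chord_form (of_real a) 0 c d z w
    = z * w * of_real (2 * ((c + a) * Re z * Re w + (c - a) * Im z * Im w) + d)"
proof -
  have z: "z * cnj z = 1" and w: "w * cnj w = 1" using assms complex_norm_square[of z] complex_norm_square[of w] by auto
  have 1: "2 * Re (z * cnj w) = 2 * (Re z * Re w + Im z * Im w)" by (simp add: algebra_simps)
  have 2: "2 * Re (z * w) = 2 * (Re z * Re w - Im z * Im w)" by (simp add: algebra_simps)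
  have "complex_of_real (2 * ((c + a) * Re z * Re w + (c - a) * Im z * Im w) + d)
     = of_real (c * (2 * Re (z * cnj w)) + a * (2 * Re (z * w)) + d)"
    unfolding 1 2 by (simp add: algebra_simps)
  also have "\<dots> = of_real c * (z * cnj w + cnj z * w) + of_real a * (z * w + cnj z * cnj w) + of_real d"
    using complex_add_cnj[of "z * cnj w"] complex_add_cnj[of "z * w"] by simp
  finally have e: "complex_of_real (2 * ((c + a) * Re z * Re w + (c - a) * Im z * Im w) + d) =
      of_real c * (z * cnj w + cnj z * w) + of_real a * (z * w + cnj z * cnj w) + of_real d" .
  show ?thesis unfolding e chord_form_def complex_cnj_zero complex_cnj_complex_of_real using z w by algebra
qed

section \<open>Normal form of a conic inside the circle\<close>

lemma continuous_on_gauge_form: "continuous_on S (gauge_form A B C D)"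
  unfolding gauge_form_def by (intro continuous_intros)

text \<open>The minimum over the disc of the Moebius-covariant quotient
  \<open>gauge_form x / (1 - |x|\<^sup>2)\<^sup>2\<close> is the common centre of the conic and the circle.\<close>
lemma gauge_form_minimum:
  assumes pos: "\<And>z. cmod z = 1 \<Longrightarrow> gauge_form A B C D z > 0"
  obtains x where "cmod x < 1"
    "\<And>z. cmod z < 1 \<Longrightarrow> gauge_form A B C D x * (1 - (cmod z)\<^sup>2)\<^sup>2 \<le> gauge_form A B C D z * (1 - (cmod x)\<^sup>2)\<^sup>2"
proof -
  let ?G = "gauge_form A B C D"
  \<comment> \<open>Sublevel set of the quotient at its value \<open>C\<close> at 0, with the
    denominator cleared so that it is visibly closed. By \<open>pos\<close> it avoids the circle,
    hence it is a compact subset of the open disc.\<close>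
  define K where "K = cball 0 1 \<inter> {z. ?G z \<le> C * (1 - (cmod z)\<^sup>2)\<^sup>2}"
  have "closed {z. ?G z \<le> C * (1 - (cmod z)\<^sup>2)\<^sup>2}"
    by (rule closed_Collect_le) (rule continuous_on_gauge_form, intro continuous_intros)
  then have "compact K" unfolding K_def by (intro compact_Int_closed) auto
  have "0 \<in> K" by (simp add: K_def gauge_form_def)
  have Kd: "cmod z < 1" if "z \<in> K" for z
  proof (rule ccontr)
    assume "\<not> cmod z < 1"
    then have "cmod z = 1" using that by (simp add: K_def)
    then show False using pos[of z] that by (simp add: K_def)
  qed
  have p: "(1 - (cmod z)\<^sup>2)\<^sup>2 > 0" if "cmod z < 1" for z
  proof -
    have "(cmod z)\<^sup>2 < 1" using that by (simp add: power_less_one_iff)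
    then show ?thesis by simp
  qed
  have cont: "continuous_on K (\<lambda>z. ?G z / (1 - (cmod z)\<^sup>2)\<^sup>2)"
  proof (rule continuous_on_divide)
    show "continuous_on K ?G" by (rule continuous_on_gauge_form)
    show "continuous_on K (\<lambda>z. (1 - (cmod z)\<^sup>2)\<^sup>2)" by (intro continuous_intros)
    show "\<forall>z\<in>K. (1 - (cmod z)\<^sup>2)\<^sup>2 \<noteq> 0" using p[OF Kd] by (metis less_irrefl)
  qed
  have "K \<noteq> {}" using \<open>0 \<in> K\<close> by auto
  obtain x where x: "x \<in> K" "\<And>z. z \<in> K \<Longrightarrow> ?G x / (1 - (cmod x)\<^sup>2)\<^sup>2 \<le> ?G z / (1 - (cmod z)\<^sup>2)\<^sup>2"
    using continuous_attains_inf[OF \<open>compact K\<close> \<open>K \<noteq> {}\<close> cont] by blast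
  have "?G x / (1 - (cmod x)\<^sup>2)\<^sup>2 \<le> ?G z / (1 - (cmod z)\<^sup>2)\<^sup>2" if "cmod z < 1" for z
  proof (cases "z \<in> K")
    case False
    have "?G x / (1 - (cmod x)\<^sup>2)\<^sup>2 \<le> C" using p[OF Kd[OF x(1)]] x(1) by (simp add: K_def divide_le_eq)
    also have "C \<le> ?G z / (1 - (cmod z)\<^sup>2)\<^sup>2" using p[OF that] False that by (simp add: K_def le_divide_eq)
    finally show ?thesis .
  qed (use x in auto)
  then have "?G x * (1 - (cmod z)\<^sup>2)\<^sup>2 \<le> ?G z * (1 - (cmod x)\<^sup>2)\<^sup>2" if "cmod z < 1" for z
  proof -
    define X Z where "X = (1 - (cmod x)\<^sup>2)\<^sup>2" "Z = (1 - (cmod z)\<^sup>2)\<^sup>2"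
    have XZ: "X > 0" "Z > 0" using p[OF that] p[OF Kd[OF x(1)]] by (simp_all add: X_Z_def)
    assume "\<And>z. cmod z < 1 \<Longrightarrow> ?G x / (1 - (cmod x)\<^sup>2)\<^sup>2 \<le> ?G z / (1 - (cmod z)\<^sup>2)\<^sup>2"
    then have "?G x / X \<le> ?G z / Z" using that by (simp add: X_Z_def)
    then show ?thesis unfolding X_Z_def[symmetric] using XZ by (simp add: divide_simps)
  qed
  then show ?thesis using that Kd x(1) by blast
qed

lemma ex_unit_rotation: obtains e where "cmod e = 1" "b * e = - complex_of_real (cmod b)"
proof (cases "b = 0")
  case False
  then show ?thesis using that[of "- complex_of_real (cmod b) / b"] by (simp add: norm_divide)
qed (use that[of 1] in auto)

lemma ex_unit_square_rotation: obtains e where "cmod e = 1" "a * e\<^sup>2 = complex_of_real (cmod a)"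
proof -
  obtain e where e: "cmod e = 1" "a * e = - complex_of_real (cmod a)" by (rule ex_unit_rotation)
  define f where "f = csqrt (- e)"
  have f: "f\<^sup>2 = - e" by (simp add: f_def)
  then have "(cmod f)\<^sup>2 = 1" using e(1) by (metis norm_power norm_minus_cancel)
  then have "cmod f = 1" using norm_ge_zero[of f] by (auto simp: power2_eq_1_iff)
  then show ?thesis using that[of f] f e(2) by simp
qed

text \<open>The linear part at 0 is 2 Re (B z); if B were nonzero, a small step with B z negative
  would go below the bound.\<close>

lemma gauge_form_min_at_zero:
  assumes "\<And>z. cmod z < 1 \<Longrightarrow> C * (1 - (cmod z)\<^sup>2)\<^sup>2 \<le> gauge_form A B C D z"
  shows "B = 0"
proof (rule ccontr)
  assume "B \<noteq> 0"
  obtain e where e: "cmod e = 1" "B * e = - complex_of_real (cmod B)" by (rule ex_unit_rotation)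
  \<comment> \<open>\<open>M\<close> bounds the coefficient of r^2, including the 2 C that comes
    from expanding (1 - r^2)^2 on the other side; r M \<le> |B| lets the linear term
    dominate.\<close>
  define M where "M = 2 * \<bar>Re (A * e\<^sup>2)\<bar> + 2 * \<bar>C\<bar> + \<bar>D\<bar> + 1"
  have M: "M > 0" by (simp add: M_def add_nonneg_pos)
  define r where "r = min (1/2) (cmod B / M)"
  have r: "0 < r" "r < 1" "r * M \<le> cmod B" using M \<open>B \<noteq> 0\<close> by (auto simp: r_def min_def field_simps)
  have "C * (1 - (cmod (of_real r * e))\<^sup>2)\<^sup>2 \<le> gauge_form A B C D (of_real r * e)"
    using r by (intro assms) (simp add: norm_mult e)
  moreover have "cmod (of_real r * e) = r" using r e by (simp add: norm_mult)
  moreover have "Re (A * (of_real r * e)\<^sup>2) = r\<^sup>2 * Re (A * e\<^sup>2)"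
  proof -
    have "A * (of_real r * e)\<^sup>2 = of_real (r\<^sup>2) * (A * e\<^sup>2)" by (simp add: power_mult_distrib)
    then show ?thesis by (simp only: Re_complex_of_real times_complex.sel Im_complex_of_real)
  qed
  moreover have "Re (B * (of_real r * e)) = - r * cmod B"
  proof -
    have "B * (of_real r * e) = of_real r * (B * e)" by simp
    also have "\<dots> = of_real (- r * cmod B)" unfolding e(2) by simp
    finally have "B * (of_real r * e) = of_real (- r * cmod B)" .
    then show ?thesis by simp
  qed
  ultimately have "C * (1 - r\<^sup>2)\<^sup>2 \<le> 2 * (r\<^sup>2 * Re (A * e\<^sup>2)) + 2 * (1 + r\<^sup>2) * (- r * cmod B) + C * (1 + r^4) + D * r\<^sup>2"
    by (simp add: gauge_form_def)
  then have "0 \<le> r * (r * (2 * Re (A * e\<^sup>2) + 2 * C + D) - 2 * (1 + r\<^sup>2) * cmod B)"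
    by (simp add: algebra_simps power2_eq_square power4_eq_xxxx)
  then have "2 * (1 + r\<^sup>2) * cmod B \<le> r * (2 * Re (A * e\<^sup>2) + 2 * C + D)"
    using r by (simp add: zero_le_mult_iff)
  also have "\<dots> \<le> r * M" using r abs_ge_self[of "Re (A * e\<^sup>2)"] abs_ge_self[of C] abs_ge_self[of D]
    unfolding M_def by (intro mult_left_mono) linarith+
  finally have "2 * (1 + r\<^sup>2) * cmod B \<le> cmod B" using r by simp
  moreover have "0 \<le> r\<^sup>2 * cmod B" by simp
  ultimately have "cmod B \<le> 0" unfolding distrib_left distrib_right by linarith
  then show False using \<open>B \<noteq> 0\<close> by simp
qed

text \<open>Moving the minimizer to the origin removes B, and a rotation makes A real and
  nonnegative.\<close>

lemma chord_form_normalize: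
  assumes pos: "\<And>z. cmod z = 1 \<Longrightarrow> gauge_form A B C D z > 0"
  obtains x e a c d where "cmod x < 1" "cmod e = 1" "0 \<le> a" "2 * c + d > 2 * a"
    "\<And>z w. cmod z = 1 \<Longrightarrow> cmod w = 1 \<Longrightarrow> chord_form A B C D (moeb x (e * z)) (moeb x (e * w)) = 0
       \<longleftrightarrow> 2 * ((c + a) * Re z * Re w + (c - a) * Im z * Im w) + d = 0"
proof -
  obtain x where x: "cmod x < 1" and
    min: "\<And>z. cmod z < 1 \<Longrightarrow> gauge_form A B C D x * (1 - (cmod z)\<^sup>2)\<^sup>2 \<le> gauge_form A B C D z * (1 - (cmod x)\<^sup>2)\<^sup>2"
    using gauge_form_minimum[OF pos] by blast
  obtain A' B' C' D' where form: "\<And>z w. 1 + cnj x * z \<noteq> 0 \<Longrightarrow> 1 + cnj x * w \<noteq> 0 \<Longrightarrow>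
       chord_form A' B' C' D' z w = chord_form A B C D (moeb x z) (moeb x w) * (1 + cnj x * z)\<^sup>2 * (1 + cnj x * w)\<^sup>2"
    and gauge: "\<And>z. 1 + cnj x * z \<noteq> 0 \<Longrightarrow>
       gauge_form A' B' C' D' z = gauge_form A B C D (moeb x z) * (cmod (1 + cnj x * z))^4"
    using chord_form_moebius[of x A B C D] by metis
  have n0: "1 + cnj x * z \<noteq> 0" if "cmod z \<le> 1" for z using one_plus_cnj_mult_nonzero[OF x that] .
  have C': "C' = gauge_form A B C D x"
    using gauge[of 0] by (simp add: gauge_form_def moeb_def)
  have "B' = 0"
  proof (rule gauge_form_min_at_zero)
    fix z assume z: "cmod z < 1"
    define n where "n = cmod (1 + cnj x * z)"
    have n: "n > 0" using n0[of z] z by (simp add: n_def)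
    have xp: "(1 - (cmod x)\<^sup>2)\<^sup>2 > 0" using power_less_one_iff[of "cmod x" 2] x by simp
    have "C' * (1 - (cmod (moeb x z))\<^sup>2)\<^sup>2 \<le> gauge_form A B C D (moeb x z) * (1 - (cmod x)\<^sup>2)\<^sup>2"
      unfolding C' by (rule min) (use moeb_disc x z in auto)
    also have "1 - (cmod (moeb x z))\<^sup>2 = (1 - (cmod x)\<^sup>2) * (1 - (cmod z)\<^sup>2) / n\<^sup>2"
      unfolding n_def using moeb_norm_sq n0[of z] z by simp
    finally have "(1 - (cmod x)\<^sup>2)\<^sup>2 * (C' * (1 - (cmod z)\<^sup>2)\<^sup>2 / n^4) \<le> (1 - (cmod x)\<^sup>2)\<^sup>2 * gauge_form A B C D (moeb x z)"
      by (simp add: power_mult_distrib power_divide mult_ac)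
    then have "C' * (1 - (cmod z)\<^sup>2)\<^sup>2 / n^4 \<le> gauge_form A B C D (moeb x z)"
      using xp mult_le_cancel_left_pos by blast
    then have "C' * (1 - (cmod z)\<^sup>2)\<^sup>2 \<le> gauge_form A B C D (moeb x z) * n^4"
      using n by (simp add: divide_le_eq)
    then show "C' * (1 - (cmod z)\<^sup>2)\<^sup>2 \<le> gauge_form A' B' C' D' z"
      using gauge n0[of z] z by (simp add: n_def)
  qed
  obtain e where e: "cmod e = 1" "A' * e\<^sup>2 = complex_of_real (cmod A')" by (rule ex_unit_square_rotation)
  show ?thesis
  proof (rule that[OF x e(1)])
    show "0 \<le> cmod A'" by simp
    have i: "(\<i> * e)\<^sup>2 = - (e\<^sup>2)" by (simp add: power_mult_distrib)
    \<comment> \<open>At \<i> e the term A' z^2 equals - |A'|, its smallest real part on the circle,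
      so positivity there is the claimed inequality.\<close>
    have "gauge_form A' B' C' D' (\<i> * e) > 0"
      unfolding gauge[OF n0[of "\<i> * e", simplified norm_mult e(1), simplified]]
      by (intro mult_pos_pos pos moeb_circle x zero_less_power) (use n0[of "\<i> * e"] e in \<open>auto simp: norm_mult\<close>)
    then show "2 * C' + D' > 2 * cmod A'" using e \<open>B' = 0\<close> by (simp add: gauge_form_def norm_mult i)
    fix z w assume zw: "cmod z = 1" "cmod w = 1"
    have n: "1 + cnj x * (e * z) \<noteq> 0" "1 + cnj x * (e * w) \<noteq> 0" using n0 zw e by (auto simp: norm_mult)
    have "chord_form A B C D (moeb x (e * z)) (moeb x (e * w)) = 0 \<longleftrightarrow> chord_form A' B' C' D' (e * z) (e * w) = 0"
      using form[OF n] n by simp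
    also have "\<dots> \<longleftrightarrow> chord_form (of_real (cmod A')) 0 C' D' z w = 0"
      using chord_form_rotate(1)[OF e(1), of A' B' C' D' z w] e \<open>B' = 0\<close> by auto
    also have "\<dots> \<longleftrightarrow> 2 * ((C' + cmod A') * Re z * Re w + (C' - cmod A') * Im z * Im w) + D' = 0"
      unfolding chord_form_axial[OF zw] using zw by (auto simp del: of_real_add of_real_mult)
    finally show "chord_form A B C D (moeb x (e * z)) (moeb x (e * w)) = 0 \<longleftrightarrow>
       2 * ((C' + cmod A') * Re z * Re w + (C' - cmod A') * Im z * Im w) + D' = 0" .
  qed
qed

lemma unit_eqI: assumes "cmod z = 1" "cmod w = 1" "Re z = Re w" "Im z = Im w \<or> Im z = 0 \<or> Im w = 0 \<or> Im z * Im w > 0" shows "z = w"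
proof -
  have "(Im z)\<^sup>2 = (Im w)\<^sup>2" using assms cmod_power2[of z] cmod_power2[of w] by simp
  then have "Im z = Im w \<or> Im z = - Im w" by (simp add: power2_eq_iff)
  then show ?thesis using assms(3,4) by (auto simp: complex_eq_iff mult_less_0_iff zero_less_mult_iff)
qed

text \<open>A vertical line that meets the circle in two distinct points has distance less than 1
  from the origin.\<close>

lemma two_points_bound:
  assumes "cmod z = 1" "cmod w = 1" "z \<noteq> w" "m * Re z = p" "m * Re w = p" "m \<noteq> 0"
  shows "\<bar>p\<bar> < \<bar>m\<bar>"
proof -
  have eq: "Re z = Re w" using assms by (metis mult_cancel_left)
  then have "Im z \<noteq> 0" using unit_eqI[of z w] assms by auto
  then have "(Re z)\<^sup>2 < 1" using assms(1) cmod_power2[of z] by (metis less_add_same_cancel1 one_power2 zero_less_power2)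
  then have "\<bar>Re z\<bar> < 1" by (simp add: abs_square_less_1)
  then have "\<bar>m\<bar> * \<bar>Re z\<bar> < \<bar>m\<bar> * 1" using assms(6) by (intro mult_strict_left_mono) auto
  then show ?thesis using assms(4) by (metis abs_mult mult.right_neutral)
qed

text \<open>If the conic has two tangents from every point of the circle, the normalized relation is the
  addition relation of Jacobi's elliptic functions, with \<open>\<delta> = dn\<close> and \<open>\<eta> = cn\<close>.\<close>
lemma chord_form_jacobi:
  assumes pos: "\<And>z. cmod z = 1 \<Longrightarrow> gauge_form A B C D z > 0"
    and two: "\<And>z. cmod z = 1 \<Longrightarrow> \<exists>w v. cmod w = 1 \<and> cmod v = 1 \<and> w \<noteq> v
        \<and> chord_form A B C D z w = 0 \<and> chord_form A B C D z v = 0"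
  obtains x e \<delta> \<eta> where "cmod x < 1" "cmod e = 1" "\<delta> \<le> 1" "\<bar>\<eta>\<bar> < \<delta>"
    "\<And>z w. cmod z = 1 \<Longrightarrow> cmod w = 1 \<Longrightarrow> chord_form A B C D (moeb x (e * z)) (moeb x (e * w)) = 0
       \<longleftrightarrow> Re z * Re w + Im z * Im w * \<delta> = \<eta>"
proof -
  obtain x e a c d where x: "cmod x < 1" and e: "cmod e = 1" and a: "0 \<le> a" and acd: "2 * c + d > 2 * a" and
    iff: "\<And>z w. cmod z = 1 \<Longrightarrow> cmod w = 1 \<Longrightarrow> chord_form A B C D (moeb x (e * z)) (moeb x (e * w)) = 0
       \<longleftrightarrow> 2 * ((c + a) * Re z * Re w + (c - a) * Im z * Im w) + d = 0"
    by (rule chord_form_normalize[OF pos]) blast+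
  have two': "\<exists>w v. cmod w = 1 \<and> cmod v = 1 \<and> w \<noteq> v
     \<and> 2 * ((c + a) * Re z * Re w + (c - a) * Im z * Im w) + d = 0
     \<and> 2 * ((c + a) * Re z * Re v + (c - a) * Im z * Im v) + d = 0" if z: "cmod z = 1" for z
  proof -
    have "cmod (moeb x (e * z)) = 1" by (rule moeb_circle) (use x e z in \<open>auto simp: norm_mult\<close>)
    from two[OF this] obtain w v where wv: "cmod w = 1" "cmod v = 1" "w \<noteq> v"
       "chord_form A B C D (moeb x (e * z)) w = 0" "chord_form A B C D (moeb x (e * z)) v = 0" by blast
    define w' v' where "w' = moeb (-x) w / e" "v' = moeb (-x) v / e"
    have w': "moeb x (e * w') = w" "moeb x (e * v') = v"
      using moeb_inverse'[OF x] wv e by (auto simp: w'_v'_def)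
    have "cmod w' = 1" "cmod v' = 1" using moeb_circle[of "-x"] wv x e by (auto simp: w'_v'_def norm_divide)
    then show ?thesis using wv w' iff[OF z] by metis
  qed
  \<comment> \<open>From the point 1 the relation fixes the real parts of both neighbours; from
    \<i>, in \<open>c2\<close>, it fixes their imaginary parts.\<close>
  have c1: "\<bar>d / 2\<bar> < \<bar>c + a\<bar>"
  proof -
    obtain w v where *: "cmod w = 1" "cmod v = 1" "w \<noteq> v" "(c + a) * Re w = - d / 2" "(c + a) * Re v = - d / 2"
      using two'[of 1] by (auto simp: algebra_simps)
    have "c + a \<noteq> 0"
    proof
      assume "c + a = 0"
      then have "d = 0" using *(4) by auto
      then show False using \<open>c + a = 0\<close> acd a by auto
    qed
    then show ?thesis using two_points_bound[OF *] by simp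
  qed
  have c2: "\<bar>d / 2\<bar> < \<bar>c - a\<bar>"
  proof -
    obtain w v where *: "cmod w = 1" "cmod v = 1" "w \<noteq> v" "(c - a) * Im w = - d / 2" "(c - a) * Im v = - d / 2"
      using two'[of \<i>] by (auto simp: algebra_simps)
    have "c - a \<noteq> 0"
    proof
      assume "c - a = 0"
      then have "d = 0" using *(4) by auto
      then show False using \<open>c - a = 0\<close> acd by auto
    qed
    then show ?thesis using two_points_bound[of "-\<i> * w" "-\<i> * v" "c - a" "- d / 2"] * by (simp add: norm_mult)
  qed
  \<comment> \<open>A negative c - a would lie below - d / 2 by \<open>c2\<close>, against
    \<open>acd\<close>; this settles the signs.\<close>
  have ca: "\<bar>d / 2\<bar> < c - a" using c1 c2 acd a by linarith
  have cp: "c + a > 0" using ca a by linarith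
  show ?thesis
  proof (rule that[OF x e])
    show "(c - a) / (c + a) \<le> 1" using cp a by simp
    have "\<bar>- d / 2\<bar> / (c + a) < (c - a) / (c + a)" using ca cp by (intro divide_strict_right_mono) auto
    then show "\<bar>(- d / 2) / (c + a)\<bar> < (c - a) / (c + a)" using cp by simp
    fix z w assume zw: "cmod z = 1" "cmod w = 1"
    define T where "T = (c + a) * Re z * Re w + (c - a) * Im z * Im w"
    have "Re z * Re w + Im z * Im w * ((c - a) / (c + a)) = T / (c + a)"
      unfolding T_def add_divide_distrib using cp by simp
    moreover have "T / (c + a) = (- d / 2) / (c + a) \<longleftrightarrow> T = - d / 2"
      using cp by (subst divide_cancel_right) auto
    ultimately show "chord_form A B C D (moeb x (e * z)) (moeb x (e * w)) = 0
       \<longleftrightarrow> Re z * Re w + Im z * Im w * ((c - a) / (c + a)) = (- d / 2) / (c + a)"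
      unfolding iff[OF zw] T_def[symmetric] by linarith
  qed
qed

text \<open>The converse passage: the relation is transported back by the inverse automorphism.
  Applied to the translation by j c it yields the conic of the j-th diagonals.\<close>

lemma chord_form_of_jacobi:
  assumes x: "cmod x < 1" and e: "cmod e = 1" and D: "0 < \<delta>" "\<delta> \<le> 1"
  obtains A B C D where "A \<noteq> 0 \<or> B \<noteq> 0 \<or> C \<noteq> 0 \<or> D \<noteq> 0"
    "\<And>z w. cmod z = 1 \<Longrightarrow> cmod w = 1 \<Longrightarrow> chord_form A B C D (moeb x (e * z)) (moeb x (e * w)) = 0
       \<longleftrightarrow> Re z * Re w + Im z * Im w * \<delta> = \<eta>"
proof -
  \<comment> \<open>Chosen so that c + a = 1, c - a = \<delta> and d = - 2 \<eta> in
    \<open>chord_form_axial\<close>.\<close>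
  define a c d where "a = (1 - \<delta>) / 2" "c = (1 + \<delta>) / 2" "d = - 2 * \<eta>"
  note acd = this
  have inv: "cmod (cnj e) = 1" "cnj e * e = 1" using e complex_norm_square[of e] by (auto simp: mult.commute)
  define A1 where "A1 = complex_of_real a * (cnj e)\<^sup>2"
  have rot: "chord_form (of_real a) 0 c d (cnj e * z) (cnj e * w) = (cnj e)\<^sup>2 * chord_form A1 0 c d z w" for z w
    using chord_form_rotate(1)[OF inv(1), of "of_real a" 0 c d z w] by (simp add: A1_def)
  obtain A B C D where form: "\<And>z w. 1 - cnj x * z \<noteq> 0 \<Longrightarrow> 1 - cnj x * w \<noteq> 0 \<Longrightarrow>
       chord_form A B C D z w = chord_form A1 0 c d (moeb (-x) z) (moeb (-x) w) * (1 - cnj x * z)\<^sup>2 * (1 - cnj x * w)\<^sup>2"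
    using chord_form_moebius[of "-x" A1 0 c d] by (auto simp: mult_ac) metis
  have main: "chord_form A B C D (moeb x (e * z)) (moeb x (e * w)) = 0
       \<longleftrightarrow> Re z * Re w + Im z * Im w * \<delta> = \<eta>" if zw: "cmod z = 1" "cmod w = 1" for z w
  proof -
    have c: "cmod (e * z) = 1" "cmod (e * w) = 1" using zw e by (auto simp: norm_mult)
    have n: "1 - cnj x * moeb x (e * z) \<noteq> 0" "1 - cnj x * moeb x (e * w) \<noteq> 0"
      using one_plus_cnj_mult_nonzero[of "-x"] moeb_circle[OF x c(1)] moeb_circle[OF x c(2)] x by auto
    have "chord_form A B C D (moeb x (e * z)) (moeb x (e * w)) = 0 \<longleftrightarrow> chord_form A1 0 c d (e * z) (e * w) = 0"
      using form[OF n] n moeb_inverse[OF x] c by simp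
    also have "\<dots> \<longleftrightarrow> chord_form (of_real a) 0 c d z w = 0"
      using rot[of "e * z" "e * w"] inv by (auto simp: mult.assoc[symmetric])
    also have "\<dots> \<longleftrightarrow> 2 * ((c + a) * Re z * Re w + (c - a) * Im z * Im w) + d = 0"
      unfolding chord_form_axial[OF zw] using zw by (auto simp del: of_real_add of_real_mult)
    also have "\<dots> \<longleftrightarrow> Re z * Re w + Im z * Im w * \<delta> = \<eta>" unfolding acd by (auto simp: field_simps)
    finally show ?thesis .
  qed
  have "A \<noteq> 0 \<or> B \<noteq> 0 \<or> C \<noteq> 0 \<or> D \<noteq> 0"
  proof (rule ccontr)
    assume "\<not> ?thesis"
    then have "chord_form A B C D u v = 0" for u v by (simp add: chord_form_def)
    \<comment> \<open>A vanishing form would force both \<eta> = 1 and \<eta> = - 1, from the pairs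
      (1, 1) and (1, - 1).\<close>
    then show False using main[of 1 1] main[of 1 "-1"] by simp
  qed
  then show ?thesis using main that by blast
qed

section \<open>Poncelet orbits\<close>

text \<open>A closed N-gon with distinct vertices whose sides satisfy the form. The orientation is
  left open, so both senses of traversal count.\<close>

definition poncelet_orbit :: "nat \<Rightarrow> complex \<Rightarrow> complex \<Rightarrow> real \<Rightarrow> real \<Rightarrow> (nat \<Rightarrow> complex) \<Rightarrow> bool" where
  "poncelet_orbit N A B C D y \<longleftrightarrow> (\<forall>j. cmod (y j) = 1) \<and> (\<forall>i j. y i = y j \<longleftrightarrow> i mod N = j mod N)
     \<and> (\<forall>j. chord_form A B C D (y j) (y (Suc j)) = 0)"

lemma mod_add_left_cancel_nat: "((i::nat) + a) mod n = (i + b) mod n \<longleftrightarrow> a mod n = b mod n"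
proof -
  have "int ((i + a) mod n) = int ((i + b) mod n) \<longleftrightarrow> int (a mod n) = int (b mod n)"
    by (simp add: zmod_int mod_eq_dvd_iff)
  then show ?thesis by simp
qed

lemma poncelet_orbit_shift: "poncelet_orbit N A B C D y \<Longrightarrow> poncelet_orbit N A B C D (\<lambda>j. y (i + j))"
  unfolding poncelet_orbit_def by (simp add: mod_add_left_cancel_nat)

text \<open>Serves both halves of the theorem: the M-th step gives the point curve and the
  decomposition, the nonzero forms give the ellipses.\<close>

lemma poncelet_orbits_closed_form:
  assumes M: "M \<ge> 2"
    and pos: "\<And>z. cmod z = 1 \<Longrightarrow> gauge_form A B C D z > 0"
    and orbits: "\<And>z. cmod z = 1 \<Longrightarrow> \<exists>y. y 0 = z \<and> poncelet_orbit (2 * M) A B C D y"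
  obtains x e \<delta> \<eta> where "cmod x < 1" "cmod e = 1" "\<delta> \<le> 1" "\<bar>\<eta>\<bar> < \<delta>"
    "\<And>z w. cmod z = 1 \<Longrightarrow> cmod w = 1 \<Longrightarrow> chord_form A B C D (moeb x (e * z)) (moeb x (e * w)) = 0
       \<longleftrightarrow> Re z * Re w + Im z * Im w * \<delta> = \<eta>"
    "\<And>y. poncelet_orbit (2 * M) A B C D y \<Longrightarrow> moeb (- x) (y M) = - moeb (- x) (y 0)"
    "\<And>j. \<exists>A' B' C' D'. (A' \<noteq> 0 \<or> B' \<noteq> 0 \<or> C' \<noteq> 0 \<or> D' \<noteq> 0) \<and>
       (\<forall>y. poncelet_orbit (2 * M) A B C D y \<longrightarrow> chord_form A' B' C' D' (y 0) (y j) = 0)"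
proof -
  let ?N = "2 * M"
  have two: "\<exists>w v. cmod w = 1 \<and> cmod v = 1 \<and> w \<noteq> v \<and> chord_form A B C D z w = 0 \<and> chord_form A B C D z v = 0"
    if z: "cmod z = 1" for z
  proof -
    obtain y where y: "y 0 = z" "poncelet_orbit ?N A B C D y" using orbits[OF z] by blast
    \<comment> \<open>The two neighbours of \<open>y 0\<close>; they differ because the polygon has
      at least four vertices.\<close>
    have 1: "y (Suc 0) \<noteq> y (?N - 1)" using y(2) M unfolding poncelet_orbit_def by simp
    have 2: "chord_form A B C D z (y (Suc 0)) = 0" using y unfolding poncelet_orbit_def by metis
    have "y (Suc (?N - 1)) = y 0" using y(2) M unfolding poncelet_orbit_def by simp
    then have 3: "chord_form A B C D z (y (?N - 1)) = 0"
      using y unfolding poncelet_orbit_def by (metis chord_form_commute)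
    show ?thesis using 1 2 3 y(2) unfolding poncelet_orbit_def by blast
  qed
  obtain x e \<delta> \<eta> where x: "cmod x < 1" and e: "cmod e = 1" and \<delta>: "\<delta> \<le> 1" and \<eta>: "\<bar>\<eta>\<bar> < \<delta>" and
    iff: "\<And>z w. cmod z = 1 \<Longrightarrow> cmod w = 1 \<Longrightarrow> chord_form A B C D (moeb x (e * z)) (moeb x (e * w)) = 0
       \<longleftrightarrow> Re z * Re w + Im z * Im w * \<delta> = \<eta>"
    using chord_form_jacobi[OF pos two] by metis
  have \<eta>1: "\<eta>\<^sup>2 < 1" using \<delta> \<eta> by (simp add: abs_square_less_1)
  have \<delta>1: "0 < \<delta>" "\<delta>\<^sup>2 \<le> 1" "\<eta>\<^sup>2 < \<delta>\<^sup>2"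
    using \<delta> \<eta> abs_ge_zero[of \<eta>] power_strict_mono[of "\<bar>\<eta>\<bar>" \<delta> 2]
    by (auto intro!: power_le_one simp del: abs_ge_zero)
  \<comment> \<open>Forced by dn c = \<delta> and cn c = \<eta>: sn^2 = 1 - \<eta>^2 and k sn^2 = 1
    - \<delta>^2.\<close>
  define k where "k = (1 - \<delta>\<^sup>2) / (1 - \<eta>\<^sup>2)"
  interpret elliptic_circle k
    by unfold_locales (use \<eta>1 \<delta>1 in \<open>auto simp: k_def divide_simps\<close>)
  define c where "c = Complex \<eta> (sqrt (1 - \<eta>\<^sup>2))"
  have c: "cmod c = 1" using \<eta>1 by (simp add: c_def cmod_def)
  have Im_c: "Im c \<noteq> 0" using \<eta>1 by (simp add: c_def)
  have Re_c: "Re c = \<eta>" by (simp add: c_def)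
  have "1 - k * (Im c)\<^sup>2 = \<delta>\<^sup>2" using \<eta>1 by (simp add: c_def k_def)
  then have \<Delta>c: "ell_delta k c = \<delta>" using \<delta>1 by (simp add: ell_delta_def)
  define \<zeta> where "\<zeta> y j = moeb (- x) (y j) / e" for y :: "nat \<Rightarrow> complex" and j
  have \<zeta>_circle: "cmod (\<zeta> y j) = 1" and y_\<zeta>: "y j = moeb x (e * \<zeta> y j)" if "poncelet_orbit ?N A B C D y" for y j
  proof -
    have "cmod (y j) = 1" using that unfolding poncelet_orbit_def by blast
    then show "cmod (\<zeta> y j) = 1" "y j = moeb x (e * \<zeta> y j)"
      unfolding \<zeta>_def using moeb_circle[of "-x" "y j"] moeb_inverse'[OF x, of "y j"] x e by (auto simp: norm_divide)
  qed
  have closed: "\<exists>c'. (c' = c \<or> c' = cnj c) \<and> (\<forall>j. \<zeta> y j = ell_add k (\<zeta> y 0) (ell_mul k j c'))"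
    if y: "poncelet_orbit ?N A B C D y" for y
  proof -
    have rel: "Re (\<zeta> y j) * Re (\<zeta> y (Suc j)) + Im (\<zeta> y j) * Im (\<zeta> y (Suc j)) * ell_delta k c = Re c" for j
      unfolding \<Delta>c Re_c iff[OF \<zeta>_circle[OF y] \<zeta>_circle[OF y], symmetric] y_\<zeta>[OF y, symmetric]
      using y unfolding poncelet_orbit_def by blast
    have ne: "\<zeta> y (Suc (Suc j)) \<noteq> \<zeta> y j" for j
    proof
      assume "\<zeta> y (Suc (Suc j)) = \<zeta> y j"
      then have "y (Suc (Suc j)) = y j" using y_\<zeta>[OF y] by metis
      then have "(j + 2) mod ?N = (j + 0) mod ?N" using y unfolding poncelet_orbit_def by simp
      then have "2 mod ?N = 0 mod ?N" unfolding mod_add_left_cancel_nat .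
      then show False using M by simp
    qed
    show ?thesis using orbit_eq_mul[of "\<zeta> y", OF \<zeta>_circle[OF y] c Im_c rel ne] by metis
  qed
  show ?thesis
  proof (rule that[OF x e \<delta> \<eta> iff])
    fix y assume y: "poncelet_orbit ?N A B C D y"
    obtain c' where c': "c' = c \<or> c' = cnj c" and cl: "\<And>j. \<zeta> y j = ell_add k (\<zeta> y 0) (ell_mul k j c')" using closed[OF y] by blast
    have nc': "cmod c' = 1" using c' c by auto
    have "y ?N = y 0" using y unfolding poncelet_orbit_def by simp
    then have "ell_add k (\<zeta> y 0) (ell_mul k ?N c') = ell_add k (\<zeta> y 0) 1" using cl[of ?N] by (simp add: \<zeta>_def add_one)
    then have "ell_mul k ?N c' = 1" using add_eq_iff[OF \<zeta>_circle[OF y]] norm_mul[OF nc'] by simp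
    \<comment> \<open>Closing after 2 M steps makes the M-fold translation its own inverse;
      distinctness of the vertices excludes the identity.\<close>
    then have "ell_add k (ell_mul k M c') (ell_mul k M c') = 1" using mul_add[OF nc', of M M] by (simp add: mult_2)
    moreover have "ell_mul k M c' \<noteq> 1"
    proof
      assume "ell_mul k M c' = 1"
      then have "\<zeta> y M = \<zeta> y 0" using cl[of M] by (simp add: add_one)
      then have "y M = y 0" using y_\<zeta>[OF y] by metis
      then show False using y M unfolding poncelet_orbit_def by simp
    qed
    ultimately have "ell_mul k M c' = -1" using double_eq_one norm_mul[OF nc'] by blast
    then have "\<zeta> y M = - \<zeta> y 0" using cl[of M] by (simp add: add_minus_one)
    moreover have "e \<noteq> 0" using e by auto
    ultimately show "moeb (- x) (y M) = - moeb (- x) (y 0)" by (simp add: \<zeta>_def divide_simps)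
  next
    fix j
    have Dj: "0 < ell_delta k (ell_mul k j c)" using delta_pos norm_mul c by blast
    have Dj1: "ell_delta k (ell_mul k j c) \<le> 1" unfolding ell_delta_def using k0 by simp
    obtain A' B' C' D' where nz: "A' \<noteq> 0 \<or> B' \<noteq> 0 \<or> C' \<noteq> 0 \<or> D' \<noteq> 0"
      and form: "\<And>z w. cmod z = 1 \<Longrightarrow> cmod w = 1 \<Longrightarrow> chord_form A' B' C' D' (moeb x (e * z)) (moeb x (e * w)) = 0
       \<longleftrightarrow> Re z * Re w + Im z * Im w * ell_delta k (ell_mul k j c) = Re (ell_mul k j c)"
      by (rule chord_form_of_jacobi[OF x e Dj Dj1, where \<eta> = "Re (ell_mul k j c)"]) (rule that)
    have "chord_form A' B' C' D' (y 0) (y j) = 0" if y: "poncelet_orbit ?N A B C D y" for y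
    proof -
      obtain c' where c': "c' = c \<or> c' = cnj c" and cl: "\<And>j. \<zeta> y j = ell_add k (\<zeta> y 0) (ell_mul k j c')" using closed[OF y] by blast
      have nc': "cmod (ell_mul k j c') = 1" using c' c norm_mul by auto
      have "Re (\<zeta> y 0) * Re (\<zeta> y j) + Im (\<zeta> y 0) * Im (\<zeta> y j) * ell_delta k (ell_mul k j c') = Re (ell_mul k j c')"
        using add_relation[OF \<zeta>_circle[OF y, of 0] nc'] cl[of j] by simp
      \<comment> \<open>Passing from c to \<open>cnj c\<close> changes neither \<open>Re\<close> nor
        \<open>ell_delta\<close>, so one form serves both orientations.\<close>
      then have "Re (\<zeta> y 0) * Re (\<zeta> y j) + Im (\<zeta> y 0) * Im (\<zeta> y j) * ell_delta k (ell_mul k j c) = Re (ell_mul k j c)"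
        using c' by (auto simp: mul_cnj delta_cnj)
      then show ?thesis using form[OF \<zeta>_circle[OF y] \<zeta>_circle[OF y]] y_\<zeta>[OF y] by metis
    qed
    then show "\<exists>A' B' C' D'. (A' \<noteq> 0 \<or> B' \<noteq> 0 \<or> C' \<noteq> 0 \<or> D' \<noteq> 0) \<and>
       (\<forall>y. poncelet_orbit (2 * M) A B C D y \<longrightarrow> chord_form A' B' C' D' (y 0) (y j) = 0)"
      using nz by blast
  qed
qed

section \<open>Blaschke products and their decomposition\<close>

definition zero_poly :: "complex list \<Rightarrow> complex poly" where
  "zero_poly as = (\<Prod>a\<leftarrow>as. [:- a, 1:])"

definition pole_poly :: "complex list \<Rightarrow> complex poly" where
  "pole_poly as = (\<Prod>a\<leftarrow>as. [:1, - cnj a:])"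

lemma zero_poly_simps [simp]: "zero_poly [] = 1" "zero_poly (a # as) = [:- a, 1:] * zero_poly as"
  and pole_poly_simps [simp]: "pole_poly [] = 1" "pole_poly (a # as) = [:1, - cnj a:] * pole_poly as"
  by (simp_all add: zero_poly_def pole_poly_def)

lemma blaschke_simps [simp]:
  "blaschke \<gamma> [] z = \<gamma>" "blaschke \<gamma> (a # as) z = (z - a) / (1 - cnj a * z) * blaschke \<gamma> as z"
  by (simp_all add: blaschke_def)

lemma poly_zero_poly_eq_0_iff: "poly (zero_poly as) z = 0 \<longleftrightarrow> z \<in> set as"
  by (induction as) auto

lemma poly_pole_poly_nonzero: "\<forall>a\<in>set as. cmod a < 1 \<Longrightarrow> cmod z \<le> 1 \<Longrightarrow> poly (pole_poly as) z \<noteq> 0"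
proof (induction as)
  case (Cons a as)
  then show ?case using one_plus_cnj_mult_nonzero[of "-a" z] by (auto simp: mult.commute)
qed simp

lemma blaschke_eq_poly: "blaschke \<gamma> as z = \<gamma> * poly (zero_poly as) z / poly (pole_poly as) z"
proof (induction as)
  case (Cons a as)
  have "poly (zero_poly (a # as)) z = (z - a) * poly (zero_poly as) z"
    "poly (pole_poly (a # as)) z = (1 - cnj a * z) * poly (pole_poly as) z"
    by (simp_all add: algebra_simps)
  then show ?case unfolding blaschke_simps Cons by simp
qed simp

lemma blaschke_mset: "mset as = mset bs \<Longrightarrow> blaschke \<gamma> as z = blaschke \<gamma> bs z"
  unfolding blaschke_def by (simp flip: prod_mset_prod_list)

lemma cmod_blaschke_circle:
  "cmod z = 1 \<Longrightarrow> \<forall>a\<in>set as. cmod a < 1 \<Longrightarrow> cmod (blaschke \<gamma> as z) = cmod \<gamma>"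
proof (induction as)
  case (Cons a as)
  have "cmod (moeb (- a) z) = 1" by (rule moeb_circle) (use Cons in auto)
  moreover have "blaschke \<gamma> (a # as) z = moeb (- a) z * blaschke \<gamma> as z" by (simp add: moeb_def)
  ultimately show ?case using Cons by (simp only: norm_mult) simp
qed simp

text \<open>Each factor composed with a disc automorphism is again a factor, up to a unimodular
  constant. The equality is confined to the closed disc, where no denominator vanishes.\<close>

lemma blaschke_compose_moeb:
  assumes x: "cmod x < 1" and e: "cmod e = 1"
  shows "\<forall>a\<in>set as. cmod a < 1 \<Longrightarrow> cmod \<gamma> = 1 \<Longrightarrow> \<exists>\<gamma>' bs. cmod \<gamma>' = 1 \<and> length bs = length as \<and> (\<forall>b\<in>set bs. cmod b < 1) \<and>
    (\<forall>z. cmod z \<le> 1 \<longrightarrow> blaschke \<gamma> as (moeb x (e * z)) = blaschke \<gamma>' bs z)"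
proof (induction as)
  case Nil
  then show ?case by (intro exI[of _ \<gamma>] exI[of _ "[]"]) auto
next
  case (Cons a as)
  then obtain \<gamma>' bs where IH: "cmod \<gamma>' = 1" "length bs = length as" "\<forall>b\<in>set bs. cmod b < 1"
    "\<And>z. cmod z \<le> 1 \<Longrightarrow> blaschke \<gamma> as (moeb x (e * z)) = blaschke \<gamma>' bs z" by auto
  have a: "cmod a < 1" using Cons by simp
  \<comment> \<open>The zero of the new factor: the preimage of a under z ->
    \<open>moeb x (e * z)\<close>, with \<open>cnj e\<close> for 1 / e.\<close>
  define b where "b = cnj e * moeb (- x) a"
  have b: "cmod b < 1" unfolding b_def using moeb_disc[of "-x" a] x e a by (simp add: norm_mult)
  have e1: "e * cnj e = 1" using e complex_norm_square[of e] by simp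
  have nx: "1 - cnj x * a \<noteq> 0" using one_plus_cnj_mult_nonzero[of "-x" a] x a by simp
  have na: "1 - cnj a * x \<noteq> 0" using one_plus_cnj_mult_nonzero[of "-a" x] x a by simp
  have bn: "b * (1 - cnj x * a) = cnj e * (a - x)" using nx by (simp add: b_def moeb_def)
  have cbn: "cnj b * (1 - cnj a * x) = e * (cnj a - cnj x)" using arg_cong[OF bn, of cnj] by (simp add: mult.commute)
  define \<kappa> where "\<kappa> = e * (1 - cnj x * a) / (1 - cnj a * x)"
  have "cmod (1 - cnj x * a) = cmod (1 - cnj a * x)"
    using complex_mod_cnj[of "1 - cnj x * a"] by (simp add: mult.commute)
  then have \<kappa>: "cmod \<kappa> = 1" using na e by (simp add: \<kappa>_def norm_mult norm_divide)
  have key: "(moeb x (e * z) - a) / (1 - cnj a * moeb x (e * z)) = \<kappa> * ((z - b) / (1 - cnj b * z))" if z: "cmod z \<le> 1" for z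
  proof -
    have n: "1 + cnj x * (e * z) \<noteq> 0" by (rule one_plus_cnj_mult_nonzero) (use x e z in \<open>auto simp: norm_mult\<close>)
    define n' where "n' = 1 + cnj x * (e * z)"
    have m: "moeb x (e * z) * n' = e * z + x" using n by (simp add: moeb_def n'_def)
    have nb: "1 - cnj b * z \<noteq> 0" using one_plus_cnj_mult_nonzero[of "-b" z] b z by simp
    have 1: "(moeb x (e * z) - a) * n' = e * (1 - cnj x * a) * (z - b)"
      using m bn e1 unfolding n'_def by algebra
    have 2: "(1 - cnj a * moeb x (e * z)) * n' = (1 - cnj a * x) * (1 - cnj b * z)"
      using m cbn unfolding n'_def by algebra
    have "(moeb x (e * z) - a) / (1 - cnj a * moeb x (e * z)) = ((moeb x (e * z) - a) * n') / ((1 - cnj a * moeb x (e * z)) * n')"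
      using n by (simp add: n'_def)
    also have "\<dots> = \<kappa> * ((z - b) / (1 - cnj b * z))" unfolding 1 2 \<kappa>_def by simp
    finally show ?thesis .
  qed
  show ?case
  proof (intro exI[of _ "\<kappa> * \<gamma>'"] exI[of _ "b # bs"] conjI allI impI)
    fix z :: complex assume z: "cmod z \<le> 1"
    have "blaschke (\<kappa> * \<gamma>') bs z = \<kappa> * blaschke \<gamma>' bs z" by (simp add: blaschke_def)
    then show "blaschke \<gamma> (a # as) (moeb x (e * z)) = blaschke (\<kappa> * \<gamma>') (b # bs) z"
      using key[OF z] IH(4)[OF z] by simp
  qed (use IH b \<kappa> in \<open>auto simp: norm_mult\<close>)
qed

section \<open>Even Blaschke products as functions of z^2\<close>

lemma infinite_unit_circle: "infinite {z. cmod z = 1}"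
proof -
  have eq: "{z. cmod z = 1} = sphere 0 1" by auto
  have "connected (sphere (0::complex) 1)" by (rule connected_sphere) simp
  moreover have "\<not> is_singleton (sphere (0::complex) 1)"
  proof
    assume "is_singleton (sphere (0::complex) 1)"
    then obtain x where "sphere (0::complex) 1 = {x}" by (rule is_singletonE)
    then have "1 \<in> {x}" "-1 \<in> {x}" by (metis dist_0_norm mem_sphere norm_one norm_minus_cancel)+
    then show False by simp
  qed
  moreover have "1 \<in> sphere (0::complex) 1" by simp
  ultimately show ?thesis unfolding eq using connected_finite_iff_sing[of "sphere (0::complex) 1"]
    by (auto simp: is_singleton_def)
qed

text \<open>Clearing denominators turns evenness into a polynomial identity on the infinite circle,
  hence everywhere. At a zero a the denominator is nonzero, so the numerator vanishes at -
  a.\<close>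

lemma blaschke_even_zero:
  assumes "\<gamma> \<noteq> 0" "\<forall>b\<in>set bs. cmod b < 1"
    and even: "\<And>z. cmod z = 1 \<Longrightarrow> blaschke \<gamma> bs (- z) = blaschke \<gamma> bs z" and a: "a \<in> set bs"
  shows "- a \<in> set bs"
proof -
  let ?P = "zero_poly bs" and ?Q = "pole_poly bs" and ?m = "[:0, -1:] :: complex poly"
  define R where "R = ?P * pcompose ?Q ?m - pcompose ?P ?m * ?Q"
  have "poly R z = 0" if z: "cmod z = 1" for z
  proof -
    have "poly ?P (-z) / poly ?Q (-z) = poly ?P z / poly ?Q z"
      using even[OF z] assms(1)
      unfolding blaschke_eq_poly times_divide_eq_right[symmetric] mult_cancel_left by blast
    moreover have "poly ?Q z \<noteq> 0" "poly ?Q (-z) \<noteq> 0" using poly_pole_poly_nonzero assms(2) z by auto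
    ultimately show ?thesis by (simp add: R_def poly_pcompose field_simps)
  qed
  then have "{z. cmod z = 1} \<subseteq> {z. poly R z = 0}" by auto
  then have "R = 0" using infinite_unit_circle poly_roots_finite finite_subset by blast
  then have "poly R a = 0" by simp
  moreover have "poly ?P a = 0" using a by (simp add: poly_zero_poly_eq_0_iff)
  moreover have "poly ?Q a \<noteq> 0"
    using poly_pole_poly_nonzero[OF assms(2), of a] assms(2) a less_imp_le by blast
  ultimately have "poly ?P (-a) = 0" by (simp add: R_def poly_pcompose)
  then show ?thesis by (simp add: poly_zero_poly_eq_0_iff)
qed

text \<open>A pair of zeros a, - a contributes a Blaschke factor in z^2 with zero a^2; the induction
  removes one pair at a time.\<close>

lemma blaschke_even_decompose:
  assumes "\<gamma> \<noteq> 0" "length bs = 2 * M" "\<forall>b\<in>set bs. cmod b < 1"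
    and "\<And>z. cmod z = 1 \<Longrightarrow> blaschke \<gamma> bs (- z) = blaschke \<gamma> bs z"
  shows "\<exists>bs'. length bs' = M \<and> (\<forall>b\<in>set bs'. cmod b < 1) \<and> (\<forall>z. blaschke \<gamma> bs z = blaschke \<gamma> bs' (z\<^sup>2))"
  using assms(2-4)
proof (induction M arbitrary: bs)
  case 0
  then show ?case by auto
next
  case (Suc M)
  show ?case
  \<comment> \<open>Nonzero zeros are removed first, since for them - a is a different zero; once
    only zeros at the origin remain, the product is an even power of z.\<close>
  proof (cases "\<exists>a\<in>set bs. a \<noteq> 0")
    case False
    then have bs: "bs = replicate (2 * Suc M) 0" using replicate_length_same[of bs 0] Suc.prems(1) by auto
    have "blaschke \<gamma> (replicate n 0) z = \<gamma> * z ^ n" for n z by (induction n) auto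
    then show ?thesis unfolding bs by (intro exI[of _ "replicate (Suc M) 0"]) (simp add: power_mult power2_eq_square power_mult_distrib)
  next
    case True
    then obtain a where a: "a \<in> set bs" "a \<noteq> 0" by blast
    have "- a \<in> set bs" using blaschke_even_zero[OF assms(1) Suc.prems(2,3) a(1)] .
    then have ma: "- a \<in> set (remove1 a bs)" using a(2) by (subst in_set_remove1) auto
    define r where "r = remove1 (- a) (remove1 a bs)"
    have "mset bs = add_mset a (mset (remove1 a bs))" using a(1) by simp
    moreover have "mset (remove1 a bs) = add_mset (- a) (mset r)" unfolding r_def mset_remove1[of "- a"]
      by (rule insert_DiffM[symmetric]) (use ma in \<open>simp only: set_mset_mset\<close>)
    ultimately have mset: "mset bs = mset (a # - a # r)" by simp
    then have len: "length r = 2 * M" using Suc.prems(1)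
    proof -
      have "size (mset bs) = size (mset (a # - a # r))" by (simp only: mset)
      then have "length bs = Suc (Suc (length r))" by (simp only: size_mset length_Cons)
      then show ?thesis using Suc.prems(1) by simp
    qed
    have set: "set bs = set (a # - a # r)" using arg_cong[OF mset, of set_mset] by simp
    have a1: "cmod a < 1" using Suc.prems a by auto
    have bs: "blaschke \<gamma> bs z = (z\<^sup>2 - a\<^sup>2) / (1 - cnj (a\<^sup>2) * z\<^sup>2) * blaschke \<gamma> r z" for z
    proof -
      have *: "(z - a) / (1 - cnj a * z) * ((z - - a) / (1 - cnj (- a) * z)) = (z\<^sup>2 - a\<^sup>2) / (1 - cnj (a\<^sup>2) * z\<^sup>2)"
        unfolding times_divide_times_eq by (rule arg_cong2[of _ _ _ _ "(/)"]) (simp_all add: power2_eq_square algebra_simps)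
      show ?thesis unfolding blaschke_mset[OF mset] blaschke_simps mult.assoc[symmetric] * ..
    qed
    have a2: "cmod (a\<^sup>2) < 1" using a1 by (simp add: norm_power power_less_one_iff)
    \<comment> \<open>The pair factor has no zero on the circle, so it can be cancelled and evenness
      passes to the rest.\<close>
    have nz: "(z\<^sup>2 - a\<^sup>2) / (1 - cnj (a\<^sup>2) * z\<^sup>2) \<noteq> 0" if z: "cmod z = 1" for z
    proof -
      have "cmod (z\<^sup>2) = 1" using z by (simp add: norm_power)
      then have "z\<^sup>2 \<noteq> a\<^sup>2" "1 - cnj (a\<^sup>2) * z\<^sup>2 \<noteq> 0"
        using a2 one_plus_cnj_mult_nonzero[of "- (a\<^sup>2)" "z\<^sup>2"] by auto
      then show ?thesis by simp
    qed
    have "\<exists>bs'. length bs' = M \<and> (\<forall>b\<in>set bs'. cmod b < 1) \<and> (\<forall>z. blaschke \<gamma> r z = blaschke \<gamma> bs' (z\<^sup>2))"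
    proof (rule Suc.IH[OF len])
      show "\<forall>b\<in>set r. cmod b < 1" using Suc.prems(2) set by auto
      show "blaschke \<gamma> r (- z) = blaschke \<gamma> r z" if "cmod z = 1" for z
        using Suc.prems(3)[OF that] nz[OF that] unfolding bs power2_minus mult_cancel_left by blast
    qed
    then obtain bs' where "length bs' = M" "\<forall>b\<in>set bs'. cmod b < 1" "\<And>z. blaschke \<gamma> r z = blaschke \<gamma> bs' (z\<^sup>2)" by blast
    then show ?thesis using a2 by (intro exI[of _ "a\<^sup>2 # bs'"]) (simp add: bs)
  qed
qed

text \<open>The hypothesis carried by the induction: only what the quotient inherits. An orbit stays
  in one fibre but need not list it in cyclic order.\<close>

definition has_poncelet_conic :: "nat \<Rightarrow> (complex \<Rightarrow> complex) \<Rightarrow> bool" where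
  "has_poncelet_conic N F \<longleftrightarrow> (\<exists>A B C D. (\<forall>z. cmod z = 1 \<longrightarrow> gauge_form A B C D z > 0) \<and>
     (\<forall>z. cmod z = 1 \<longrightarrow> (\<exists>y. y 0 = z \<and> poncelet_orbit N A B C D y \<and> (\<forall>j. F (y j) = F z))))"

lemma foldr_comp_snoc: "foldr (\<circ>) (Cs @ [C]) id = foldr (\<circ>) Cs id \<circ> C"
  by (induction Cs) (auto simp: o_assoc)

text \<open>The relation reads a (1 + z^2 w^2) + c (z^2 + w^2) = 2 \<eta> z w; squaring both sides
  leaves only z^2 and w^2.\<close>

lemma squared_conic:
  assumes zw: "cmod z = 1" "cmod w = 1" and rel: "Re z * Re w + Im z * Im w * \<delta> = \<eta>"
  shows "chord_form (of_real (((1 - \<delta>) / 2)\<^sup>2)) (of_real ((1 - \<delta>\<^sup>2) / 2)) (((1 + \<delta>) / 2)\<^sup>2) (1 + \<delta>\<^sup>2 - 4 * \<eta>\<^sup>2) (z\<^sup>2) (w\<^sup>2) = 0"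
proof -
  define a c where "a = (1 - \<delta>) / 2" "c = (1 + \<delta>) / 2"
  have "chord_form (of_real a) 0 c (- 2 * \<eta>) z w = 0"
    unfolding chord_form_axial[OF zw] using rel by (simp add: a_c_def field_simps)
  then have e: "of_real a * (1 + z\<^sup>2 * w\<^sup>2) + of_real c * (z\<^sup>2 + w\<^sup>2) = 2 * of_real \<eta> * (z * w)"
    unfolding chord_form_def by (simp add: algebra_simps)
  have 1: "(1 - \<delta>\<^sup>2) / 2 = 2 * a * c" "1 + \<delta>\<^sup>2 - 4 * \<eta>\<^sup>2 = 2 * c\<^sup>2 + 2 * a\<^sup>2 - 4 * \<eta>\<^sup>2"
    by (simp_all add: a_c_def field_simps power2_eq_square)
  have "chord_form (of_real (a\<^sup>2)) (of_real (2 * a * c)) (c\<^sup>2) (2 * c\<^sup>2 + 2 * a\<^sup>2 - 4 * \<eta>\<^sup>2) (z\<^sup>2) (w\<^sup>2)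
     = (of_real a * (1 + z\<^sup>2 * w\<^sup>2) + of_real c * (z\<^sup>2 + w\<^sup>2))\<^sup>2 - (2 * of_real \<eta> * (z * w))\<^sup>2"
    unfolding chord_form_def of_real_add of_real_diff of_real_mult of_real_power of_real_numeral complex_cnj_mult complex_cnj_power
      complex_cnj_complex_of_real complex_cnj_numeral by algebra
  then show ?thesis unfolding 1 a_c_def[symmetric] e by simp
qed

text \<open>The gauge equals 4 ((c + a Re z)^2 - \<eta>^2), and c + a Re z \<ge> c - a = \<delta> >
  |\<eta>|.\<close>

lemma squared_conic_gauge:
  assumes z: "cmod z = 1" and "\<delta> \<le> 1" "\<bar>\<eta>\<bar> < \<delta>"
  shows "gauge_form (of_real (((1 - \<delta>) / 2)\<^sup>2)) (of_real ((1 - \<delta>\<^sup>2) / 2)) (((1 + \<delta>) / 2)\<^sup>2) (1 + \<delta>\<^sup>2 - 4 * \<eta>\<^sup>2) z > 0"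
proof -
  define a c where "a = (1 - \<delta>) / 2" "c = (1 + \<delta>) / 2"
  have 1: "(1 - \<delta>\<^sup>2) / 2 = 2 * a * c" "1 + \<delta>\<^sup>2 - 4 * \<eta>\<^sup>2 = 2 * c\<^sup>2 + 2 * a\<^sup>2 - 4 * \<eta>\<^sup>2"
    by (simp_all add: a_c_def field_simps power2_eq_square)
  have "(Re z)\<^sup>2 + (Im z)\<^sup>2 = 1" using z cmod_power2[of z] by simp
  then have "gauge_form (of_real (a\<^sup>2)) (of_real (2 * a * c)) (c\<^sup>2) (2 * c\<^sup>2 + 2 * a\<^sup>2 - 4 * \<eta>\<^sup>2) z = 4 * ((c + a * Re z)\<^sup>2 - \<eta>\<^sup>2)"
  proof -
    have 2: "Re (of_real (a\<^sup>2) * z\<^sup>2) = a\<^sup>2 * (2 * (Re z)\<^sup>2 - 1)"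
    proof -
      have "Re (z\<^sup>2) = 2 * (Re z)\<^sup>2 - 1" using \<open>(Re z)\<^sup>2 + (Im z)\<^sup>2 = 1\<close> by (simp add: Re_power2)
      moreover have "Re (of_real (a\<^sup>2) * z\<^sup>2) = a\<^sup>2 * Re (z\<^sup>2)"
        by (simp only: times_complex.sel Re_complex_of_real Im_complex_of_real)
      ultimately show ?thesis by simp
    qed
    have 3: "Re (of_real (2 * a * c) * z) = 2 * a * c * Re z" by simp
    show ?thesis unfolding gauge_form_def z 2 3 power_one one_add_one by algebra
  qed
  moreover have "\<eta>\<^sup>2 < (c + a * Re z)\<^sup>2"
  proof -
    have "a * \<bar>Re z\<bar> \<le> a * 1" using z abs_Re_le_cmod[of z] assms by (intro mult_left_mono) (auto simp: a_c_def)
    moreover have "a * \<bar>Re z\<bar> = \<bar>a * Re z\<bar>" using assms(2) by (simp add: abs_mult a_c_def)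
    ultimately have "- a \<le> a * Re z" by linarith
    then have "\<delta> \<le> c + a * Re z" by (simp add: a_c_def field_simps)
    then have "\<bar>\<eta>\<bar> < \<bar>c + a * Re z\<bar>" using assms by linarith
    then show ?thesis using power_strict_mono[of "\<bar>\<eta>\<bar>" "\<bar>c + a * Re z\<bar>" 2] by simp
  qed
  ultimately show ?thesis unfolding 1 a_c_def[symmetric] by simp
qed


text \<open>Squaring identifies \<zeta> with - \<zeta>, which is M steps further, so the period
  drops from 2 M to exactly M.\<close>

lemma squared_conic_orbit:
  assumes x: "cmod x < 1" and e: "cmod e = 1"
    and iff: "\<And>z w. cmod z = 1 \<Longrightarrow> cmod w = 1 \<Longrightarrow> chord_form A B C D (moeb x (e * z)) (moeb x (e * w)) = 0
       \<longleftrightarrow> Re z * Re w + Im z * Im w * \<delta> = \<eta>"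
    and half: "\<And>y. poncelet_orbit (2 * M) A B C D y \<Longrightarrow> moeb (- x) (y M) = - moeb (- x) (y 0)"
    and y: "poncelet_orbit (2 * M) A B C D y"
  shows "poncelet_orbit M (of_real (((1 - \<delta>) / 2)\<^sup>2)) (of_real ((1 - \<delta>\<^sup>2) / 2)) (((1 + \<delta>) / 2)\<^sup>2) (1 + \<delta>\<^sup>2 - 4 * \<eta>\<^sup>2)
           (\<lambda>j. (moeb (- x) (y j) / e)\<^sup>2)"
proof -
  define \<zeta> where "\<zeta> j = moeb (- x) (y j) / e" for j
  have yc: "cmod (y j) = 1" for j using y unfolding poncelet_orbit_def by blast
  have e0: "e \<noteq> 0" using e by auto
  have \<zeta>: "cmod (\<zeta> j) = 1" "y j = moeb x (e * \<zeta> j)" for j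
    unfolding \<zeta>_def using moeb_circle[of "-x" "y j"] moeb_inverse'[OF x, of "y j"] x e yc[of j] by (auto simp: norm_divide)
  have eq: "\<zeta> i = \<zeta> j \<longleftrightarrow> i mod (2 * M) = j mod (2 * M)" for i j
  proof -
    have "y i = y j" if "\<zeta> i = \<zeta> j" using \<zeta>(2)[of i] \<zeta>(2)[of j] that by simp
    then have "\<zeta> i = \<zeta> j \<longleftrightarrow> y i = y j" by (auto simp: \<zeta>_def)
    then show ?thesis using y unfolding poncelet_orbit_def by blast
  qed
  have neg: "\<zeta> (j + M) = - \<zeta> j" for j
    using half[OF poncelet_orbit_shift[OF y, of j]] by (simp add: \<zeta>_def)
  have eq2: "(\<zeta> i)\<^sup>2 = (\<zeta> j)\<^sup>2 \<longleftrightarrow> i mod M = j mod M" for i j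
  proof -
    have "(\<zeta> i)\<^sup>2 = (\<zeta> j)\<^sup>2 \<longleftrightarrow> \<zeta> i = \<zeta> j \<or> \<zeta> i = \<zeta> (j + M)" unfolding power2_eq_iff neg ..
    also have "\<dots> \<longleftrightarrow> i mod (2 * M) = j mod (2 * M) \<or> i mod (2 * M) = (j + M) mod (2 * M)" unfolding eq ..
    also have "\<dots> \<longleftrightarrow> int (2 * M) dvd (int i - int j) \<or> int (2 * M) dvd (int i - int j - int M)"
    proof -
      have "a mod (2 * M) = b mod (2 * M) \<longleftrightarrow> int (2 * M) dvd (int a - int b)" for a b
        unfolding mod_eq_dvd_iff[symmetric] zmod_int[symmetric] of_nat_eq_iff ..
      then show ?thesis by (simp add: diff_diff_eq)
    qed
    also have "\<dots> \<longleftrightarrow> int M dvd (int i - int j)"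
    proof
      assume "int (2 * M) dvd (int i - int j) \<or> int (2 * M) dvd (int i - int j - int M)"
      then have "int M dvd (int i - int j) \<or> int M dvd (int i - int j - int M)"
        using dvd_mult_right[of 2 "int M"] by auto
      then show "int M dvd (int i - int j)" using dvd_add[of "int M" "int i - int j - int M" "int M"] by auto
    next
      assume "int M dvd (int i - int j)"
      then obtain q where q: "int i - int j = int M * q" by blast
      show "int (2 * M) dvd (int i - int j) \<or> int (2 * M) dvd (int i - int j - int M)"
      \<comment> \<open>An odd multiple of M is M plus a multiple of 2 M, which is the case of
        opposite points.\<close>
      proof (cases "even q")
        case True
        then obtain r where "q = 2 * r" by blast
        then have "int i - int j = int (2 * M) * r" using q by simp
        then show ?thesis by (metis dvd_triv_left)
      next
        case False
        then obtain r where "q = 2 * r + 1" by (rule oddE)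
        then have "int i - int j - int M = int (2 * M) * r" using q by (simp add: algebra_simps)
        then show ?thesis by (metis dvd_triv_left)
      qed
    qed
    also have "\<dots> \<longleftrightarrow> i mod M = j mod M"
      unfolding mod_eq_dvd_iff[symmetric] zmod_int[symmetric] of_nat_eq_iff ..
    finally show ?thesis .
  qed
  have rel: "Re (\<zeta> j) * Re (\<zeta> (Suc j)) + Im (\<zeta> j) * Im (\<zeta> (Suc j)) * \<delta> = \<eta>" for j
    unfolding iff[OF \<zeta>(1) \<zeta>(1), symmetric] \<zeta>(2)[symmetric] using y unfolding poncelet_orbit_def by blast
  show ?thesis unfolding poncelet_orbit_def \<zeta>_def[symmetric]
    using \<zeta>(1) eq2 squared_conic[OF \<zeta>(1) \<zeta>(1) rel] by (simp add: norm_power)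
qed

text \<open>The conic is a hypothesis only from degree 4 on, because the induction starts at degree
  2, where the product is itself the single factor.\<close>

theorem blaschke_composition:
  assumes "1 \<le> n" "cmod \<gamma> = 1" "length as = 2 ^ n" "\<forall>a\<in>set as. cmod a < 1"
    and "2 \<le> n \<Longrightarrow> has_poncelet_conic (2 ^ n) (blaschke \<gamma> as)"
  shows "\<exists>Cs. length Cs = n \<and> (\<forall>C\<in>set Cs. is_fbp 2 C) \<and> (\<forall>z\<in>ball 0 1. blaschke \<gamma> as z = foldr (\<circ>) Cs id z)"
  using assms
proof (induction n arbitrary: \<gamma> as rule: nat_induct_at_least)
  case base
  then have "is_fbp 2 (blaschke \<gamma> as)" unfolding is_fbp_def by auto
  then show ?case by (intro exI[of _ "[blaschke \<gamma> as]"]) auto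
next
  case (Suc n)
  let ?F = "blaschke \<gamma> as"
  define M :: nat where "M = 2 ^ n"
  have M: "M \<ge> 2" "2 ^ Suc n = 2 * M" using Suc(1) power_increasing[of 1 n "2::nat"] by (auto simp: M_def)
  have "has_poncelet_conic (2 * M) ?F" using Suc M(2) by simp
  then obtain A B C D where pos: "\<And>z. cmod z = 1 \<Longrightarrow> gauge_form A B C D z > 0"
    and orbits: "\<And>z. cmod z = 1 \<Longrightarrow> \<exists>y. y 0 = z \<and> poncelet_orbit (2 * M) A B C D y \<and> (\<forall>j. ?F (y j) = ?F z)"
    unfolding has_poncelet_conic_def by blast
  have orbits': "\<exists>y. y 0 = z \<and> poncelet_orbit (2 * M) A B C D y" if "cmod z = 1" for z
    using orbits[OF that] by blast
  obtain x e \<delta> \<eta> where x: "cmod x < 1" and e: "cmod e = 1" and \<delta>: "\<delta> \<le> 1" and \<eta>: "\<bar>\<eta>\<bar> < \<delta>" and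
    iff: "\<And>z w. cmod z = 1 \<Longrightarrow> cmod w = 1 \<Longrightarrow> chord_form A B C D (moeb x (e * z)) (moeb x (e * w)) = 0
       \<longleftrightarrow> Re z * Re w + Im z * Im w * \<delta> = \<eta>" and
    half: "\<And>y. poncelet_orbit (2 * M) A B C D y \<Longrightarrow> moeb (- x) (y M) = - moeb (- x) (y 0)"
    by (rule poncelet_orbits_closed_form[OF M(1) pos orbits']) blast+
  have e0: "e \<noteq> 0" using e by auto
  obtain \<gamma>' bs where bs: "cmod \<gamma>' = 1" "length bs = length as" "\<forall>b\<in>set bs. cmod b < 1"
    and Fm: "\<And>z. cmod z \<le> 1 \<Longrightarrow> ?F (moeb x (e * z)) = blaschke \<gamma>' bs z"
    using blaschke_compose_moeb[OF x e, of as \<gamma>] Suc by blast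
  have even: "blaschke \<gamma>' bs (- z) = blaschke \<gamma>' bs z" if z: "cmod z = 1" for z
  proof -
    have "cmod (moeb x (e * z)) = 1" by (rule moeb_circle) (use x e z in \<open>auto simp: norm_mult\<close>)
    from orbits[OF this] obtain y where y: "y 0 = moeb x (e * z)" "poncelet_orbit (2 * M) A B C D y" "?F (y M) = ?F (moeb x (e * z))"
      by blast
    have "cmod (y M) = 1" using y(2) unfolding poncelet_orbit_def by blast
    then have "y M = moeb x (moeb (- x) (y M))" using moeb_inverse'[OF x] by simp
    also have "moeb (- x) (y M) = e * (- z)" unfolding half[OF y(2)] y(1) using moeb_inverse[OF x, of "e * z"] e z by (simp add: norm_mult)
    finally have "?F (moeb x (e * (- z))) = ?F (moeb x (e * z))" using y(3) by simp
    then show ?thesis using Fm[of z] Fm[of "-z"] z by simp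
  qed
  have "\<gamma>' \<noteq> 0" using bs(1) by auto
  moreover have "length bs = 2 * M" using Suc M(2) bs(2) by simp
  ultimately obtain ds where ds: "length ds = M" "\<forall>b\<in>set ds. cmod b < 1"
    and sq: "\<And>z. blaschke \<gamma>' bs z = blaschke \<gamma>' ds (z\<^sup>2)"
    using blaschke_even_decompose[OF _ _ bs(3) even] by blast
  let ?m' = "\<lambda>z. moeb (- x) z / e"
  have m': "cmod (?m' z) \<le> 1" "moeb x (e * ?m' z) = z" if "cmod z \<le> 1" for z
    using moeb_circle[of "-x" z] moeb_disc[of "-x" z] x e e0 that moeb_inverse'[OF x that]
    by (cases "cmod z = 1"; force simp: norm_divide)+
  have F: "?F z = blaschke \<gamma>' ds ((?m' z)\<^sup>2)" if "cmod z \<le> 1" for z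
    using Fm[OF m'(1)[OF that]] m'(2)[OF that] sq by simp
  have "\<exists>y. y 0 = z \<and> poncelet_orbit M (of_real (((1 - \<delta>) / 2)\<^sup>2)) (of_real ((1 - \<delta>\<^sup>2) / 2)) (((1 + \<delta>) / 2)\<^sup>2) (1 + \<delta>\<^sup>2 - 4 * \<eta>\<^sup>2) y \<and>
             (\<forall>j. blaschke \<gamma>' ds (y j) = blaschke \<gamma>' ds z)" if z: "cmod z = 1" for z
  proof -
    \<comment> \<open>A square root of z is carried to the original circle; the orbit through its
      image squares to an orbit through z.\<close>
    have c: "cmod (csqrt z) = 1" using z by simp
    have u: "cmod (moeb x (e * csqrt z)) = 1" by (rule moeb_circle) (use x e c in \<open>auto simp: norm_mult\<close>)
    from orbits[OF u] obtain y where y: "y 0 = moeb x (e * csqrt z)" "poncelet_orbit (2 * M) A B C D y"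
      "\<And>j. ?F (y j) = ?F (moeb x (e * csqrt z))" by blast
    have yc: "cmod (y j) = 1" for j using y(2) unfolding poncelet_orbit_def by blast
    let ?y = "\<lambda>j. (?m' (y j))\<^sup>2"
    have y0: "?y 0 = z" unfolding y(1) using moeb_inverse[OF x, of "e * csqrt z"] e e0 c by (simp add: norm_mult)
    have "blaschke \<gamma>' ds (?y j) = blaschke \<gamma>' ds z" for j
    proof -
      have "blaschke \<gamma>' ds (?y j) = ?F (y j)" using F[of "y j"] yc by simp
      also have "\<dots> = ?F (y 0)" using y(1,3) by simp
      also have "\<dots> = blaschke \<gamma>' ds (?y 0)" using F[of "y 0"] yc by simp
      finally show ?thesis using y0 by simp
    qed
    then show ?thesis
      using squared_conic_orbit[OF x e iff half y(2)] y0 by (intro exI[of _ ?y]) blast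
  qed
  then have "has_poncelet_conic M (blaschke \<gamma>' ds)"
    unfolding has_poncelet_conic_def using squared_conic_gauge[OF _ \<delta> \<eta>] by blast
  then obtain Cs where Cs: "length Cs = n" "\<forall>C\<in>set Cs. is_fbp 2 C"
    "\<And>z. z \<in> ball 0 1 \<Longrightarrow> blaschke \<gamma>' ds z = foldr (\<circ>) Cs id z"
    using Suc.IH[of \<gamma>' ds] bs(1) ds unfolding M_def by blast
  \<comment> \<open>The square of the normal coordinate, a Blaschke product with the double zero x;
    it becomes the innermost factor.\<close>
  define C where "C = blaschke (inverse (e\<^sup>2)) [x, x]"
  have C: "C z = (?m' z)\<^sup>2" for z
    unfolding C_def using e0 by (simp add: moeb_def power2_eq_square field_simps)
  have "is_fbp 2 C" unfolding is_fbp_def C_def using x e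
    by (intro exI[of _ "inverse (e\<^sup>2)"] exI[of _ "[x, x]"]) (auto simp: norm_inverse norm_power)
  moreover have "?F z = foldr (\<circ>) (Cs @ [C]) id z" if z: "z \<in> ball 0 1" for z
  proof -
    have "cmod (?m' z) < 1" using moeb_disc[of "-x" z] x e z by (simp add: norm_divide dist_norm)
    then have "C z \<in> ball 0 1" unfolding C by (simp add: norm_power power_less_one_iff dist_norm)
    then show ?thesis using F[of z] z Cs(3) unfolding foldr_comp_snoc by (simp add: C dist_norm)
  qed
  moreover have "length (Cs @ [C]) = Suc n" using Cs(1) by simp
  moreover have "\<forall>C\<in>set (Cs @ [C]). is_fbp 2 C" using Cs(2) \<open>is_fbp 2 C\<close> by simp
  ultimately show ?case by blast
qed

section \<open>Lifting a Blaschke product on the circle\<close>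

lemma cis_Arg_unit: "cmod z = 1 \<Longrightarrow> cis (Arg z) = z"
  by (subst cis_Arg) (auto simp: sgn_eq)

lemma cis_arctan_double: "cis (- 2 * arctan r) = (1 - \<i> * of_real r) / (1 + \<i> * of_real r)"
proof -
  have s: "1 + r\<^sup>2 > 0" by (simp add: add_pos_nonneg)
  have "cis (arctan r) = (1 + \<i> * of_real r) / of_real (sqrt (1 + r\<^sup>2))"
    using s by (simp add: complex_eq_iff cos_arctan sin_arctan Re_divide_of_real Im_divide_of_real)
  then have c: "cis (- arctan r) = (1 - \<i> * of_real r) / of_real (sqrt (1 + r\<^sup>2))"
    unfolding cis_cnj[symmetric] by simp
  have "cis (- 2 * arctan r) = (cis (- arctan r))\<^sup>2" by (simp add: power2_eq_square cis_mult)
  also have "\<dots> = (1 - \<i> * of_real r)\<^sup>2 / of_real (1 + r\<^sup>2)"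
    unfolding c using s by (simp add: power_divide flip: of_real_power)
  also have "complex_of_real (1 + r\<^sup>2) = (1 - \<i> * of_real r) * (1 + \<i> * of_real r)"
    by (simp add: algebra_simps power2_eq_square)
  also have "(1 - \<i> * of_real r)\<^sup>2 / ((1 - \<i> * of_real r) * (1 + \<i> * of_real r)) = (1 - \<i> * of_real r) / (1 + \<i> * of_real r)"
  proof -
    have "1 - \<i> * of_real r \<noteq> 0" by (simp add: complex_eq_iff)
    then show ?thesis by (simp add: power2_eq_square)
  qed
  finally show ?thesis .
qed

text \<open>The denominator u + i v has u > 0, so its argument is arctan (v / u), and the numerator
  is \<open>cis t\<close> times its conjugate. Hence the lift t - 2 arctan (v / u), whose derivative
  is the Poisson kernel.\<close>

lemma blaschke_factor_lift:
  assumes a: "cmod a < 1"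
  obtains L L' where "\<And>t. (L has_real_derivative L' t) (at t)" "\<And>t. L' t > 0" "\<And>t. L (t + 2 * pi) = L t + 2 * pi"
    "\<And>t. (cis t - a) / (1 - cnj a * cis t) = cis (L t)"
proof -
  define u v where "u t = 1 - Re a * cos t - Im a * sin t" "v t = Im a * cos t - Re a * sin t" for t
  note uv = this
  have q: "1 - cnj a * cis t = Complex (u t) (v t)" for t by (simp add: complex_eq_iff uv)
  have a2: "(Re a)\<^sup>2 + (Im a)\<^sup>2 < 1" using a unfolding cmod_power2[symmetric] by (simp add: power_less_one_iff)
  have circ: "(1 - u t)\<^sup>2 + (v t)\<^sup>2 = (Re a)\<^sup>2 + (Im a)\<^sup>2" for t
  proof -
    have "(1 - u t)\<^sup>2 + (v t)\<^sup>2 = ((Re a)\<^sup>2 + (Im a)\<^sup>2) * ((sin t)\<^sup>2 + (cos t)\<^sup>2)" unfolding uv by algebra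
    then show ?thesis by simp
  qed
  have u: "u t > 0" for t
  proof -
    have "(1 - u t)\<^sup>2 < 1" using circ[of t] a2 zero_le_power2[of "v t"] by linarith
    then have "\<bar>1 - u t\<bar> < 1" by (simp add: abs_square_less_1)
    then show ?thesis by linarith
  qed
  define L where "L t = t - 2 * arctan (v t / u t)" for t
  define L' where "L' t = (1 - (Re a)\<^sup>2 - (Im a)\<^sup>2) / ((u t)\<^sup>2 + (v t)\<^sup>2)" for t
  show ?thesis
  proof (rule that[of L L'])
    fix t
    have n: "(u t)\<^sup>2 + (v t)\<^sup>2 > 0" using u[of t] by (simp add: add_pos_nonneg)
    show "L' t > 0" unfolding L'_def using n a2 by simp
    have du: "(u has_real_derivative - v t) (at t)" unfolding uv by (auto intro!: derivative_eq_intros)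
    have dv: "(v has_real_derivative u t - 1) (at t)" unfolding uv by (auto intro!: derivative_eq_intros)
    have "((\<lambda>t. v t / u t) has_real_derivative ((u t - 1) * u t - v t * (- v t)) / (u t * u t)) (at t)"
      using u[of t] by (intro DERIV_divide du dv) simp
    then have "((\<lambda>t. arctan (v t / u t)) has_real_derivative
        inverse (1 + (v t / u t)\<^sup>2) * (((u t - 1) * u t - v t * (- v t)) / (u t * u t))) (at t)"
      by (rule DERIV_chain2[OF DERIV_arctan])
    note DERIV_diff[OF DERIV_ident DERIV_cmult[OF this, of 2]]
    then have "(L has_real_derivative 1 - 2 * (inverse (1 + (v t / u t)\<^sup>2) * (((u t - 1) * u t - v t * (- v t)) / (u t * u t)))) (at t)"
      unfolding L_def .
    moreover have "1 - 2 * (inverse (1 + (v t / u t)\<^sup>2) * (((u t - 1) * u t - v t * (- v t)) / (u t * u t))) = L' t"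
    proof -
      have "1 + (v t / u t)\<^sup>2 = ((u t)\<^sup>2 + (v t)\<^sup>2) / (u t)\<^sup>2" using u[of t] by (simp add: power_divide add_divide_distrib)
      then have 1: "inverse (1 + (v t / u t)\<^sup>2) = (u t)\<^sup>2 / ((u t)\<^sup>2 + (v t)\<^sup>2)" by (simp only: inverse_divide)
      have "(u t)\<^sup>2 / ((u t)\<^sup>2 + (v t)\<^sup>2) * (((u t - 1) * u t - v t * (- v t)) / (u t * u t))
         = ((u t - 1) * u t + v t * v t) / ((u t)\<^sup>2 + (v t)\<^sup>2)" using u[of t] by (simp add: power2_eq_square)
      moreover have "1 - 2 * (((u t - 1) * u t + v t * v t) / ((u t)\<^sup>2 + (v t)\<^sup>2))
        = ((u t)\<^sup>2 + (v t)\<^sup>2 - 2 * ((u t - 1) * u t + v t * v t)) / ((u t)\<^sup>2 + (v t)\<^sup>2)"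
      proof -
        have "1 - 2 * (x / d) = (d - 2 * x) / d" if "d > 0" for x d :: real using that by (simp add: diff_divide_distrib)
        from this[OF n] show ?thesis .
      qed
      moreover have "(u t)\<^sup>2 + (v t)\<^sup>2 - 2 * ((u t - 1) * u t + v t * v t) = 1 - (Re a)\<^sup>2 - (Im a)\<^sup>2"
        using circ[of t] by algebra
      ultimately show ?thesis unfolding 1 L'_def by simp
    qed
    ultimately show "(L has_real_derivative L' t) (at t)" by simp
    show "L (t + 2 * pi) = L t + 2 * pi" by (simp add: L_def uv)
    define r where "r = v t / u t"
    have v: "v t = r * u t" using u[of t] by (simp add: r_def)
    have q1: "1 - cnj a * cis t = of_real (u t) * (1 + \<i> * of_real r)"
      unfolding q v by (simp add: complex_eq_iff)
    have q2: "1 - a * cis (- t) = of_real (u t) * (1 - \<i> * of_real r)"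
      using arg_cong[OF q1, of cnj] by (simp add: cis_cnj)
    have "cis t * cis (- t) = 1" by (simp add: cis_mult)
    then have "cis t - a = cis t * (1 - a * cis (- t))" by algebra
    then have "(cis t - a) / (1 - cnj a * cis t) = cis t * ((1 - \<i> * of_real r) / (1 + \<i> * of_real r))"
      unfolding q1 q2 using u[of t] by simp
    also have "\<dots> = cis (L t)" unfolding cis_arctan_double[symmetric] L_def r_def cis_mult by simp
    finally show "(cis t - a) / (1 - cnj a * cis t) = cis (L t)" .
  qed
qed

lemma blaschke_lift:
  assumes "cmod \<gamma> = 1" "\<forall>a\<in>set as. cmod a < 1"
  shows "\<exists>L L'. (\<forall>t. (L has_real_derivative L' t) (at t)) \<and> (\<forall>t. L' t \<ge> 0 \<and> (as \<noteq> [] \<longrightarrow> L' t > 0))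
    \<and> (\<forall>t. L (t + 2 * pi) = L t + 2 * pi * length as) \<and> (\<forall>t. blaschke \<gamma> as (cis t) = cis (L t))"
  using assms(2)
proof (induction as)
  case Nil
  show ?case by (rule exI[of _ "\<lambda>t. Arg \<gamma>"], rule exI[of _ "\<lambda>t. 0"]) (auto simp: cis_Arg_unit[OF assms(1)])
next
  case (Cons a as)
  have as: "\<forall>a\<in>set as. cmod a < 1" using Cons.prems by simp
  from Cons.IH[OF this] obtain K K' where K: "\<And>t. (K has_real_derivative K' t) (at t)" "\<And>t. K' t \<ge> 0"
    "\<And>t. K (t + 2 * pi) = K t + 2 * pi * length as" "\<And>t. blaschke \<gamma> as (cis t) = cis (K t)" by blast
  obtain L L' where L: "\<And>t. (L has_real_derivative L' t) (at t)" "\<And>t. L' t > 0" "\<And>t. L (t + 2 * pi) = L t + 2 * pi"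
    "\<And>t. (cis t - a) / (1 - cnj a * cis t) = cis (L t)"
    using blaschke_factor_lift[of a] Cons.prems by (metis list.set_intros(1))
  show ?case
  proof (rule exI[of _ "\<lambda>t. L t + K t"], rule exI[of _ "\<lambda>t. L' t + K' t"], intro conjI allI)
    fix t
    show "((\<lambda>t. L t + K t) has_real_derivative L' t + K' t) (at t)" by (intro DERIV_add L K)
    show "0 \<le> L' t + K' t" using L(2)[of t] K(2)[of t] by simp
    show "a # as \<noteq> [] \<longrightarrow> 0 < L' t + K' t" using L(2)[of t] K(2)[of t] by simp
    show "L (t + 2 * pi) + K (t + 2 * pi) = L t + K t + 2 * pi * length (a # as)"
      unfolding L(3) K(3) by (simp add: algebra_simps)
    show "blaschke \<gamma> (a # as) (cis t) = cis (L t + K t)" unfolding blaschke_simps L(4) K(4) cis_mult ..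
  qed
qed

section \<open>Fibres of a circle map with an increasing lift of degree N\<close>

locale circle_cover =
  fixes F :: "complex \<Rightarrow> complex" and L L' :: "real \<Rightarrow> real" and N :: nat
  assumes N: "N \<ge> 1"
    and deriv: "\<And>t. (L has_real_derivative L' t) (at t)"
    and deriv_pos: "\<And>t. L' t > 0"
    and period: "\<And>t. L (t + 2 * pi) = L t + 2 * pi * N"
    and lift: "\<And>t. F (cis t) = cis (L t)"
begin

lemma L_less: "s < t \<Longrightarrow> L s < L t"
  by (rule DERIV_pos_imp_increasing) (use deriv deriv_pos in blast)+

lemma L_less_iff: "L s < L t \<longleftrightarrow> s < t"
  using L_less[of s t] L_less[of t s] by (cases s t rule: linorder_cases) auto

lemma L_eq_iff: "L s = L t \<longleftrightarrow> s = t"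
  using L_less[of s t] L_less[of t s] by (cases s t rule: linorder_cases) auto

lemma L_period_add: "L (t + 2 * pi * of_nat k) = L t + 2 * pi * N * of_nat k"
proof (induction k)
  case (Suc k)
  have "L (t + 2 * pi * of_nat (Suc k)) = L ((t + 2 * pi * of_nat k) + 2 * pi)" by (simp add: algebra_simps)
  then show ?case unfolding period Suc by (simp add: algebra_simps)
qed simp

lemma L_surj: "\<exists>s. L s = y"
proof -
  obtain k :: nat where k: "\<bar>y\<bar> + \<bar>L 0\<bar> \<le> of_nat k" using real_arch_simple by blast
  have "1 \<le> 2 * pi * real N"
  proof -
    have "1 * 1 \<le> (2 * pi) * real N" by (rule mult_mono) (use N pi_gt3 in auto)
    then show ?thesis by simp
  qed
  then have "1 * of_nat k \<le> 2 * pi * N * real k" by (rule mult_right_mono) simp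
  then have k': "\<bar>y\<bar> + \<bar>L 0\<bar> \<le> 2 * pi * N * real k" using k by simp
  have 1: "y \<le> L (2 * pi * of_nat k)" using L_period_add[of 0 k] k' by simp
  have 2: "L (- 2 * pi * of_nat k) \<le> y" using L_period_add[of "- 2 * pi * of_nat k" k] k' by simp
  have "- 2 * pi * real k \<le> 2 * pi * of_nat k" by simp
  then show ?thesis using IVT[of L, OF 2 1] deriv DERIV_isCont by blast
qed

text \<open>Lift of the j-th next point of the fibre. Being real valued and defined for all j, it
  turns the cyclic order into the order of the line; \<open>step N\<close> adds 2 pi.\<close>

definition step :: "nat \<Rightarrow> real \<Rightarrow> real" where
  "step j t = (THE s. L s = L t + 2 * pi * j)"

lemma L_step: "L (step j t) = L t + 2 * pi * j"
proof -
  have "\<exists>!s. L s = L t + 2 * pi * j" using L_surj L_eq_iff by metis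
  then show ?thesis unfolding step_def by (rule theI')
qed

lemma step_eqI: "L s = L t + 2 * pi * j \<Longrightarrow> step j t = s"
  using L_step L_eq_iff by metis

lemma step_0: "step 0 t = t"
  by (rule step_eqI) simp

lemma step_step: "step i (step j t) = step (i + j) t"
  by (rule step_eqI) (simp add: L_step algebra_simps)

lemma step_N: "step N t = t + 2 * pi"
  by (rule step_eqI) (simp add: period)

lemma step_add_N: "step (j + N) t = step j t + 2 * pi"
  by (rule step_eqI, unfold period L_step) (simp add: algebra_simps)

lemma step_less_iff: "step i t < step j t \<longleftrightarrow> i < j"
  using L_less_iff[of "step i t" "step j t"] by (simp add: L_step)

lemma F_step: "F (cis (step j t)) = F (cis t)"
  unfolding lift L_step by (simp add: cis_multiple_2pi flip: cis_mult)

lemma step_bounds: assumes "j < N" shows "t \<le> step j t" "step j t < t + 2 * pi"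
  using step_less_iff[of j t N] step_less_iff[of 0 t j] step_less_iff[of j t 0] assms step_N[of t] step_0[of t]
  by (auto simp: not_less[symmetric])

text \<open>Equal values mean that the lifts differ by 2 pi m, and monotonicity over one period
  confines m to 0 \<le> m < N.\<close>

lemma fibre_exhaust:
  assumes "F (cis s) = F (cis t)" "t \<le> s" "s < t + 2 * pi"
  obtains j where "j < N" "s = step j t"
proof -
  have "cis (L s) = cis (L t)" using assms(1) lift by simp
  then have "cos (L s) = cos (L t) \<and> sin (L s) = sin (L t)" by (metis cis.sel)
  then obtain m :: int where m: "L s = L t + 2 * pi * m" using sin_cos_eq_iff[of "L s" "L t"] by (auto simp: mult_ac)
  have "L t \<le> L s" using assms(2) L_less_iff[of s t] by (simp add: not_less[symmetric])
  then have "0 \<le> m" using m mult_le_cancel_left_pos[of "2 * pi" 0 "of_int m"] by simp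
  have "L s < L t + 2 * pi * N" using assms(3) L_less_iff[of s "t + 2 * pi"] period by simp
  then have "2 * pi * m < 2 * pi * N" using m by simp
  then have "real_of_int m < real N" by simp
  then have "nat m < N" using \<open>0 \<le> m\<close> by linarith
  moreover have "s = step (nat m) t" by (rule sym, rule step_eqI) (use m \<open>0 \<le> m\<close> in simp)
  ultimately show ?thesis using that by blast
qed

text \<open>\<open>step j\<close> is \<open>L\<close> followed by a shift and the inverse of
  \<open>L\<close>, so the inverse function theorem applies.\<close>

lemma step_deriv: "\<exists>D>0. (step j has_real_derivative D) (at t)"
proof -
  define G where "G y = (THE s. L s = y)" for y
  have GL: "G (L s) = s" for s unfolding G_def using L_eq_iff by auto
  have LG: "L (G y) = y" for y using L_surj[of y] GL by auto
  have st: "step j = (\<lambda>t. G (L t + 2 * pi * j))" using L_step GL by metis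
  let ?y = "L t + 2 * pi * j"
  have contG: "isCont G ?y"
  proof -
    have "isCont G (L (G ?y))"
      by (rule isCont_inverse_function[of 1 "G ?y" G L]) (use GL DERIV_isCont[OF deriv] in auto)
    then show ?thesis by (simp add: LG)
  qed
  have "(G has_real_derivative inverse (L' (G ?y))) (at ?y)"
    by (rule DERIV_inverse_function[of L _ _ _ "?y - 1" "?y + 1"]) (use deriv deriv_pos[of "G ?y"] LG contG in auto)
  moreover have "((\<lambda>t. L t + 2 * pi * j) has_real_derivative L' t) (at t)"
    using DERIV_add[OF deriv DERIV_const] by fastforce
  ultimately have "(step j has_real_derivative inverse (L' (G ?y)) * L' t) (at t)"
    unfolding st by (rule DERIV_chain2)
  then show ?thesis using deriv_pos by (intro exI[of _ "inverse (L' (G ?y)) * L' t"]) simp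
qed

lemma ccw_angle_cis: assumes "t \<le> s" "s < t + 2 * pi" shows "ccw_angle (cis t) (cis s) = s - t"
proof (cases "s - t \<le> pi")
  case True
  have "Arg (cis s / cis t) = s - t" unfolding cis_divide using True assms by (intro cis_Arg_unique) auto
  then show ?thesis using assms by (simp add: ccw_angle_def)
next
  case False
  have "cis s / cis t = cis (s - t - 2 * pi)" unfolding cis_divide by (simp add: complex_eq_iff cos_diff sin_diff)
  then have "Arg (cis s / cis t) = s - t - 2 * pi" using False assms by (intro cis_Arg_unique) auto
  then show ?thesis using assms by (simp add: ccw_angle_def)
qed

lemma circle_fibre_eq: "circle_fibre F (cis t) = (\<lambda>j. cis (step j t)) ` {..<N}"
proof
  show "circle_fibre F (cis t) \<subseteq> (\<lambda>j. cis (step j t)) ` {..<N}"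
  proof
    fix z assume "z \<in> circle_fibre F (cis t)"
    then have z: "cmod z = 1" "F z = F (cis t)" by (auto simp: circle_fibre_def)
    define s where "s = t + ccw_angle (cis t) z"
    have n: "cmod (z / cis t) = 1" using z by (simp add: norm_divide)
    have b: "t \<le> s" "s < t + 2 * pi" unfolding s_def ccw_angle_def using Arg_bounded[of "z / cis t"] pi_gt_zero
      by auto
    have "cis (Arg (z / cis t)) = z / cis t" by (rule cis_Arg_unit[OF n])
    then have "cis (ccw_angle (cis t) z) = z / cis t"
      unfolding ccw_angle_def by (simp flip: cis_mult)
    then have "z = cis s" unfolding s_def by (simp flip: cis_mult)
    obtain j where "j < N" "s = step j t" by (rule fibre_exhaust[OF _ b]) (use z(2) \<open>z = cis s\<close> in auto)
    then show "z \<in> (\<lambda>j. cis (step j t)) ` {..<N}" using \<open>z = cis s\<close> by auto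
  qed
  show "(\<lambda>j. cis (step j t)) ` {..<N} \<subseteq> circle_fibre F (cis t)"
    using F_step by (auto simp: circle_fibre_def)
qed

lemma ccw_angle_step: "j < N \<Longrightarrow> ccw_angle (cis t) (cis (step j t)) = step j t - t"
  using step_bounds by (intro ccw_angle_cis) auto

lemma cis_step_add_mult: "cis (step (m + q * N) t) = cis (step m t)"
proof (induction q)
  case (Suc q)
  have "m + Suc q * N = (m + q * N) + N" by simp
  then have "cis (step (m + Suc q * N) t) = cis (step (m + q * N) t + 2 * pi)" by (simp only: step_add_N)
  also have "\<dots> = cis (step (m + q * N) t)" by (simp add: cis.ctr)
  finally show ?case using Suc by simp
qed simp

lemma cis_step_mod: "cis (step (i mod N) t) = cis (step i t)"
  using cis_step_add_mult[of "i mod N" "i div N" t] by (simp only: mod_div_mult_eq)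

lemma inj_on_cis_step: "inj_on (\<lambda>i. cis (step i t)) {..<N}"
proof (rule inj_onI)
  fix a b assume "a \<in> {..<N}" "b \<in> {..<N}" and eq: "cis (step a t) = cis (step b t)"
  then have "step a t - t = step b t - t" using ccw_angle_step[of a t] ccw_angle_step[of b t] by (simp only: lessThan_iff)
  then show "a = b" using step_less_iff[of a t b] step_less_iff[of b t a] by linarith
qed

lemma cis_step_eq_iff: "cis (step i t) = cis (step j t) \<longleftrightarrow> i mod N = j mod N"
proof -
  have "i mod N < N" "j mod N < N" using N by auto
  then have "cis (step (i mod N) t) = cis (step (j mod N) t) \<longleftrightarrow> i mod N = j mod N"
    using inj_on_eq_iff[OF inj_on_cis_step, of "i mod N" "j mod N" t] by blast
  then show ?thesis unfolding cis_step_mod .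
qed

text \<open>The angles seen from \<open>cis t\<close> are the increasing numbers
  \<open>step j t - t\<close>, so exactly j points of the fibre precede the j-th.\<close>

lemma fibre_step_eq: assumes "j < N" shows "fibre_step F (cis t) j = cis (step j t)"
proof -
  have card: "card {u \<in> circle_fibre F (cis t). ccw_angle (cis t) u < ccw_angle (cis t) (cis (step i t))} = i" if i: "i < N" for i
  proof -
    have "ccw_angle (cis t) (cis (step k t)) < ccw_angle (cis t) (cis (step i t)) \<longleftrightarrow> k < i" if "k < N" for k
      unfolding ccw_angle_step[OF i] ccw_angle_step[OF that] using step_less_iff[of k t i] by simp
    then have "{u \<in> circle_fibre F (cis t). ccw_angle (cis t) u < ccw_angle (cis t) (cis (step i t))} = (\<lambda>j. cis (step j t)) ` {..<i}"
      unfolding circle_fibre_eq using i by fastforce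
    moreover have "inj_on (\<lambda>j. cis (step j t)) {..<i}" by (rule inj_on_subset[OF inj_on_cis_step]) (use i in auto)
    ultimately show ?thesis by (simp add: card_image)
  qed
  show ?thesis unfolding fibre_step_def
  proof (rule the_equality)
    show "cis (step j t) \<in> circle_fibre F (cis t) \<and>
        card {u \<in> circle_fibre F (cis t). ccw_angle (cis t) u < ccw_angle (cis t) (cis (step j t))} = j"
      using card[OF assms] assms unfolding circle_fibre_eq by blast
    fix z assume z: "z \<in> circle_fibre F (cis t) \<and> card {u \<in> circle_fibre F (cis t). ccw_angle (cis t) u < ccw_angle (cis t) z} = j"
    then obtain i where i: "i < N" "z = cis (step i t)" unfolding circle_fibre_eq by blast
    have "i = j" using z unfolding i(2) card[OF i(1)] by (rule conjunct2)
    then show "z = cis (step j t)" using i by blast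
  qed
qed

end

section \<open>Ellipses and their support functions\<close>

text \<open>With s = Re (y cnj d) the focal distances of a point of the ellipse are a + s / a and a
  - s / a; this disposes of both square roots.\<close>

lemma focal_sum_iff:
  fixes y d :: complex
  assumes a: "cmod d < a"
  shows "cmod (y - d) + cmod (y + d) = 2 * a \<longleftrightarrow> a\<^sup>2 * (cmod y)\<^sup>2 - (Re (y * cnj d))\<^sup>2 = a\<^sup>2 * (a\<^sup>2 - (cmod d)\<^sup>2)"
proof -
  define p m n e s where "p = cmod (y + d)" "m = cmod (y - d)" "n = cmod y" "e = cmod d" and s: "s = Re (y * cnj d)"
  note defs = this
  have p2: "p\<^sup>2 = n\<^sup>2 + e\<^sup>2 + 2 * s" and m2: "m\<^sup>2 = n\<^sup>2 + e\<^sup>2 - 2 * s"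
    unfolding defs cmod_power2 by (simp_all add: power2_eq_square algebra_simps)
  have pos1: "p \<ge> 0" "m \<ge> 0" "0 \<le> e" "e < a" using a by (simp_all add: defs)
  then have pos: "p \<ge> 0" "m \<ge> 0" "a > 0" "0 \<le> e" "e < a" by auto
  show ?thesis unfolding defs[symmetric]
  proof
    assume "m + p = 2 * a"
    then have "2 * a * (p - m) = 4 * s" using p2 m2 by algebra
    then have "a * p = a\<^sup>2 + s" using \<open>m + p = 2 * a\<close> by algebra
    then have "a\<^sup>2 * p\<^sup>2 = (a\<^sup>2 + s)\<^sup>2" by (metis power_mult_distrib)
    then show "a\<^sup>2 * n\<^sup>2 - s\<^sup>2 = a\<^sup>2 * (a\<^sup>2 - e\<^sup>2)" unfolding p2 by algebra
  next
    assume q: "a\<^sup>2 * n\<^sup>2 - s\<^sup>2 = a\<^sup>2 * (a\<^sup>2 - e\<^sup>2)"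
    have cs: "\<bar>s\<bar> \<le> n * e" using abs_Re_le_cmod[of "y * cnj d"] by (simp add: defs norm_mult)
    \<comment> \<open>Keeps a^2 + s and a^2 - s nonnegative, so that roots can be taken in the
      squared equations below.\<close>
    have s_le: "\<bar>s\<bar> \<le> a\<^sup>2"
    proof (rule power2_le_imp_le)
      have "s\<^sup>2 \<le> n\<^sup>2 * e\<^sup>2" using power_mono[OF cs, of 2] by (simp add: power_mult_distrib)
      then have "a\<^sup>2 * s\<^sup>2 \<le> (a\<^sup>2 * n\<^sup>2) * e\<^sup>2" using mult_left_mono[of "s\<^sup>2" "n\<^sup>2 * e\<^sup>2" "a\<^sup>2"] by (simp add: mult_ac)
      also have "a\<^sup>2 * n\<^sup>2 = s\<^sup>2 + a\<^sup>2 * (a\<^sup>2 - e\<^sup>2)" using q by simp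
      finally have "(a\<^sup>2 - e\<^sup>2) * s\<^sup>2 \<le> (a\<^sup>2 - e\<^sup>2) * (a\<^sup>2 * e\<^sup>2)" by (simp add: algebra_simps)
      moreover have ae: "e\<^sup>2 < a\<^sup>2" using pos by (intro power_strict_mono) auto
      ultimately have "s\<^sup>2 \<le> a\<^sup>2 * e\<^sup>2" by (simp add: mult_le_cancel_left)
      also have "\<dots> \<le> a\<^sup>2 * a\<^sup>2" using ae by (intro mult_left_mono) auto
      finally show "\<bar>s\<bar>\<^sup>2 \<le> (a\<^sup>2)\<^sup>2" by (simp add: power2_eq_square)
    qed simp
    have "(a * p)\<^sup>2 = (a\<^sup>2 + s)\<^sup>2" using q p2 by algebra
    then have "a * p = a\<^sup>2 + s" using pos s_le by (elim power2_eq_imp_eq) auto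
    moreover have "(a * m)\<^sup>2 = (a\<^sup>2 - s)\<^sup>2" using q m2 by algebra
    then have "a * m = a\<^sup>2 - s" using pos s_le by (elim power2_eq_imp_eq) auto
    ultimately have "a * (m + p) = a * (2 * a)" by (simp add: algebra_simps power2_eq_square)
    then show "m + p = 2 * a" using pos by simp
  qed
qed

text \<open>The point where the ellipse with foci \<open>\<plusminus>d\<close> and semiminor axis \<open>b\<close> has outer unit normal \<open>u\<close>;
  the real part in the rotated frame is its support function.\<close>
definition ellipse_point :: "real \<Rightarrow> complex \<Rightarrow> complex \<Rightarrow> complex" where
  "ellipse_point b d u = u * Complex (sqrt (b\<^sup>2 + (Re (d * cnj u))\<^sup>2))
      (Re (d * cnj u) * Im (d * cnj u) / sqrt (b\<^sup>2 + (Re (d * cnj u))\<^sup>2))"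

lemma ellipse_point_focal:
  assumes u: "cmod u = 1" and b: "b > 0"
  shows "cmod (ellipse_point b d u - d) + cmod (ellipse_point b d u + d) = 2 * sqrt (b\<^sup>2 + (cmod d)\<^sup>2)"
proof -
  define r s where "r = Re (d * cnj u)" "s = Im (d * cnj u)"
  define w where "w = sqrt (b\<^sup>2 + r\<^sup>2)"
  have w: "w > 0" "w\<^sup>2 = b\<^sup>2 + r\<^sup>2" using b by (simp_all add: w_def add_pos_nonneg)
  define a where "a = sqrt (b\<^sup>2 + (cmod d)\<^sup>2)"
  have a: "a\<^sup>2 = b\<^sup>2 + (cmod d)\<^sup>2" by (simp add: a_def)
  have d: "(cmod d)\<^sup>2 = r\<^sup>2 + s\<^sup>2"
  proof -
    have "cmod d = cmod (d * cnj u)" using u by (simp add: norm_mult)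
    then show ?thesis unfolding r_s_def cmod_power2[symmetric] by simp
  qed
  have uu: "cnj u * u = 1" using u complex_norm_square[of u] by (simp add: mult.commute)
  have y: "ellipse_point b d u = u * Complex w (r * s / w)" unfolding ellipse_point_def w_def r_s_def ..
  have "cnj d * u = cnj (d * cnj u)" by simp
  also have "\<dots> = Complex r (- s)" unfolding r_s_def by (simp add: complex_eq_iff)
  finally have "ellipse_point b d u * cnj d = Complex w (r * s / w) * Complex r (- s)" unfolding y by (simp add: mult_ac)
  then have ip: "Re (ellipse_point b d u * cnj d) = w * r + r * s / w * s" by simp
  have n: "(cmod (ellipse_point b d u))\<^sup>2 = w\<^sup>2 + (r * s / w)\<^sup>2" unfolding y norm_mult u cmod_power2 by (simp add: cmod_power2)
  have ipw: "w * (w * r + r * s / w * s) = r * a\<^sup>2"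
  proof -
    have "w * (w * r + r * s / w * s) = w\<^sup>2 * r + r * s\<^sup>2" using w(1) by (simp add: field_simps power2_eq_square)
    then show ?thesis unfolding a d w(2) by algebra
  qed
  have nw: "w\<^sup>2 * (w\<^sup>2 + (r * s / w)\<^sup>2) = w\<^sup>2 * w\<^sup>2 + r\<^sup>2 * s\<^sup>2" using w(1) by (simp add: field_simps power2_eq_square)
  have "w\<^sup>2 * (a\<^sup>2 * (w\<^sup>2 + (r * s / w)\<^sup>2) - (w * r + r * s / w * s)\<^sup>2) = w\<^sup>2 * (a\<^sup>2 * b\<^sup>2)"
    using ipw nw a d w(2) by algebra
  then have key: "a\<^sup>2 * (w\<^sup>2 + (r * s / w)\<^sup>2) - (w * r + r * s / w * s)\<^sup>2 = a\<^sup>2 * b\<^sup>2" using w(1) by simp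
  have "cmod d < a" unfolding a_def using b by (intro real_less_rsqrt) simp
  then show ?thesis unfolding a_def[symmetric] focal_sum_iff[OF \<open>cmod d < a\<close>] ip n using key a by simp
qed

lemma focal_imp_ellipse_point:
  assumes b: "b > 0" and y: "cmod (y - d) + cmod (y + d) = 2 * sqrt (b\<^sup>2 + (cmod d)\<^sup>2)"
  obtains u where "cmod u = 1" "y = ellipse_point b d u"
proof -
  define a where "a = sqrt (b\<^sup>2 + (cmod d)\<^sup>2)"
  have a: "a\<^sup>2 = b\<^sup>2 + (cmod d)\<^sup>2" by (simp add: a_def)
  have ad: "cmod d < a" unfolding a_def using b by (intro real_less_rsqrt) simp
  then have a0: "a > 0" using norm_ge_zero[of d] by linarith
  define t where "t = Re (y * cnj d)"
  have q: "a\<^sup>2 * (cmod y)\<^sup>2 - t\<^sup>2 = a\<^sup>2 * b\<^sup>2"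
    using y unfolding a_def[symmetric] focal_sum_iff[OF ad] t_def[symmetric] by (simp add: a)
  \<comment> \<open>Half the gradient at y of a^2 |y|^2 - (Re (y cnj d))^2, hence an outer normal of
    the ellipse.\<close>
  define n where "n = of_real (a\<^sup>2) * y - of_real t * d"
  have yn: "Re (y * cnj n) = a\<^sup>2 * b\<^sup>2"
  proof -
    have "y * cnj n = of_real (a\<^sup>2) * (y * cnj y) - of_real t * (y * cnj d)" unfolding n_def by (simp add: algebra_simps)
    also have "Re \<dots> = a\<^sup>2 * (cmod y)\<^sup>2 - t * Re (y * cnj d)" unfolding complex_norm_square[symmetric] by (simp flip: of_real_power)
    finally show ?thesis using q by (simp add: t_def power2_eq_square)
  qed
  then have n0: "n \<noteq> 0" using a0 b by auto
  define u where "u = n / of_real (cmod n)"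
  have u: "cmod u = 1" using n0 by (simp add: u_def norm_divide)
  have nu: "n = of_real (cmod n) * u" using n0 by (simp add: u_def)
  have dn: "Re (d * cnj n) = b\<^sup>2 * t"
  proof -
    have "d * cnj n = of_real (a\<^sup>2) * cnj (y * cnj d) - of_real t * (d * cnj d)" unfolding n_def by (simp add: algebra_simps)
    also have "Re \<dots> = a\<^sup>2 * t - t * (cmod d)\<^sup>2" unfolding complex_norm_square[symmetric] t_def by (simp flip: of_real_power)
    finally show ?thesis unfolding a by algebra
  qed
  \<comment> \<open>Inverts the linear map y -> n, so that y is recovered from its normal.\<close>
  have My: "of_real (b\<^sup>2) * n + of_real (Re (d * cnj n)) * d = of_real (a\<^sup>2 * b\<^sup>2) * y"
    unfolding dn unfolding n_def by (simp add: algebra_simps)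
  define w where "w = sqrt (b\<^sup>2 + (Re (d * cnj u))\<^sup>2)"
  have w: "w > 0" "w\<^sup>2 = b\<^sup>2 + (Re (d * cnj u))\<^sup>2" using b by (simp_all add: w_def add_pos_nonneg)
  have uu: "u * cnj u = 1" using u complex_norm_square[of u] by simp
  have E: "of_real w * ellipse_point b d u = of_real (b\<^sup>2) * u + of_real (Re (d * cnj u)) * d"
  proof -
    define r s where "r = Re (d * cnj u)" "s = Im (d * cnj u)"
    have ds: "d = u * Complex r s"
    proof -
      have "Complex r s = d * cnj u" unfolding r_s_def by (rule complex_surj)
      then show ?thesis using uu by (simp add: mult.left_commute)
    qed
    have "of_real w * ellipse_point b d u = u * (of_real w * Complex w (r * s / w))"
    proof -
      have "sqrt (b\<^sup>2 + r\<^sup>2) = w" by (simp add: w_def r_s_def)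
      then show ?thesis unfolding ellipse_point_def r_s_def[symmetric] by (simp add: mult.left_commute)
    qed
    also have "of_real w * Complex w (r * s / w) = Complex (w\<^sup>2) (r * s)" using w(1) by (simp add: complex_eq_iff power2_eq_square)
    also have "\<dots> = of_real (b\<^sup>2) + of_real r * Complex r s" unfolding w(2) r_s_def[symmetric] by (simp add: complex_eq_iff power2_eq_square)
    also have "u * \<dots> = of_real (b\<^sup>2) * u + of_real r * (u * Complex r s)" by (simp add: algebra_simps)
    finally show ?thesis unfolding ds[symmetric] unfolding r_s_def .
  qed
  have dnu: "Re (d * cnj n) = cmod n * Re (d * cnj u)" by (subst nu) (simp add: algebra_simps)
  have E2: "of_real (cmod n * w) * ellipse_point b d u = of_real (a\<^sup>2 * b\<^sup>2) * y"
  proof -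
    have "of_real (cmod n * w) * ellipse_point b d u = of_real (b\<^sup>2) * (of_real (cmod n) * u) + of_real (cmod n * Re (d * cnj u)) * d"
      using E unfolding of_real_mult by algebra
    then show ?thesis unfolding nu[symmetric] dnu[symmetric] My .
  qed
  have "cmod n * w = a\<^sup>2 * b\<^sup>2"
  proof -
    have "Re (of_real (cmod n * w) * ellipse_point b d u * cnj n) = (cmod n * w)\<^sup>2"
    proof -
      have "of_real w * ellipse_point b d u * cnj u = of_real (b\<^sup>2) * (u * cnj u) + of_real (Re (d * cnj u)) * (d * cnj u)"
        unfolding E by (simp add: algebra_simps)
      also have "Re \<dots> = w\<^sup>2" unfolding uu w(2) by (simp add: power2_eq_square)
      finally have 1: "Re (of_real w * ellipse_point b d u * cnj u) = w\<^sup>2" .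
      have "of_real (cmod n * w) * ellipse_point b d u * cnj n = of_real ((cmod n)\<^sup>2) * (of_real w * ellipse_point b d u * cnj u)"
        by (subst (2) nu) (simp add: algebra_simps power2_eq_square)
      also have "Re \<dots> = (cmod n)\<^sup>2 * Re (of_real w * ellipse_point b d u * cnj u)"
        by (simp only: times_complex.sel Re_complex_of_real Im_complex_of_real)
      finally show ?thesis unfolding 1 by (simp add: power_mult_distrib)
    qed
    moreover have "Re (of_real (a\<^sup>2 * b\<^sup>2) * y * cnj n) = (a\<^sup>2 * b\<^sup>2)\<^sup>2"
    proof -
      have "Re (of_real (a\<^sup>2 * b\<^sup>2) * y * cnj n) = a\<^sup>2 * b\<^sup>2 * Re (y * cnj n)"
        by (simp only: mult.assoc times_complex.sel Re_complex_of_real Im_complex_of_real)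
      then show ?thesis unfolding yn by (simp add: power2_eq_square)
    qed
    ultimately have "(cmod n * w)\<^sup>2 = (a\<^sup>2 * b\<^sup>2)\<^sup>2" unfolding E2 by simp
    then show ?thesis using w(1) by (elim power2_eq_imp_eq) auto
  qed
  then have "y = ellipse_point b d u" using E2 a0 b by simp
  with u show ?thesis using that by blast
qed

text \<open>The bridge to support functions: the chord has unit normal \<open>cis \<phi>\<close> and
  signed distance cos \<delta>, and in these data the form is quadratic in the distance.\<close>

lemma chord_form_support:
  "chord_form A B C D (cis (\<phi> - \<delta>)) (cis (\<phi> + \<delta>))
    = (cis \<phi>)\<^sup>2 * of_real (4 * C * (cos \<delta>)\<^sup>2 + 4 * cos \<delta> * Re (B * cis \<phi>) + D - 2 * C + 2 * Re (A * (cis \<phi>)\<^sup>2))"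
proof -
  define u h where "u = cis \<phi>" "h = complex_of_real (cos \<delta>)"
  have s: "cis (\<phi> - \<delta>) + cis (\<phi> + \<delta>) = 2 * h * u" unfolding u_h_def by (simp add: complex_eq_iff cos_add cos_diff sin_add sin_diff)
  have p: "cis (\<phi> - \<delta>) * cis (\<phi> + \<delta>) = u\<^sup>2" unfolding u_h_def by (simp add: cis_mult power2_eq_square)
  have uu: "u * cnj u = 1" unfolding u_h_def by (simp add: cis_cnj cis_mult)
  have 1: "complex_of_real (2 * Re (A * u\<^sup>2)) = A * u\<^sup>2 + cnj A * (cnj u)\<^sup>2"
    using complex_add_cnj[of "A * u\<^sup>2"] by simp
  have 2: "complex_of_real (2 * Re (B * u)) = B * u + cnj B * cnj u"
    using complex_add_cnj[of "B * u"] by simp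
  have "complex_of_real (4 * C * (cos \<delta>)\<^sup>2 + 4 * cos \<delta> * Re (B * u) + D - 2 * C + 2 * Re (A * u\<^sup>2))
     = of_real (4 * C * (cos \<delta>)\<^sup>2 + 2 * cos \<delta> * (2 * Re (B * u)) + D - 2 * C) + of_real (2 * Re (A * u\<^sup>2))"
    by simp
  also have "\<dots> = 4 * of_real C * h\<^sup>2 + 2 * h * of_real (2 * Re (B * u)) + of_real D - 2 * of_real C + of_real (2 * Re (A * u\<^sup>2))"
    unfolding u_h_def by simp
  finally have r: "complex_of_real (4 * C * (cos \<delta>)\<^sup>2 + 4 * cos \<delta> * Re (B * u) + D - 2 * C + 2 * Re (A * u\<^sup>2))
      = 4 * of_real C * h\<^sup>2 + 2 * h * (B * u + cnj B * cnj u) + of_real D - 2 * of_real C + (A * u\<^sup>2 + cnj A * (cnj u)\<^sup>2)"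
    unfolding 1 2 .
  show ?thesis unfolding u_h_def(1)[symmetric] r chord_form_def using s p uu by algebra
qed

section \<open>Envelopes of chords\<close>

text \<open>The chord through \<open>cis (\<phi> - \<delta>)\<close> and \<open>cis (\<phi> + \<delta>)\<close> is the line
  \<open>Re (x * cis (- \<phi>)) = cos \<delta>\<close>.\<close>
lemma Im_chord:
  "Im ((x - cis s) * cnj (cis g - cis s))
     = - 2 * sin ((g - s) / 2) * (Re (x * cis (- ((s + g) / 2))) - cos ((g - s) / 2))"
proof -
  define p d where "p = (s + g) / 2" "d = (g - s) / 2"
  have sg: "s = p - d" "g = p + d" by (simp_all add: p_d_def field_simps)
  have 1: "cis g - cis s = 2 * \<i> * sin d * cis p" unfolding sg
    by (simp add: complex_eq_iff cos_add cos_diff sin_add sin_diff)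
  have 2: "cis s = cis p * (cos d - \<i> * sin d)" unfolding sg
    by (simp add: complex_eq_iff cos_add cos_diff sin_add sin_diff algebra_simps)
  have "(x - cis s) * cnj (cis g - cis s) = - 2 * \<i> * sin d * (x * cis (- p) - cos d + \<i> * sin d)"
  proof -
    have "cis p * cis (- p) = 1" by (simp add: cis_mult)
    then show ?thesis unfolding 1 unfolding 2 complex_cnj_mult complex_cnj_numeral complex_cnj_i complex_cnj_complex_of_real cis_cnj by algebra
  qed
  then show ?thesis unfolding p_d_def[symmetric] by simp
qed

context circle_cover
begin

text \<open>The j-th chord from \<open>cis t\<close> is the line with unit normal
  \<open>cis (mid j t)\<close> at signed distance \<open>cos (half j t)\<close>.\<close>

definition mid :: "nat \<Rightarrow> real \<Rightarrow> real" where "mid j t = (t + step j t) / 2"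
definition half :: "nat \<Rightarrow> real \<Rightarrow> real" where "half j t = (step j t - t) / 2"

lemma mid_half: "mid j t - half j t = t" "mid j t + half j t = step j t"
  by (simp_all add: mid_def half_def field_simps)

lemma half_bounds: assumes "0 < j" "j < N" shows "0 < half j t" "half j t < pi"
  using step_less_iff[of 0 t j] step_bounds[OF assms(2), of t] assms step_0[of t] by (auto simp: half_def)

lemma mid_deriv: "\<exists>D>0. (mid j has_real_derivative D) (at t)"
proof -
  obtain D where D: "D > 0" "(step j has_real_derivative D) (at t)" using step_deriv by blast
  have "(mid j has_real_derivative (1 + D) / 2) (at t)"
    unfolding mid_def by (auto intro!: derivative_eq_intros D(2))
  then show ?thesis using D(1) by (intro exI[of _ "(1 + D) / 2"]) simp
qed

lemma mid_surj: assumes "j < N" shows "\<exists>t. mid j t = \<theta>"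
proof -
  have "mid j (\<theta> - pi) \<le> \<theta>" using step_bounds(2)[OF assms, of "\<theta> - pi"] by (simp add: mid_def)
  moreover have "\<theta> \<le> mid j \<theta>" using step_bounds(1)[OF assms, of \<theta>] by (simp add: mid_def)
  moreover have "isCont (mid j) t" for t
    using mid_deriv[of j t] DERIV_isCont by blast
  ultimately show ?thesis using IVT[of "mid j" "\<theta> - pi" \<theta> \<theta>] pi_gt_zero by auto
qed

text \<open>Opposite normals with opposite distances describe one chord traversed both ways, so that
  two j-fold steps make a full turn; 2 j < N excludes this.\<close>

lemma opposite_chord_distinct:
  assumes j: "0 < j" "2 * j < N" and mid: "mid j t' = mid j t + pi"
  shows "cos (half j t') \<noteq> - cos (half j t)"
proof
  assume eq: "cos (half j t') = - cos (half j t)"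
  have jN: "j < N" using j by simp
  have "cos (half j t') = cos (pi - half j t)" using eq by simp
  then have h: "half j t' = pi - half j t"
    by (rule cos_inj_pi[rotated 4]) (use half_bounds[OF j(1) jN, of t] half_bounds[OF j(1) jN, of t'] in auto)
  have "t' = step j t" using mid_half[of j t'] mid_half[of j t] mid h by linarith
  moreover have "step j t' = t + 2 * pi" using mid_half[of j t'] mid_half[of j t] mid h by linarith
  ultimately have "step (j + j) t = step N t" by (simp add: step_step step_N)
  then show False using step_less_iff[of "j + j" t N] j by simp
qed

text \<open>The function of the definition is the support equation times - 2 sin (half), which never
  vanishes; such a factor changes neither the zeros nor whether the derivative vanishes at a
  zero.\<close>

lemma poncelet_curve_iff:
  assumes j: "0 < j" "j < N"
  shows "x \<in> poncelet_curve F j \<longleftrightarrow> (\<exists>t. Re (x * cis (- mid j t)) = cos (half j t) \<and>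
     ((\<lambda>s. Re (x * cis (- mid j s)) - cos (half j s)) has_real_derivative 0) (at t))"
proof -
  define r where "r s = Re (x * cis (- mid j s)) - cos (half j s)" for s
  define m where "m s = - 2 * sin (half j s)" for s
  have eq: "Im ((x - cis s) * cnj (fibre_step F (cis s) j - cis s)) = m s * r s" for s
    unfolding fibre_step_eq[OF j(2)] Im_chord m_def r_def mid_def half_def ..
  have m: "m s \<noteq> 0" for s using half_bounds[OF j, of s] sin_gt_zero[of "half j s"] by (simp add: m_def)
  have key: "((\<lambda>s. m s * r s) has_real_derivative 0) (at t) \<longleftrightarrow> (r has_real_derivative 0) (at t)" if "r t = 0" for t
  proof -
    obtain D where D: "(step j has_real_derivative D) (at t)" using step_deriv by blast
    have dm: "(m has_real_derivative - 2 * (cos (half j t) * ((D - 1) / 2))) (at t)"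
      unfolding m_def half_def by (auto intro!: derivative_eq_intros D)
    have dm': "((\<lambda>s. inverse (m s)) has_real_derivative - (inverse (m t) * (- 2 * (cos (half j t) * ((D - 1) / 2))) * inverse (m t))) (at t)"
      by (rule DERIV_inverse'[OF dm m])
    show ?thesis
    proof
      assume "(r has_real_derivative 0) (at t)"
      from DERIV_mult[OF dm this] show "((\<lambda>s. m s * r s) has_real_derivative 0) (at t)" using that by simp
    next
      assume "((\<lambda>s. m s * r s) has_real_derivative 0) (at t)"
      from DERIV_mult[OF dm' this] have "((\<lambda>s. inverse (m s) * (m s * r s)) has_real_derivative 0) (at t)" using that by simp
      moreover have "(\<lambda>s. inverse (m s) * (m s * r s)) = r" using m by auto
      ultimately show "(r has_real_derivative 0) (at t)" by simp
    qed
  qed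
  have "x \<in> poncelet_curve F j \<longleftrightarrow> (\<exists>t. m t * r t = 0 \<and> ((\<lambda>s. m s * r s) has_real_derivative 0) (at t))"
    unfolding poncelet_curve_def Let_def eq mem_Collect_eq ..
  also have "\<dots> \<longleftrightarrow> (\<exists>t. r t = 0 \<and> (r has_real_derivative 0) (at t))"
    using m key by auto
  finally show ?thesis unfolding r_def by simp
qed

lemma half_deriv: "\<exists>D. (half j has_real_derivative D) (at t)"
proof -
  obtain D where D: "(step j has_real_derivative D) (at t)" using step_deriv by blast
  have "(half j has_real_derivative (D - 1) / 2) (at t)"
    unfolding half_def by (auto intro!: derivative_eq_intros D)
  then show ?thesis by blast
qed

lemma Re_rotated_deriv:
  assumes "(f has_real_derivative D) (at t)"
  shows "((\<lambda>s. Re (x * cis (- f s))) has_real_derivative D * Im (x * cis (- f t))) (at t)"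
proof -
  have "((\<lambda>s. Re x * cos (f s) + Im x * sin (f s)) has_real_derivative D * (Im x * cos (f t) - Re x * sin (f t))) (at t)"
    by (auto intro!: derivative_eq_intros assms simp: algebra_simps)
  then show ?thesis by (simp add: algebra_simps)
qed

lemma Re_chord_deriv:
  assumes "(mid j has_real_derivative P) (at t)" "(half j has_real_derivative H) (at t)"
  shows "((\<lambda>s. Re (x * cis (- mid j s)) - cos (half j s)) has_real_derivative P * Im (x * cis (- mid j t)) + H * sin (half j t)) (at t)"
proof -
  have "((\<lambda>s. cos (half j s)) has_real_derivative - sin (half j t) * H) (at t)"
    by (rule DERIV_chain2[OF DERIV_cos assms(2)])
  from DERIV_diff[OF Re_rotated_deriv[OF assms(1)] this] show ?thesis by (simp add: mult.commute)
qed

lemma complex_rotated_eqI: "Re (x * cis p) = Re (y * cis p) \<Longrightarrow> Im (x * cis p) = Im (y * cis p) \<Longrightarrow> x = y"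
  by (metis complex_eqI cis_neq_zero mult_right_cancel)

text \<open>When all chords meet in c, the derivative condition excludes the other points of each
  chord, since the normal turns with positive speed.\<close>

lemma poncelet_curve_point:
  assumes j: "0 < j" "j < N" and c: "\<And>t. Re (c * cis (- mid j t)) = cos (half j t)"
  shows "poncelet_curve F j = {c}"
proof -
  have z: "(\<lambda>s. Re (c * cis (- mid j s)) - cos (half j s)) = (\<lambda>s. 0)" using c by simp
  have "x = c" if "x \<in> poncelet_curve F j" for x
  proof -
    from that obtain t where t: "Re (x * cis (- mid j t)) = cos (half j t)"
      "((\<lambda>s. Re (x * cis (- mid j s)) - cos (half j s)) has_real_derivative 0) (at t)"
      unfolding poncelet_curve_iff[OF j] by blast
    obtain P where P: "P > 0" "(mid j has_real_derivative P) (at t)" using mid_deriv by blast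
    obtain H where H: "(half j has_real_derivative H) (at t)" using half_deriv by blast
    have "P * Im (x * cis (- mid j t)) + H * sin (half j t) = 0"
      using DERIV_unique[OF Re_chord_deriv[OF P(2) H] t(2)] .
    moreover have "P * Im (c * cis (- mid j t)) + H * sin (half j t) = 0"
      using DERIV_unique[OF Re_chord_deriv[OF P(2) H, of c]] z by simp
    ultimately have "P * Im (x * cis (- mid j t)) = P * Im (c * cis (- mid j t))" by linarith
    then have "Im (x * cis (- mid j t)) = Im (c * cis (- mid j t))" using P(1) by simp
    then show ?thesis using t(1) c[of t] complex_rotated_eqI by metis
  qed
  moreover have "c \<in> poncelet_curve F j" unfolding poncelet_curve_iff[OF j] z using c by auto
  ultimately show ?thesis by blast
qed

text \<open>At each t the line fixes the coordinate of x along the normal, and the derivative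
  condition the one across it. Differentiating \<open>supp\<close> identifies the result as the
  ellipse point with that normal.\<close>

lemma poncelet_curve_ellipse:
  assumes j: "0 < j" "2 * j < N" and b: "b > 0"
    and supp: "\<And>t. (cos (half j t) - Re (c * cis (- mid j t)))\<^sup>2 = b\<^sup>2 + (Re (d * cis (- mid j t)))\<^sup>2"
  shows "poncelet_curve F j = {z. cmod (z - (c + d)) + cmod (z - (c - d)) = 2 * sqrt (b\<^sup>2 + (cmod d)\<^sup>2)}"
proof -
  have jN: "j < N" using j by simp
  define k where "k t = cos (half j t) - Re (c * cis (- mid j t))" for t
  have k2: "(k t)\<^sup>2 = b\<^sup>2 + (Re (d * cis (- mid j t)))\<^sup>2" for t using supp by (simp add: k_def)
  have k0: "k t \<noteq> 0" for t using k2[of t] b by (metis add_pos_nonneg less_irrefl power_zero_numeral zero_le_power2 zero_less_power)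
  \<comment> \<open>\<open>supp\<close> gives only the square of the distance from the centre, so
    \<open>cis (mid j t)\<close> may be the inner normal; the sign corrects this.\<close>
  define \<epsilon> where "\<epsilon> t = sgn (k t)" for t
  have \<epsilon>: "\<epsilon> t = 1 \<or> \<epsilon> t = -1" for t using k0[of t] by (simp add: \<epsilon>_def sgn_if)
  have sq: "sqrt (b\<^sup>2 + (Re (d * cis (- mid j t)))\<^sup>2) = \<epsilon> t * k t" for t
    unfolding k2[symmetric] by (simp add: \<epsilon>_def sgn_if)
  have pt: "ellipse_point b d (of_real (\<epsilon> t) * cis (mid j t)) * cis (- mid j t)
     = Complex (k t) (Re (d * cis (- mid j t)) * Im (d * cis (- mid j t)) / k t)" for t
  proof -
    have s: "d * cnj (of_real (\<epsilon> t) * cis (mid j t)) = of_real (\<epsilon> t) * (d * cis (- mid j t))" by (simp add: cis_cnj mult_ac)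
    have e2: "\<epsilon> t * \<epsilon> t = 1" using \<epsilon>[of t] by auto
    have sqe: "sqrt (b\<^sup>2 + (Re (d * cnj (of_real (\<epsilon> t) * cis (mid j t))))\<^sup>2) = \<epsilon> t * k t"
    proof -
      have e2: "(Re (of_real (\<epsilon> t) * w))\<^sup>2 = (Re w)\<^sup>2" for w using \<epsilon>[of t] by auto
      show ?thesis unfolding s e2 by (rule sq)
    qed
    have prod: "Re (of_real (\<epsilon> t) * w) * Im (of_real (\<epsilon> t) * w) = Re w * Im w" for w using \<epsilon>[of t] by auto
    have "ellipse_point b d (of_real (\<epsilon> t) * cis (mid j t)) = of_real (\<epsilon> t) * cis (mid j t) *
       Complex (\<epsilon> t * k t) (Re (d * cis (- mid j t)) * Im (d * cis (- mid j t)) / (\<epsilon> t * k t))"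
      unfolding ellipse_point_def sqe unfolding s prod ..
    also have "\<dots> = cis (mid j t) * Complex (k t) (Re (d * cis (- mid j t)) * Im (d * cis (- mid j t)) / k t)"
      using \<epsilon>[of t] by (auto simp: complex_eq_iff)
    finally have "ellipse_point b d (of_real (\<epsilon> t) * cis (mid j t)) =
       cis (mid j t) * Complex (k t) (Re (d * cis (- mid j t)) * Im (d * cis (- mid j t)) / k t)" .
    moreover have "cis (mid j t) * z * cis (- mid j t) = z" for z
      using cis_mult[of "mid j t" "- mid j t"] by (simp add: mult.commute mult.left_commute)
    ultimately show ?thesis by simp
  qed
  have iff: "x \<in> poncelet_curve F j \<longleftrightarrow> (\<exists>t. x = c + ellipse_point b d (of_real (\<epsilon> t) * cis (mid j t)))" for x
  proof -
    have "Re (x * cis (- mid j t)) = cos (half j t) \<and>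
     ((\<lambda>s. Re (x * cis (- mid j s)) - cos (half j s)) has_real_derivative 0) (at t)
     \<longleftrightarrow> x = c + ellipse_point b d (of_real (\<epsilon> t) * cis (mid j t))" for t
    proof -
      obtain P where P: "P > 0" "(mid j has_real_derivative P) (at t)" using mid_deriv by blast
      obtain H where H: "(half j has_real_derivative H) (at t)" using half_deriv by blast
      define r s where "r = Re (d * cis (- mid j t))" "s = Im (d * cis (- mid j t))"
      have dk: "(k has_real_derivative - (P * Im (c * cis (- mid j t)) + H * sin (half j t))) (at t)"
      proof -
        have "k = (\<lambda>s. - (Re (c * cis (- mid j s)) - cos (half j s)))" by (auto simp: k_def)
        then show ?thesis using DERIV_minus[OF Re_chord_deriv[OF P(2) H, of c]] by simp
      qed
      have "((\<lambda>s. (k s)\<^sup>2) has_real_derivative 2 * k t * - (P * Im (c * cis (- mid j t)) + H * sin (half j t))) (at t)"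
        by (auto intro!: derivative_eq_intros dk)
      moreover have "((\<lambda>s. b\<^sup>2 + (Re (d * cis (- mid j s)))\<^sup>2) has_real_derivative 2 * r * (P * s)) (at t)"
        by (rule derivative_eq_intros Re_rotated_deriv[OF P(2)] refl)+ (simp add: r_s_def)
      ultimately have "k t * - (P * Im (c * cis (- mid j t)) + H * sin (half j t)) = r * (P * s)"
        unfolding k2 using DERIV_unique by fastforce
      then have kk: "P * Im (c * cis (- mid j t)) + H * sin (half j t) = - P * (r * s / k t)" using k0[of t]
        by (simp add: field_simps)
      have "((\<lambda>s. Re (x * cis (- mid j s)) - cos (half j s)) has_real_derivative 0) (at t) \<longleftrightarrow>
         P * Im (x * cis (- mid j t)) + H * sin (half j t) = 0"
        using Re_chord_deriv[OF P(2) H, of x] DERIV_unique by metis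
      also have "\<dots> \<longleftrightarrow> P * Im ((x - c) * cis (- mid j t)) = P * (r * s / k t)"
        using kk by (simp add: left_diff_distrib right_diff_distrib) linarith
      also have "\<dots> \<longleftrightarrow> Im ((x - c) * cis (- mid j t)) = r * s / k t" using P(1) by (subst mult_left_cancel) auto
      finally have 1: "((\<lambda>s. Re (x * cis (- mid j s)) - cos (half j s)) has_real_derivative 0) (at t) \<longleftrightarrow>
         Im ((x - c) * cis (- mid j t)) = r * s / k t" .
      have 2: "Re (x * cis (- mid j t)) = cos (half j t) \<longleftrightarrow> Re ((x - c) * cis (- mid j t)) = k t"
        by (simp add: k_def left_diff_distrib)
      have "Re ((x - c) * cis (- mid j t)) = k t \<and> Im ((x - c) * cis (- mid j t)) = r * s / k t
         \<longleftrightarrow> (x - c) * cis (- mid j t) = ellipse_point b d (of_real (\<epsilon> t) * cis (mid j t)) * cis (- mid j t)"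
        unfolding pt r_s_def by (simp only: complex_eq_iff complex.sel)
      also have "\<dots> \<longleftrightarrow> x = c + ellipse_point b d (of_real (\<epsilon> t) * cis (mid j t))"
        by (subst mult_right_cancel) (auto simp: diff_eq_eq add.commute)
      finally show ?thesis unfolding 1 2 .
    qed
    then show ?thesis unfolding poncelet_curve_iff[OF j(1) jN] by blast
  qed
  \<comment> \<open>Of the chords with normals u and - u one has the right sign; otherwise they are
    the same line, against \<open>opposite_chord_distinct\<close>.\<close>
  have normals: "\<exists>t. of_real (\<epsilon> t) * cis (mid j t) = u" if u: "cmod u = 1" for u
  proof -
    obtain t1 where t1: "mid j t1 = Arg u" using mid_surj[OF jN] by blast
    obtain t2 where t2: "mid j t2 = Arg u + pi" using mid_surj[OF jN] by blast
    have c1: "cis (mid j t1) = u" and c2: "cis (mid j t2) = - u"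
      unfolding t1 t2 using cis_Arg_unit[OF u] by (simp_all flip: cis_mult)
    have "\<epsilon> t1 = 1 \<or> \<epsilon> t2 = -1"
    proof (rule ccontr)
      assume "\<not> ?thesis"
      then have e: "\<epsilon> t1 = -1" "\<epsilon> t2 = 1" using \<epsilon> by auto
      have m: "cis (- mid j t2) = - cis (- mid j t1)" unfolding t1 t2 by (simp add: complex_eq_iff)
      have "\<epsilon> t2 * k t2 = \<epsilon> t1 * k t1" unfolding sq[symmetric] m mult_minus_right uminus_complex.sel power2_minus ..
      then have "k t2 = - k t1" using e by simp
      then have "cos (half j t2) = - cos (half j t1)" unfolding k_def m by simp
      then show False using opposite_chord_distinct[OF j, of t2 t1] t1 t2 by simp
    qed
    then show ?thesis using c1 c2 by (metis minus_minus mult_1 mult_minus1 of_real_1 of_real_minus)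
  qed
  have "c + ellipse_point b d u \<in> {z. cmod (z - (c + d)) + cmod (z - (c - d)) = 2 * sqrt (b\<^sup>2 + (cmod d)\<^sup>2)}" if "cmod u = 1" for u
    using ellipse_point_focal[OF that b, of d] by (simp add: algebra_simps)
  moreover have "cmod (of_real (\<epsilon> t) * cis (mid j t)) = 1" for t using \<epsilon>[of t] by (auto simp: norm_mult)
  moreover have "\<exists>t. z = c + ellipse_point b d (of_real (\<epsilon> t) * cis (mid j t))"
    if "cmod (z - (c + d)) + cmod (z - (c - d)) = 2 * sqrt (b\<^sup>2 + (cmod d)\<^sup>2)" for z
  proof -
    have "cmod ((z - c) - d) + cmod ((z - c) + d) = 2 * sqrt (b\<^sup>2 + (cmod d)\<^sup>2)" using that by (simp add: algebra_simps)
    then obtain u where "cmod u = 1" "z - c = ellipse_point b d u" by (rule focal_imp_ellipse_point[OF b])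
    then show ?thesis using normals[of u] by (metis add.commute diff_add_cancel)
  qed
  ultimately show ?thesis unfolding set_eq_iff iff by blast
qed

end

section \<open>Recovering an ellipse from its tangents\<close>

lemma Re_power2_half: "(Re w)\<^sup>2 = ((cmod w)\<^sup>2 + Re (w\<^sup>2)) / 2"
  by (simp add: cmod_power2 Re_power2)

lemma cis_add_chord: "cis (\<phi> - \<delta>) + cis (\<phi> + \<delta>) = 2 * of_real (cos \<delta>) * cis \<phi>"
  and cis_mult_chord: "cis (\<phi> - \<delta>) * cis (\<phi> + \<delta>) = (cis \<phi>)\<^sup>2"
  by (simp_all add: complex_eq_iff cos_add cos_diff sin_add sin_diff cis_mult power2_eq_square)

text \<open>\<open>Q \<theta> h = 0\<close> says that the line with normal \<open>cis \<theta>\<close> at signed distance \<open>h\<close> from the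
  origin touches the conic; two parallel tangents in every direction make the conic an ellipse.\<close>
lemma parallel_tangents_imp_ellipse:
  fixes A B :: complex and C D :: real
  defines "Q \<equiv> \<lambda>\<theta> h. 4 * C * h\<^sup>2 + 4 * h * Re (B * cis \<theta>) + D - 2 * C + 2 * Re (A * (cis \<theta>)\<^sup>2)"
  assumes nz: "A \<noteq> 0 \<or> B \<noteq> 0 \<or> C \<noteq> 0 \<or> D \<noteq> 0"
    and roots: "\<And>\<theta>. \<exists>h g. h \<noteq> g \<and> Q \<theta> h = 0 \<and> Q \<theta> g = 0"
  obtains b c d where "b > 0"
    "\<And>\<theta> h. Q \<theta> h = 0 \<Longrightarrow> (h - Re (c * cis (- \<theta>)))\<^sup>2 = b\<^sup>2 + (Re (d * cis (- \<theta>)))\<^sup>2"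
proof -
  \<comment> \<open>With C = 0 the form is affine in h, so two roots make its coefficients vanish at
    every angle, and then all of A, B and D vanish.\<close>
  have "C \<noteq> 0"
  proof
    assume C: "C = 0"
    have B: "Re (B * cis \<theta>) = 0" for \<theta>
    proof -
      obtain h g where hg: "h \<noteq> g" "Q \<theta> h = 0" "Q \<theta> g = 0" using roots by blast
      define X K where "X = Re (B * cis \<theta>)" "K = Re (A * (cis \<theta>)\<^sup>2)"
      have "4 * h * X + D + 2 * K = 0" "4 * g * X + D + 2 * K = 0" using hg(2,3) unfolding Q_def C X_K_def[symmetric] by simp_all
      then have "(h - g) * X = 0" by algebra
      then have "(h - g) * Re (B * cis \<theta>) = 0" unfolding X_K_def .
      then show ?thesis using hg(1) by simp
    qed
    have A: "D + 2 * Re (A * (cis \<theta>)\<^sup>2) = 0" for \<theta>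
      using roots[of \<theta>] B[of \<theta>] unfolding Q_def C by auto
    have "B = 0" using B[of 0] B[of "pi / 2"] by (simp add: complex_eq_iff)
    moreover have "(cis (pi / 2))\<^sup>2 = -1" by (simp add: complex_eq_iff power2_eq_square)
    moreover have "(cis (pi / 4))\<^sup>2 = \<i>" by (simp add: power2_eq_square cis_mult complex_eq_iff)
    ultimately show False using A[of 0] A[of "pi / 2"] A[of "pi / 4"] C nz by (simp add: complex_eq_iff)
  qed
  \<comment> \<open>Completing the square in h turns the condition into (h + Re (p cis \<theta>))^2
    = m + Re (\<nu> cis (2 \<theta>)), so the centre is - cnj p.\<close>
  define p m \<nu> where "p = B / of_real (2 * C)" "m = (cmod (B / of_real (2 * C)))\<^sup>2 / 2 - (D - 2 * C) / (4 * C)"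
    "\<nu> = (B / of_real (2 * C))\<^sup>2 / 2 - A / of_real (2 * C)"
  note pm = this
  have sq: "(h + Re (p * cis \<theta>))\<^sup>2 = m + Re (\<nu> * (cis \<theta>)\<^sup>2)" if "Q \<theta> h = 0" for \<theta> h
  proof -
    have "(Re (p * cis \<theta>))\<^sup>2 = (cmod p)\<^sup>2 / 2 + Re (p\<^sup>2 * (cis \<theta>)\<^sup>2) / 2"
      unfolding Re_power2_half[of "p * cis \<theta>"] by (simp add: norm_mult power_mult_distrib add_divide_distrib)
    moreover have "Re (\<nu> * (cis \<theta>)\<^sup>2) = Re (p\<^sup>2 * (cis \<theta>)\<^sup>2) / 2 - Re (A * (cis \<theta>)\<^sup>2) / (2 * C)"
    proof -
      have "\<nu> * (cis \<theta>)\<^sup>2 = (p\<^sup>2 * (cis \<theta>)\<^sup>2) / of_real 2 - (A * (cis \<theta>)\<^sup>2) / of_real (2 * C)"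
        unfolding pm by (simp add: algebra_simps)
      then show ?thesis by (simp only: minus_complex.sel Re_divide_of_real)
    qed
    moreover have "Re (B * cis \<theta>) = 2 * C * Re (p * cis \<theta>)"
    proof -
      have "B * cis \<theta> = of_real (2 * C) * (p * cis \<theta>)" using \<open>C \<noteq> 0\<close> by (simp add: pm)
      then show ?thesis by (simp only: times_complex.sel Re_complex_of_real Im_complex_of_real)
    qed
    moreover have "m = (cmod p)\<^sup>2 / 2 - (D - 2 * C) / (4 * C)" by (simp add: pm)
    ultimately have "4 * C * ((h + Re (p * cis \<theta>))\<^sup>2 - (m + Re (\<nu> * (cis \<theta>)\<^sup>2))) = Q \<theta> h"
      unfolding Q_def using \<open>C \<noteq> 0\<close> by (simp add: power2_sum) (simp add: field_simps power2_eq_square)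
    then show ?thesis using that \<open>C \<noteq> 0\<close> by simp
  qed
  have pos: "m + Re (\<nu> * (cis \<theta>)\<^sup>2) > 0" for \<theta>
  proof -
    obtain h g where hg: "h \<noteq> g" "Q \<theta> h = 0" "Q \<theta> g = 0" using roots by blast
    have "m + Re (\<nu> * (cis \<theta>)\<^sup>2) \<noteq> 0" using sq[OF hg(2)] sq[OF hg(3)] hg(1) by auto
    moreover have "m + Re (\<nu> * (cis \<theta>)\<^sup>2) \<ge> 0" using sq[OF hg(2)] zero_le_power2 by metis
    ultimately show ?thesis by linarith
  qed
  \<comment> \<open>Evaluated where Re (\<nu> cis (2 \<theta>)) has its minimum - |\<nu>|.\<close>
  have m: "m > cmod \<nu>"
  proof -
    obtain e where e: "cmod e = 1" "- \<nu> * e\<^sup>2 = complex_of_real (cmod (- \<nu>))" by (rule ex_unit_square_rotation)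
    have "Re (\<nu> * e\<^sup>2) = - cmod \<nu>" using arg_cong[OF e(2), of Re] by simp
    then show ?thesis using pos[of "Arg e"] cis_Arg_unit[OF e(1)] by simp
  qed
  \<comment> \<open>The choice d^2 = 2 cnj \<nu> makes (Re (d cis (- \<theta>)))^2 equal to |\<nu>|
    + Re (\<nu> cis (2 \<theta>)), which leaves b^2 = m - |\<nu>|.\<close>
  show ?thesis
  proof (rule that[of "sqrt (m - cmod \<nu>)" "- cnj p" "csqrt (2 * cnj \<nu>)"])
    show "sqrt (m - cmod \<nu>) > 0" using m by simp
    fix \<theta> h assume "Q \<theta> h = 0"
    define d where "d = csqrt (2 * cnj \<nu>)"
    have d2: "d\<^sup>2 = 2 * cnj \<nu>" by (simp add: d_def)
    have "(cmod d)\<^sup>2 = 2 * cmod \<nu>" unfolding norm_power[symmetric] d2 by (simp add: norm_mult)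
    moreover define X where "X = \<nu> * (cis \<theta>)\<^sup>2"
    moreover have "(d * cis (- \<theta>))\<^sup>2 = cnj (2 * X)" unfolding power_mult_distrib d2 X_def by (simp add: cis_cnj)
    then have "Re ((d * cis (- \<theta>))\<^sup>2) = 2 * Re X" by simp
    ultimately have 1: "(Re (d * cis (- \<theta>)))\<^sup>2 = cmod \<nu> + Re (\<nu> * (cis \<theta>)\<^sup>2)"
      unfolding Re_power2_half[of "d * cis (- \<theta>)"] by (simp only: norm_mult norm_cis mult_1_right) simp
    have 2: "Re (- cnj p * cis (- \<theta>)) = - Re (p * cis \<theta>)" by simp
    have 3: "(sqrt (m - cmod \<nu>))\<^sup>2 = m - cmod \<nu>" using m by simp
    show "(h - Re (- cnj p * cis (- \<theta>)))\<^sup>2 = (sqrt (m - cmod \<nu>))\<^sup>2 + (Re (csqrt (2 * cnj \<nu>) * cis (- \<theta>)))\<^sup>2"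
      unfolding d_def[symmetric] 1 2 3 diff_minus_eq_add sq[OF \<open>Q \<theta> h = 0\<close>] by simp
  qed
qed

context circle_cover
begin

text \<open>The chords with normal angles \<theta> and \<theta> + pi are parallel tangents, distinct
  by \<open>opposite_chord_distinct\<close>.\<close>

lemma conic_imp_ellipse:
  assumes j: "0 < j" "2 * j < N" and nz: "A \<noteq> 0 \<or> B \<noteq> 0 \<or> C \<noteq> 0 \<or> D \<noteq> 0"
    and conic: "\<And>t. chord_form A B C D (cis t) (cis (step j t)) = 0"
  shows "is_ellipse (poncelet_curve F j)"
proof -
  define Q where "Q = (\<lambda>\<theta> h. 4 * C * h\<^sup>2 + 4 * h * Re (B * cis \<theta>) + D - 2 * C + 2 * Re (A * (cis \<theta>)\<^sup>2))"
  have Q: "Q (mid j t) (cos (half j t)) = 0" for t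
  proof -
    have "(cis (mid j t))\<^sup>2 * of_real (Q (mid j t) (cos (half j t))) = 0"
      unfolding Q_def chord_form_support[symmetric] mid_half by (rule conic)
    then show ?thesis unfolding mult_eq_0_iff of_real_eq_0_iff by simp
  qed
  have roots: "\<exists>h g. h \<noteq> g \<and> Q \<theta> h = 0 \<and> Q \<theta> g = 0" for \<theta>
  proof -
    have jN: "j < N" using j by simp
    obtain t t' where t: "mid j t = \<theta>" "mid j t' = \<theta> + pi" using mid_surj[OF jN] by metis
    have m: "cis (\<theta> + pi) = - cis \<theta>" by (simp add: complex_eq_iff)
    have "Q \<theta> (- cos (half j t')) = Q (\<theta> + pi) (cos (half j t'))"
      unfolding Q_def m by (simp only: mult_minus_right mult_minus_left power2_minus uminus_complex.sel minus_minus)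
    then have "Q \<theta> (- cos (half j t')) = 0" using Q[of t'] t by simp
    moreover have "Q \<theta> (cos (half j t)) = 0" using Q[of t] t by simp
    moreover have "- cos (half j t') \<noteq> cos (half j t)" using opposite_chord_distinct[OF j, of t' t] t by auto
    ultimately show ?thesis by blast
  qed
  obtain b c d where b: "b > 0" and
    supp: "\<And>\<theta> h. Q \<theta> h = 0 \<Longrightarrow> (h - Re (c * cis (- \<theta>)))\<^sup>2 = b\<^sup>2 + (Re (d * cis (- \<theta>)))\<^sup>2"
    using parallel_tangents_imp_ellipse[OF nz roots[unfolded Q_def]] unfolding Q_def by blast
  have eq: "poncelet_curve F j = {z. cmod (z - (c + d)) + cmod (z - (c - d)) = 2 * sqrt (b\<^sup>2 + (cmod d)\<^sup>2)}"
    using poncelet_curve_ellipse[OF j b] supp[OF Q] by blast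
  have "cmod d < sqrt (b\<^sup>2 + (cmod d)\<^sup>2)" using b by (intro real_less_rsqrt) simp
  then have "cmod ((c + d) - (c - d)) < 2 * sqrt (b\<^sup>2 + (cmod d)\<^sup>2)" by (simp add: norm_mult flip: mult_2)
  then show ?thesis unfolding is_ellipse_def eq by blast
qed

text \<open>In the coordinate \<open>moeb (- x)\<close> the chords are diameters. The corresponding
  hyperbolic geodesics all pass through x, so their straight counterparts are concurrent
  too.\<close>

lemma involution_imp_point:
  assumes j: "0 < j" "j < N" and x: "cmod x < 1"
    and inv: "\<And>t. moeb (- x) (cis (step j t)) = - moeb (- x) (cis t)"
  shows "\<exists>c. poncelet_curve F j = {c}"
proof -
  define q where "q = 1 + x * cnj x"
  have q: "q = of_real (1 + (cmod x)\<^sup>2)" by (simp add: q_def complex_norm_square[symmetric] del: of_real_power)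
  have q0: "q \<noteq> 0" unfolding q of_real_eq_0_iff using zero_le_power2[of "cmod x"] by linarith
  have cq: "cnj q = q" by (simp add: q)
  \<comment> \<open>The point of the Klein model that corresponds to x in the Poincare
    model.\<close>
  define c where "c = 2 * x / q"
  have "Re (c * cis (- mid j t)) = cos (half j t)" for t
  proof -
    define \<zeta> where "\<zeta> = moeb (- x) (cis t)"
    have z: "cis t = moeb x \<zeta>" and w: "cis (step j t) = moeb x (- \<zeta>)"
      using moeb_inverse'[OF x, of "cis t"] moeb_inverse'[OF x, of "cis (step j t)"] unfolding inv \<zeta>_def by simp_all
    have "cmod \<zeta> = 1" unfolding \<zeta>_def by (rule moeb_circle) (use x in auto)
    then have n: "1 + cnj x * \<zeta> \<noteq> 0" "1 + cnj x * (- \<zeta>) \<noteq> 0" using one_plus_cnj_mult_nonzero[OF x] by (metis norm_minus_cancel order_refl)+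
    define z w where "z = cis t" "w = cis (step j t)"
    have zn: "z * (1 + cnj x * \<zeta>) = \<zeta> + x" and wn: "w * (1 + cnj x * (- \<zeta>)) = - \<zeta> + x"
      unfolding z_w_def z w using n by (simp_all add: moeb_def)
    have "q * c = 2 * x" using q0 by (simp add: c_def)
    moreover have "q * cnj c = 2 * cnj x" using arg_cong[OF \<open>q * c = 2 * x\<close>, of cnj] cq by simp
    ultimately have "q * (c + z * w * cnj c) * ((1 + cnj x * \<zeta>) * (1 + cnj x * (- \<zeta>))) = q * (z + w) * ((1 + cnj x * \<zeta>) * (1 + cnj x * (- \<zeta>)))"
      using zn wn unfolding q_def by algebra
    then have line: "c + z * w * cnj c = z + w" using q0 n by simp
    have "z * w = (cis (mid j t))\<^sup>2" "z + w = 2 * of_real (cos (half j t)) * cis (mid j t)"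
      using cis_mult_chord[of "mid j t" "half j t"] cis_add_chord[of "mid j t" "half j t"] by (simp_all add: mid_half z_w_def)
    then have "c + (cis (mid j t))\<^sup>2 * cnj c = 2 * of_real (cos (half j t)) * cis (mid j t)" using line by simp
    moreover have "cis (mid j t) * cis (- mid j t) = 1" by (simp add: cis_mult)
    ultimately have "c * cis (- mid j t) + cis (mid j t) * cnj c = of_real (2 * cos (half j t))"
      unfolding of_real_mult of_real_numeral by algebra
    moreover have "cis (mid j t) * cnj c = cnj (c * cis (- mid j t))" by (simp add: cis_cnj)
    ultimately have "c * cis (- mid j t) + cnj (c * cis (- mid j t)) = of_real (2 * cos (half j t))" by simp
    then show ?thesis unfolding complex_add_cnj of_real_eq_iff by simp
  qed
  then show ?thesis using poncelet_curve_point[OF j] by blast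
qed

end

section \<open>The Hardy space as a space of power series\<close>

unbundle fps_syntax

text \<open>On power series the Cauchy product \<open>mult_seq\<close> becomes ring multiplication,
  which makes the inverse of \<open>pole_fps\<close> available.\<close>

definition l2 :: "complex fps \<Rightarrow> bool" where "l2 f \<longleftrightarrow> fps_nth f \<in> H2"
definition ip :: "complex fps \<Rightarrow> complex fps \<Rightarrow> complex" where "ip f g = h2_inner (fps_nth f) (fps_nth g)"

lemma l2_iff: "l2 f \<longleftrightarrow> summable (\<lambda>k. (cmod (f $ k))\<^sup>2)"
  by (simp add: l2_def H2_def)

lemma summable_ip: assumes "l2 f" "l2 g" shows "summable (\<lambda>k. f $ k * cnj (g $ k))"
proof (rule summable_comparison_test')
  show "summable (\<lambda>k. (cmod (f $ k))\<^sup>2 + (cmod (g $ k))\<^sup>2)"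
    using assms by (intro summable_add) (auto simp: l2_iff)
  fix k
  have "2 * (cmod (f $ k) * cmod (g $ k)) \<le> (cmod (f $ k))\<^sup>2 + (cmod (g $ k))\<^sup>2"
    using sum_squares_bound[of "cmod (f $ k)" "cmod (g $ k)"] by (simp add: mult.assoc)
  moreover have "0 \<le> cmod (f $ k) * cmod (g $ k)" by simp
  ultimately show "norm (f $ k * cnj (g $ k)) \<le> (cmod (f $ k))\<^sup>2 + (cmod (g $ k))\<^sup>2"
    unfolding norm_mult complex_mod_cnj by linarith
qed

lemma l2_add: assumes "l2 f" "l2 g" shows "l2 (f + g)"
  unfolding l2_iff
proof (rule summable_comparison_test')
  show "summable (\<lambda>k. 2 * (cmod (f $ k))\<^sup>2 + 2 * (cmod (g $ k))\<^sup>2)"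
    using assms by (intro summable_add summable_mult) (auto simp: l2_iff)
  fix k
  have "(cmod (f $ k + g $ k))\<^sup>2 \<le> (cmod (f $ k) + cmod (g $ k))\<^sup>2"
    by (intro power_mono norm_triangle_ineq) simp
  also have "\<dots> \<le> 2 * (cmod (f $ k))\<^sup>2 + 2 * (cmod (g $ k))\<^sup>2"
    using sum_squares_bound[of "cmod (f $ k)" "cmod (g $ k)"] by (simp add: power2_sum)
  finally show "norm ((cmod ((f + g) $ k))\<^sup>2) \<le> 2 * (cmod (f $ k))\<^sup>2 + 2 * (cmod (g $ k))\<^sup>2" by simp
qed

lemma l2_cmult: "l2 f \<Longrightarrow> l2 (fps_const c * f)"
  unfolding l2_iff by (simp add: norm_mult power_mult_distrib summable_mult)

lemma l2_diff: "l2 f \<Longrightarrow> l2 g \<Longrightarrow> l2 (f - g)"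
  using l2_add[of f "fps_const (-1) * g"] l2_cmult[of g "-1"] by (simp flip: fps_const_neg)

lemma l2_0: "l2 0" by (simp add: l2_iff)

lemma l2_const: "l2 (fps_const c)"
  unfolding l2_iff by (rule summable_finite[of "{0}"]) auto

lemma l2_1: "l2 1" using l2_const[of 1] by simp

lemma l2_sum: "finite A \<Longrightarrow> (\<And>i. i \<in> A \<Longrightarrow> l2 (f i)) \<Longrightarrow> l2 (\<Sum>i\<in>A. f i)"
  by (induction A rule: finite_induct) (auto simp: l2_0 l2_add)

lemma l2_X: "l2 f \<Longrightarrow> l2 (fps_X * f)"
  unfolding l2_iff by (subst summable_Suc_iff[symmetric]) simp

lemma l2_shift: "l2 f \<Longrightarrow> l2 (fps_shift n f)"
  using summable_ignore_initial_segment[of "\<lambda>k. (cmod (f $ k))\<^sup>2" n] by (simp add: l2_iff)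

lemma ip_add_left: "l2 f \<Longrightarrow> l2 g \<Longrightarrow> l2 h \<Longrightarrow> ip (f + g) h = ip f h + ip g h"
  unfolding ip_def h2_inner_def by (simp add: suminf_add summable_ip algebra_simps)

lemma ip_cmult_left: "l2 f \<Longrightarrow> l2 h \<Longrightarrow> ip (fps_const c * f) h = c * ip f h"
  unfolding ip_def h2_inner_def by (simp add: suminf_mult summable_ip mult.assoc)

lemma ip_cnj: "l2 f \<Longrightarrow> l2 g \<Longrightarrow> ip g f = cnj (ip f g)"
  unfolding ip_def h2_inner_def by (subst bounded_linear.suminf[OF bounded_linear_cnj summable_ip]) (auto simp: mult.commute)

lemma ip_diff_left: "l2 f \<Longrightarrow> l2 g \<Longrightarrow> l2 h \<Longrightarrow> ip (f - g) h = ip f h - ip g h"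
  unfolding ip_def h2_inner_def by (simp add: suminf_diff summable_ip algebra_simps)

lemma ip_add_right: "l2 f \<Longrightarrow> l2 g \<Longrightarrow> l2 h \<Longrightarrow> ip h (f + g) = ip h f + ip h g"
  by (simp add: ip_cnj[of _ h] ip_add_left l2_add)

lemma ip_diff_right: "l2 f \<Longrightarrow> l2 g \<Longrightarrow> l2 h \<Longrightarrow> ip h (f - g) = ip h f - ip h g"
  by (simp add: ip_cnj[of _ h] ip_diff_left l2_diff)

lemma ip_cmult_right: "l2 f \<Longrightarrow> l2 h \<Longrightarrow> ip h (fps_const c * f) = cnj c * ip h f"
  by (simp add: ip_cnj[of _ h] ip_cmult_left l2_cmult)

lemma ip_0_left: "ip 0 h = 0" by (simp add: ip_def h2_inner_def)

lemma ip_sum_left: "finite A \<Longrightarrow> (\<And>i. i \<in> A \<Longrightarrow> l2 (f i)) \<Longrightarrow> l2 h \<Longrightarrow> ip (\<Sum>i\<in>A. f i) h = (\<Sum>i\<in>A. ip (f i) h)"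
  by (induction A rule: finite_induct) (auto simp: ip_0_left ip_add_left l2_sum)

lemma ip_sum_right: "finite A \<Longrightarrow> (\<And>i. i \<in> A \<Longrightarrow> l2 (f i)) \<Longrightarrow> l2 h \<Longrightarrow> ip h (\<Sum>i\<in>A. f i) = (\<Sum>i\<in>A. ip h (f i))"
  by (simp add: ip_cnj[of _ h] ip_sum_left l2_sum)

lemma ip_self: assumes "l2 f" shows "ip f f = of_real (\<Sum>k. (cmod (f $ k))\<^sup>2)"
  unfolding ip_def h2_inner_def using assms
  by (simp add: suminf_of_real l2_iff complex_norm_square flip: of_real_power)

lemma ip_self_eq_0: assumes "l2 f" "ip f f = 0" shows "f = 0"
proof (rule fps_ext)
  fix n
  have "(\<Sum>k. (cmod (f $ k))\<^sup>2) = 0" using ip_self[OF assms(1)] unfolding assms(2) by (metis of_real_eq_0_iff)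
  then have "\<forall>k. (cmod (f $ k))\<^sup>2 = 0"
    using suminf_eq_zero_iff[OF assms(1)[unfolded l2_iff]] by simp
  then show "f $ n = 0 $ n" by simp
qed

lemma ip_self_nonneg: "l2 f \<Longrightarrow> Re (ip f f) \<ge> 0" and ip_self_real: "l2 f \<Longrightarrow> ip f f = of_real (Re (ip f f))"
  by (simp_all add: ip_self suminf_nonneg l2_iff)

lemma ip_one: "ip f 1 = f $ 0"
proof -
  have "(\<Sum>k. f $ k * cnj (1 $ k)) = (\<Sum>k\<in>{0}. f $ k * cnj (1 $ k))"
    by (rule suminf_finite) auto
  then show ?thesis by (simp add: ip_def h2_inner_def)
qed

lemma ip_X_X: assumes "l2 f" "l2 g" shows "ip (fps_X * f) (fps_X * g) = ip f g"
proof -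
  have "summable (\<lambda>k. (fps_X * f) $ k * cnj ((fps_X * g) $ k))" using assms by (intro summable_ip l2_X)
  from suminf_split_head[OF this] show ?thesis by (simp add: ip_def h2_inner_def)
qed

lemma ip_X_right: assumes "l2 f" "l2 g" shows "ip f (fps_X * g) = ip (fps_shift 1 f) g"
proof -
  have "summable (\<lambda>k. f $ k * cnj ((fps_X * g) $ k))" using assms by (intro summable_ip l2_X)
  from suminf_split_head[OF this] show ?thesis by (simp add: ip_def h2_inner_def)
qed

section \<open>Blaschke factors acting on square-summable series\<close>

abbreviation pole_factor :: "complex \<Rightarrow> complex fps" where "pole_factor a \<equiv> 1 - fps_const (cnj a) * fps_X"
abbreviation zero_factor :: "complex \<Rightarrow> complex fps" where "zero_factor a \<equiv> fps_X - fps_const a"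

lemma l2_pole_factor: "l2 f \<Longrightarrow> l2 (pole_factor a * f)"
  unfolding left_diff_distrib mult.assoc by (auto intro: l2_diff l2_cmult l2_X)

lemma l2_zero_factor: "l2 f \<Longrightarrow> l2 (zero_factor a * f)"
  unfolding left_diff_distrib mult.assoc by (auto intro: l2_diff l2_cmult l2_X)

text \<open>The quotient y solves y = f + cnj a X y, so its truncated norms satisfy S \<le> T + |a|
  S, a bound uniform in the truncation.\<close>

lemma l2_inverse_pole_factor: assumes "cmod a < 1" "l2 f" shows "l2 (inverse (pole_factor a) * f)"
proof -
  define y where "y = inverse (pole_factor a) * f"
  have "pole_factor a $ 0 \<noteq> 0" by simp
  then have "pole_factor a * y = f" by (simp add: y_def mult.assoc[symmetric] inverse_mult_eq_1')
  then have rec: "y = f + fps_const (cnj a) * (fps_X * y)" by (simp add: left_diff_distrib mult.assoc algebra_simps)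
  have y0: "y $ 0 = f $ 0" by (subst rec) simp
  have yS: "y $ Suc n = f $ Suc n + cnj a * y $ n" for n by (subst rec) simp
  define S where "S n = L2_set (\<lambda>k. cmod (y $ k)) {..n}" for n
  define T where "T = sqrt (\<Sum>k. (cmod (f $ k))\<^sup>2)"
  have fT: "L2_set (\<lambda>k. cmod (f $ k)) {..n} \<le> T" for n
    unfolding L2_set_def T_def using assms(2) by (intro real_sqrt_le_mono sum_le_suminf) (auto simp: l2_iff)
  have "S n * (1 - cmod a) \<le> T" for n
  proof -
    define v where "v k = (if k = 0 then 0 else cmod a * cmod (y $ (k - 1)))" for k
    have "S n \<le> L2_set (\<lambda>k. cmod (f $ k) + v k) {..n}" unfolding S_def
    proof (rule L2_set_mono)
      fix k
      show "cmod (y $ k) \<le> cmod (f $ k) + v k"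
      proof (cases k)
        case (Suc m)
        then show ?thesis using norm_triangle_ineq[of "f $ Suc m" "cnj a * y $ m"] by (simp add: v_def yS norm_mult)
      qed (simp add: v_def y0)
    qed simp
    also have "\<dots> \<le> L2_set (\<lambda>k. cmod (f $ k)) {..n} + L2_set v {..n}" by (rule L2_set_triangle_ineq)
    also have "L2_set v {..n} \<le> cmod a * S n"
    proof -
      have "(\<Sum>k\<le>n. (v k)\<^sup>2) \<le> (\<Sum>k\<le>Suc n. (v k)\<^sup>2)" by simp
      also have "\<dots> = (cmod a)\<^sup>2 * (\<Sum>k\<le>n. (cmod (y $ k))\<^sup>2)"
        unfolding sum.atMost_Suc_shift by (simp add: v_def power_mult_distrib sum_distrib_left)
      finally have "sqrt (\<Sum>k\<le>n. (v k)\<^sup>2) \<le> sqrt ((cmod a)\<^sup>2 * (\<Sum>k\<le>n. (cmod (y $ k))\<^sup>2))" by (rule real_sqrt_le_mono)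
      then show ?thesis by (simp add: L2_set_def S_def real_sqrt_mult)
    qed
    finally have "S n \<le> T + cmod a * S n" using fT[of n] by simp
    then show ?thesis by (simp add: algebra_simps)
  qed
  then have SB: "S n \<le> T / (1 - cmod a)" for n using assms(1) by (simp add: le_divide_eq)
  have "summable (\<lambda>k. (cmod (y $ k))\<^sup>2)"
  proof (rule bounded_imp_summable)
    fix n
    have "(\<Sum>k\<le>n. (cmod (y $ k))\<^sup>2) = (S n)\<^sup>2" unfolding S_def L2_set_def by (simp add: sum_nonneg)
    also have "\<dots> \<le> (T / (1 - cmod a))\<^sup>2" using SB by (intro power_mono) (auto simp: S_def L2_set_nonneg)
    finally show "(\<Sum>k\<le>n. (cmod (y $ k))\<^sup>2) \<le> (T / (1 - cmod a))\<^sup>2" .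
  qed simp
  then show ?thesis by (simp add: l2_iff y_def)
qed

definition zero_fps :: "complex list \<Rightarrow> complex fps" where "zero_fps as = fps_of_poly (zero_poly as)"
definition pole_fps :: "complex list \<Rightarrow> complex fps" where "pole_fps as = fps_of_poly (pole_poly as)"

lemma zero_fps_simps: "zero_fps [] = 1" "zero_fps (a # as) = zero_factor a * zero_fps as"
  by (simp_all add: zero_fps_def fps_of_poly_mult fps_of_poly_linear del: mult_pCons_left)

lemma pole_fps_simps: "pole_fps [] = 1" "pole_fps (a # as) = pole_factor a * pole_fps as"
  by (simp_all add: pole_fps_def fps_of_poly_mult fps_of_poly_linear' del: mult_pCons_left)

lemma pole_fps_0: "pole_fps as $ 0 = 1"
  by (induction as) (simp_all add: pole_fps_simps)

lemma pole_fps_inverse: "pole_fps as * inverse (pole_fps as) = 1"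
  by (simp add: inverse_mult_eq_1' pole_fps_0)

lemma l2_zero_fps: "l2 f \<Longrightarrow> l2 (zero_fps as * f)"
  by (induction as) (simp_all add: zero_fps_simps mult.assoc l2_zero_factor)

lemma l2_pole_fps: "l2 f \<Longrightarrow> l2 (pole_fps as * f)"
  by (induction as) (simp_all add: pole_fps_simps mult.assoc l2_pole_factor)

lemma l2_inverse_pole_fps: "\<forall>a\<in>set as. cmod a < 1 \<Longrightarrow> l2 f \<Longrightarrow> l2 (inverse (pole_fps as) * f)"
proof (induction as)
  case (Cons a as)
  have "inverse (pole_fps (a # as)) = inverse (pole_factor a) * inverse (pole_fps as)"
    unfolding pole_fps_simps by (rule fps_inverse_mult)
  then show ?case using Cons by (simp add: mult.assoc l2_inverse_pole_factor)
qed (simp add: pole_fps_simps)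

lemma l2_fps_of_poly: "l2 (fps_of_poly p)"
  unfolding l2_iff by (rule summable_finite[of "{..degree p}"]) (auto simp: coeff_eq_0)

lemma fps_shift_pole_factor: "fps_shift 1 (pole_factor a * fps_shift n h) = fps_shift (Suc n) (pole_factor a * h)"
  by (rule fps_ext) (simp add: left_diff_distrib mult.assoc)

text \<open>The adjoint of multiplication by \<open>zero_fps as\<close>, computed one factor at a time:
  \<open>(S - a)\<^sup>*\<close> is multiplication by \<open>1 - cnj a X\<close> followed by the backward shift.\<close>
lemma ip_zero_fps: "l2 f \<Longrightarrow> l2 g \<Longrightarrow> ip f (zero_fps as * g) = ip (fps_shift (length as) (pole_fps as * f)) g"
proof (induction as arbitrary: g)
  case (Cons a as)
  define w where "w = fps_shift (length as) (pole_fps as * f)"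
  have w: "l2 w" unfolding w_def by (intro l2_shift l2_pole_fps Cons)
  have "ip f (zero_fps (a # as) * g) = ip f (zero_fps as * (zero_factor a * g))"
    by (simp add: zero_fps_simps mult_ac)
  also have "\<dots> = ip w (zero_factor a * g)" unfolding w_def by (rule Cons.IH) (use Cons l2_zero_factor in auto)
  also have "\<dots> = ip (fps_shift 1 w) g - cnj a * ip w g"
    unfolding left_diff_distrib using w Cons.prems(2) by (simp add: ip_diff_right ip_X_right ip_cmult_right l2_X l2_cmult)
  also have "\<dots> = ip (fps_shift 1 w - fps_const (cnj a) * w) g"
    using w Cons.prems(2) by (simp add: ip_diff_left ip_cmult_left l2_shift l2_cmult)
  also have "fps_shift 1 w - fps_const (cnj a) * w = fps_shift 1 (pole_factor a * w)"
    by (rule fps_ext) (simp add: left_diff_distrib mult.assoc)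
  also have "\<dots> = fps_shift (length (a # as)) (pole_fps (a # as) * f)"
    unfolding w_def fps_shift_pole_factor by (simp add: pole_fps_simps mult.assoc)
  finally show ?case .
qed (simp add: zero_fps_simps pole_fps_simps)

text \<open>On the circle |z - a| = |1 - cnj a z|; in coefficients both norms have the same
  expansion.\<close>

lemma ip_blaschke_factor:
  assumes "l2 y" shows "ip (zero_factor a * y) (zero_factor a * y) = ip (pole_factor a * y) (pole_factor a * y)"
proof -
  note [simp] = assms l2_X l2_cmult l2_diff ip_diff_left ip_diff_right ip_cmult_left ip_cmult_right ip_X_X
  have "ip (zero_factor a * y) (zero_factor a * y) = ip y y - cnj a * ip (fps_X * y) y - a * ip y (fps_X * y) + a * cnj a * ip y y"
    unfolding left_diff_distrib by simp (simp add: algebra_simps)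
  moreover have "ip (pole_factor a * y) (pole_factor a * y) = ip y y - cnj a * ip (fps_X * y) y - a * ip y (fps_X * y) + a * cnj a * ip y y"
    unfolding left_diff_distrib mult.assoc mult_1_left by simp (simp add: algebra_simps)
  ultimately show ?thesis by simp
qed

lemma ip_blaschke_isometry:
  "\<forall>a\<in>set as. cmod a < 1 \<Longrightarrow> l2 f \<Longrightarrow> ip (zero_fps as * (inverse (pole_fps as) * f)) (zero_fps as * (inverse (pole_fps as) * f)) = ip f f"
proof (induction as)
  case (Cons a as)
  define y where "y = inverse (pole_factor a) * (zero_fps as * (inverse (pole_fps as) * f))"
  have y: "l2 y" unfolding y_def using Cons.prems by (auto intro!: l2_inverse_pole_factor l2_zero_fps l2_inverse_pole_fps)
  have "inverse (pole_fps (a # as)) = inverse (pole_factor a) * inverse (pole_fps as)"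
    unfolding pole_fps_simps by (rule fps_inverse_mult)
  then have eq: "zero_fps (a # as) * (inverse (pole_fps (a # as)) * f) = zero_factor a * y"
    by (simp add: zero_fps_simps y_def mult_ac)
  have "pole_factor a $ 0 \<noteq> 0" by simp
  then have "pole_factor a * y = zero_fps as * (inverse (pole_fps as) * f)"
    by (simp add: y_def mult.assoc[symmetric] inverse_mult_eq_1')
  then show ?case unfolding eq ip_blaschke_factor[OF y] using Cons by simp
qed (simp add: zero_fps_simps pole_fps_simps)

lemma blaschke_has_fps_expansion:
  "blaschke \<gamma> as has_fps_expansion fps_const \<gamma> * (zero_fps as * inverse (pole_fps as))"
proof (induction as)
  case Nil
  have "blaschke \<gamma> [] = (\<lambda>_. \<gamma>)" by auto
  then show ?case by (simp add: zero_fps_simps pole_fps_simps)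
next
  case (Cons a as)
  have "(\<lambda>z. (z - a) * inverse (1 - cnj a * z) * blaschke \<gamma> as z) has_fps_expansion
     (fps_X - fps_const a) * inverse (1 - fps_const (cnj a) * fps_X) * (fps_const \<gamma> * (zero_fps as * inverse (pole_fps as)))"
    by (intro fps_expansion_intros Cons) simp
  moreover have "(\<lambda>z. (z - a) * inverse (1 - cnj a * z) * blaschke \<gamma> as z) = blaschke \<gamma> (a # as)"
    by (auto simp: divide_inverse)
  moreover have "(fps_X - fps_const a) * inverse (1 - fps_const (cnj a) * fps_X) * (fps_const \<gamma> * (zero_fps as * inverse (pole_fps as)))
     = fps_const \<gamma> * (zero_fps (a # as) * inverse (pole_fps (a # as)))"
    unfolding zero_fps_simps pole_fps_simps fps_inverse_mult by (simp only: mult_ac)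
  ultimately show ?case by (simp only:)
qed

lemma taylor_coeff_blaschke: "taylor_coeff (blaschke \<gamma> as) = fps_nth (fps_const \<gamma> * (zero_fps as * inverse (pole_fps as)))"
  using fps_nth_fps_expansion[OF blaschke_has_fps_expansion[of \<gamma> as]] by (auto simp: taylor_coeff_def)

lemma mult_seq_fps: "mult_seq (fps_nth f) (fps_nth g) = fps_nth (f * g)"
  by (auto simp: mult_seq_def fps_mult_nth atLeast0AtMost)

text \<open>Multiplication and division by \<open>pole_fps\<close> preserve square summability, so
  only the numerator of the product matters.\<close>

lemma BH2_iff:
  assumes "\<gamma> \<noteq> 0" "\<forall>a\<in>set as. cmod a < 1"
  shows "fps_nth f \<in> BH2 (blaschke \<gamma> as) \<longleftrightarrow> (\<exists>g. l2 g \<and> f = zero_fps as * g)"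
proof
  assume "fps_nth f \<in> BH2 (blaschke \<gamma> as)"
  then obtain h where h: "h \<in> H2" "fps_nth f = mult_seq (taylor_coeff (blaschke \<gamma> as)) h" by (auto simp: BH2_def)
  have "h = fps_nth (Abs_fps h)" by auto
  then have "fps_nth f = fps_nth (fps_const \<gamma> * (zero_fps as * inverse (pole_fps as)) * Abs_fps h)"
    unfolding h(2) taylor_coeff_blaschke mult_seq_fps[symmetric] by simp
  then have "f = zero_fps as * (fps_const \<gamma> * (inverse (pole_fps as) * Abs_fps h))"
    by (simp add: fps_nth_inject mult_ac)
  moreover have "l2 (fps_const \<gamma> * (inverse (pole_fps as) * Abs_fps h))"
    using h(1) \<open>h = fps_nth (Abs_fps h)\<close> assms by (intro l2_cmult l2_inverse_pole_fps) (auto simp: l2_def)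
  ultimately show "\<exists>g. l2 g \<and> f = zero_fps as * g" by blast
next
  assume "\<exists>g. l2 g \<and> f = zero_fps as * g"
  then obtain g where g: "l2 g" "f = zero_fps as * g" by blast
  define h where "h = fps_const (inverse \<gamma>) * (pole_fps as * g)"
  have "fps_nth h \<in> H2" unfolding l2_def[symmetric] h_def by (intro l2_cmult l2_pole_fps g)
  moreover have "fps_const \<gamma> * (zero_fps as * inverse (pole_fps as)) * h = f"
  proof -
    have "fps_const \<gamma> * fps_const (inverse \<gamma>) = 1" using assms(1) by simp
    then show ?thesis unfolding h_def g(2) using pole_fps_inverse[of as] by algebra
  qed
  ultimately show "fps_nth f \<in> BH2 (blaschke \<gamma> as)"
    unfolding BH2_def taylor_coeff_blaschke using mult_seq_fps by (metis image_eqI)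
qed

text \<open>By \<open>ip_zero_fps\<close> orthogonality says that the adjoint image w of f is
  orthogonal to everything, itself included. The model space is thus the polynomials of degree below
  \<open>length as\<close> over the pole polynomial.\<close>

lemma model_space_iff:
  assumes "\<gamma> \<noteq> 0" "\<forall>a\<in>set as. cmod a < 1"
  shows "fps_nth f \<in> model_space (blaschke \<gamma> as) \<longleftrightarrow> l2 f \<and> fps_shift (length as) (pole_fps as * f) = 0"
proof -
  define w where "w = fps_shift (length as) (pole_fps as * f)"
  have "fps_nth f \<in> model_space (blaschke \<gamma> as) \<longleftrightarrow> l2 f \<and> (\<forall>g. l2 g \<longrightarrow> ip f (zero_fps as * g) = 0)"
  proof -
    have "(\<forall>g\<in>BH2 (blaschke \<gamma> as). h2_inner (fps_nth f) g = 0) \<longleftrightarrow> (\<forall>u. fps_nth u \<in> BH2 (blaschke \<gamma> as) \<longrightarrow> ip f u = 0)"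
    proof (intro iffI ballI allI impI)
      fix g assume *: "\<forall>u. fps_nth u \<in> BH2 (blaschke \<gamma> as) \<longrightarrow> ip f u = 0" "g \<in> BH2 (blaschke \<gamma> as)"
      have "fps_nth (Abs_fps g) = g" by auto
      then show "h2_inner (fps_nth f) g = 0" using *(1)[rule_format, of "Abs_fps g"] *(2) by (simp add: ip_def)
    qed (simp add: ip_def)
    then show ?thesis unfolding model_space_def mem_Collect_eq BH2_iff[OF assms] l2_def[of f] by blast
  qed
  also have "\<dots> \<longleftrightarrow> l2 f \<and> w = 0"
  proof (intro conj_cong refl)
    assume f: "l2 f"
    have w: "l2 w" unfolding w_def by (intro l2_shift l2_pole_fps f)
    show "(\<forall>g. l2 g \<longrightarrow> ip f (zero_fps as * g) = 0) \<longleftrightarrow> w = 0"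
      using ip_zero_fps[OF f, of _ as] ip_self_eq_0[OF w] w ip_0_left unfolding w_def[symmetric] by metis
  qed
  finally show ?thesis unfolding w_def .
qed

section \<open>The numerical range of the compressed shift\<close>

lemma degree_zero_poly: "degree (zero_poly as) = length as" and coeff_zero_poly_length: "coeff (zero_poly as) (length as) = 1"
proof -
  have "degree (zero_poly as) = length as \<and> lead_coeff (zero_poly as) = 1"
  proof (induction as)
    case (Cons a as)
    then have "zero_poly as \<noteq> 0" by auto
    then have "degree ([:- a, 1:] * zero_poly as) = Suc (length as)" using Cons by (subst degree_mult_eq) auto
    moreover have "lead_coeff ([:- a, 1:] * zero_poly as) = 1"
      unfolding lead_coeff_mult Cons[THEN conjunct2] by simp
    ultimately show ?case by (simp del: mult_pCons_left)
  qed simp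
  then show "degree (zero_poly as) = length as" "coeff (zero_poly as) (length as) = 1" by auto
qed

lemma degree_pole_poly: "degree (pole_poly as) \<le> length as"
proof (induction as)
  case (Cons a as)
  have "degree ([:1, - cnj a:] * pole_poly as) \<le> degree [:1, - cnj a:] + degree (pole_poly as)" by (rule degree_mult_le)
  also have "\<dots> \<le> 1 + length as" using Cons by (intro add_mono) auto
  finally show ?case by (simp del: mult_pCons_left)
qed simp

lemma poly_eq_0_of_roots:
  assumes "\<And>m. m \<ge> N \<Longrightarrow> coeff p m = 0" "inj_on z {..<N}" "\<And>i. i < N \<Longrightarrow> poly p (z i) = 0"
  shows "p = (0 :: complex poly)"
proof (rule ccontr)
  assume p: "p \<noteq> 0"
  have "degree p < N" using assms(1) p by (metis leading_coeff_neq_0 not_less)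
  moreover have "N = card (z ` {..<N})" using card_image[OF assms(2)] by simp
  moreover have "card (z ` {..<N}) \<le> card {x. poly p x = 0}"
    by (rule card_mono) (use assms(3) poly_roots_finite[OF p] in auto)
  ultimately show False using card_poly_roots_bound[OF p] by linarith
qed

lemma fps_shift_eq_0_iff: "fps_shift n f = 0 \<longleftrightarrow> (\<forall>m\<ge>n. f $ m = 0)"
proof
  assume eq: "fps_shift n f = 0"
  show "\<forall>m\<ge>n. f $ m = 0"
  proof (intro allI impI)
    fix m assume "n \<le> m"
    then show "f $ m = 0" using arg_cong[OF eq, of "\<lambda>g. g $ (m - n)"] by simp
  qed
qed (auto intro: fps_ext)

text \<open>Multiplication by X raises the degree of the numerator to at most
  \<open>length as\<close>; subtracting a multiple of the inner function restores it. The subtracted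
  part is orthogonal to the model space, so the projection disappears from the quadratic
  form.\<close>

lemma compressed_shift_inner:
  assumes \<gamma>: "\<gamma> \<noteq> 0" and as: "\<forall>a\<in>set as. cmod a < 1" "as \<noteq> []"
    and x: "fps_nth x \<in> model_space (blaschke \<gamma> as)"
  shows "h2_inner (compressed_shift (blaschke \<gamma> as) (fps_nth x)) (fps_nth x) = ip (fps_X * x) x"
proof -
  let ?B = "blaschke \<gamma> as" and ?n = "length as"
  note ms = model_space_iff[OF \<gamma> as(1)]
  have lx: "l2 x" and x0: "\<And>m. m \<ge> ?n \<Longrightarrow> (pole_fps as * x) $ m = 0" using x unfolding ms fps_shift_eq_0_iff by auto
  \<comment> \<open>Top coefficient of the numerator of x; \<open>zero_poly as\<close> is monic, so
    c is the multiple to subtract.\<close>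
  define c where "c = (pole_fps as * x) $ (?n - 1)"
  define b where "b = zero_fps as * (inverse (pole_fps as) * fps_const c)"
  define g where "g = fps_X * x - b"
  have lb: "l2 b" unfolding b_def by (intro l2_zero_fps l2_inverse_pole_fps l2_const as)
  have lg: "l2 g" unfolding g_def by (intro l2_diff l2_X lx lb)
  have pg: "pole_fps as * g = fps_X * (pole_fps as * x) - zero_fps as * fps_const c"
    unfolding g_def b_def using pole_fps_inverse[of as] by algebra
  have "(pole_fps as * g) $ m = 0" if m: "m \<ge> ?n" for m
  proof (cases "m = ?n")
    case True
    then show ?thesis unfolding pg using as(2) by (simp add: zero_fps_def coeff_zero_poly_length c_def)
  next
    case False
    then have "coeff (zero_poly as) m = 0" "m - 1 \<ge> ?n" "m \<noteq> 0" using m by (auto simp: coeff_eq_0 degree_zero_poly)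
    then show ?thesis unfolding pg using x0[of "m - 1"] by (simp add: zero_fps_def)
  qed
  then have gm: "fps_nth g \<in> model_space ?B" unfolding ms fps_shift_eq_0_iff using lg by blast
  have ms_all: "\<exists>u. h = fps_nth u" for h :: "nat \<Rightarrow> complex" by (rule exI[of _ "Abs_fps h"]) auto
  have b_orth: "ip b u = 0" if "fps_nth u \<in> model_space ?B" for u
  proof -
    have lu: "l2 u" and "fps_shift ?n (pole_fps as * u) = 0" using that unfolding ms by auto
    then have "ip u b = 0" unfolding b_def using ip_zero_fps[OF lu, of "inverse (pole_fps as) * fps_const c" as]
      by (simp add: l2_inverse_pole_fps l2_const as ip_0_left)
    then show ?thesis using ip_cnj[OF lu lb] by simp
  qed
  have sx: "shift_op (fps_nth x) = fps_nth (fps_X * x)" by (auto simp: shift_op_def)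
  have minus: "fps_nth u - fps_nth v = fps_nth (u - v)" for u v :: "complex fps" by auto
  have "proj_model ?B (shift_op (fps_nth x)) = fps_nth g" unfolding proj_model_def
  proof (rule the_equality)
    show "fps_nth g \<in> model_space ?B \<and> (\<forall>h\<in>model_space ?B. h2_inner (shift_op (fps_nth x) - fps_nth g) h = 0)"
    proof (intro conjI ballI gm)
      fix h assume h: "h \<in> model_space ?B"
      obtain u where u: "h = fps_nth u" using ms_all by blast
      have "ip b u = 0" using b_orth h u by blast
      moreover have "fps_X * x - g = b" by (simp add: g_def)
      ultimately show "h2_inner (shift_op (fps_nth x) - fps_nth g) h = 0" unfolding sx u minus ip_def[symmetric] by simp
    qed
    fix h assume h: "h \<in> model_space ?B \<and> (\<forall>k\<in>model_space ?B. h2_inner (shift_op (fps_nth x) - h) k = 0)"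
    obtain u where u: "h = fps_nth u" using ms_all by blast
    have um: "fps_nth u \<in> model_space ?B" using h u by blast
    have lu: "l2 u" using um unfolding ms by blast
    have dm: "fps_nth (g - u) \<in> model_space ?B" using gm um lg lu unfolding ms
      by (simp add: l2_diff right_diff_distrib fps_shift_diff)
    have "ip (fps_X * x - u) (g - u) = 0"
      unfolding ip_def by (rule conjunct2[OF h[unfolded u sx minus], rule_format, OF dm])
    moreover have "ip b (g - u) = 0" using b_orth[OF dm] .
    moreover have "fps_X * x - u = (g - u) + b" by (simp add: g_def)
    ultimately have "ip (g - u) (g - u) = 0" using ip_add_left[OF l2_diff[OF lg lu] lb l2_diff[OF lg lu]] by simp
    then have "g - u = 0" using ip_self_eq_0[OF l2_diff[OF lg lu]] by blast
    then show "h = fps_nth g" using u by simp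
  qed
  then have "h2_inner (compressed_shift ?B (fps_nth x)) (fps_nth x) = ip g x" by (simp add: compressed_shift_def ip_def)
  also have "\<dots> = ip (fps_X * x) x" using ip_diff_left[OF l2_X[OF lx] lb lx] b_orth[OF x] by (simp add: g_def)
  finally show ?thesis .
qed

lemma num_range_SB_eq:
  assumes \<gamma>: "\<gamma> \<noteq> 0" and as: "\<forall>a\<in>set as. cmod a < 1" "as \<noteq> []"
  shows "num_range_SB (blaschke \<gamma> as)
     = {ip (fps_X * x) x | x. l2 x \<and> (\<forall>m\<ge>length as. (pole_fps as * x) $ m = 0) \<and> ip x x = 1}"
proof -
  have ex: "(\<exists>h. Q h) \<longleftrightarrow> (\<exists>u :: complex fps. Q (fps_nth u))" for Q
  proof -
    have "fps_nth (Abs_fps h) = h" for h :: "nat \<Rightarrow> complex" by auto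
    then show ?thesis by metis
  qed
  have "num_range_SB (blaschke \<gamma> as) = {h2_inner (compressed_shift (blaschke \<gamma> as) (fps_nth x)) (fps_nth x) | x.
     fps_nth x \<in> model_space (blaschke \<gamma> as) \<and> ip x x = 1}"
    unfolding num_range_SB_def ip_def ex ..
  also have "\<dots> = {ip (fps_X * x) x | x. fps_nth x \<in> model_space (blaschke \<gamma> as) \<and> ip x x = 1}"
    using compressed_shift_inner[OF assms] by (intro Collect_cong ex_cong1) auto
  finally show ?thesis unfolding model_space_iff[OF \<gamma> as(1)] fps_shift_eq_0_iff by (simp add: conj_assoc)
qed

text \<open>The nodes \<open>z i\<close> are a fibre of \<open>X B\<close> over a point of the circle. The functions \<open>basis i\<close>
  vanishing at all other nodes form an orthogonal basis of the model space of \<open>X B\<close>, in which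
  multiplication by \<open>X\<close> is diagonal up to multiples of \<open>defect\<close> (Clark's unitary perturbation).\<close>
locale clark_basis =
  fixes as :: "complex list" and z :: "nat \<Rightarrow> complex" and \<nu> :: complex and N :: nat
  assumes as: "\<forall>a\<in>set as. cmod a < 1" and N: "N = Suc (length as)"
    and \<nu>: "cmod \<nu> = 1" and circle: "\<And>i. i < N \<Longrightarrow> cmod (z i) = 1" and inj: "inj_on z {..<N}"
    and roots: "\<And>i. i < N \<Longrightarrow> poly (zero_poly (0 # as)) (z i) = \<nu> * poly (pole_poly as) (z i)"
begin

text \<open>Over the pole polynomial, \<open>W\<close> is X B - \<nu> for the product B with
  constant 1, and its roots are the nodes; \<open>Wi i\<close> drops the node i.\<close>

definition W :: "complex poly" where "W = zero_poly (0 # as) - smult \<nu> (pole_poly as)"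
definition Wi :: "nat \<Rightarrow> complex poly" where "Wi i = (\<Prod>l\<in>{..<N} - {i}. [:- z l, 1:])"
definition basis :: "nat \<Rightarrow> complex fps" where "basis i = inverse (pole_fps as) * fps_of_poly (Wi i)"
definition defect :: "complex fps" where "defect = inverse (pole_fps as) * fps_of_poly W"
definition inner_fps :: "complex fps" where "inner_fps = zero_fps (0 # as) * (inverse (pole_fps (0 # as)) * 1)"

lemma pole_0: "pole_fps (0 # as) = pole_fps as" by (simp add: pole_fps_simps)

lemma degree_Wi: "i < N \<Longrightarrow> degree (Wi i) = length as" and lead_Wi: "i < N \<Longrightarrow> coeff (Wi i) (length as) = 1"
proof -
  assume i: "i < N"
  have "degree (Wi i) = (\<Sum>l\<in>{..<N} - {i}. degree [:- z l, 1:])" unfolding Wi_def by (rule degree_prod_eq_sum_degree) auto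
  also have "\<dots> = length as" using i by (simp add: N)
  finally show d: "degree (Wi i) = length as" .
  have "lead_coeff (Wi i) = 1" unfolding Wi_def by (simp add: lead_coeff_prod)
  then show "coeff (Wi i) (length as) = 1" unfolding d .
qed

text \<open>Both sides are monic of degree N and vanish at all N nodes, so the difference, of
  smaller degree, is zero.\<close>

lemma W_eq: assumes i: "i < N" shows "W = [:- z i, 1:] * Wi i"
proof -
  have "W - [:- z i, 1:] * Wi i = 0"
  proof (rule poly_eq_0_of_roots[OF _ inj])
    fix m assume m: "N \<le> m"
    have d: "degree ([:- z i, 1:] * Wi i) = N" and lc: "coeff ([:- z i, 1:] * Wi i) N = 1"
    proof -
      have nz: "Wi i \<noteq> 0" using lead_Wi[OF i] by auto
      show d: "degree ([:- z i, 1:] * Wi i) = N" using nz degree_Wi[OF i] by (subst degree_mult_eq) (auto simp: N)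
      have "lead_coeff ([:- z i, 1:] * Wi i) = 1" using lead_Wi[OF i] degree_Wi[OF i] by (subst lead_coeff_mult) simp
      then show "coeff ([:- z i, 1:] * Wi i) N = 1" unfolding d .
    qed
    have q: "coeff (pole_poly as) m = 0" using degree_pole_poly[of as] m N by (intro coeff_eq_0) simp
    have p: "coeff (zero_poly (0 # as)) m = (if m = N then 1 else 0)"
      using coeff_zero_poly_length[of "0 # as"] degree_zero_poly[of "0 # as"] m N by (auto simp: coeff_eq_0 simp del: zero_poly_simps)
    have "coeff ([:- z i, 1:] * Wi i) m = (if m = N then 1 else 0)"
      using d lc m coeff_eq_0[of "[:- z i, 1:] * Wi i" m] by (cases "m = N") (simp_all del: mult_pCons_left)
    then show "coeff (W - [:- z i, 1:] * Wi i) m = 0" unfolding W_def coeff_diff coeff_smult p q by simp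
  next
    fix l assume l: "l < N"
    have "poly W (z l) = 0" using roots[OF l] by (simp add: W_def)
    moreover have "poly ([:- z i, 1:] * Wi i) (z l) = 0"
    proof (cases "l = i")
      case False
      then have "poly (Wi i) (z l) = 0" unfolding Wi_def poly_prod using l by (intro prod_zero) auto
      then show ?thesis by simp
    qed simp
    ultimately show "poly (W - [:- z i, 1:] * Wi i) (z l) = 0" by (simp only: poly_diff diff_self)
  qed
  then show ?thesis by simp
qed

lemma poly_Wi: "i < N \<Longrightarrow> l < N \<Longrightarrow> poly (Wi i) (z l) = 0 \<longleftrightarrow> l \<noteq> i"
  unfolding Wi_def poly_prod using inj by (auto simp: inj_on_def)

lemma X_basis: assumes i: "i < N" shows "fps_X * basis i = fps_const (z i) * basis i + defect"
proof -
  have "fps_of_poly W = (fps_X - fps_const (z i)) * fps_of_poly (Wi i)"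
    unfolding W_eq[OF i] fps_of_poly_mult fps_of_poly_linear by simp
  then show ?thesis unfolding basis_def defect_def by algebra
qed

lemma defect_eq: "defect = inner_fps - fps_const \<nu>"
proof -
  have "fps_of_poly W = zero_fps (0 # as) - fps_const \<nu> * pole_fps as"
    unfolding W_def by (simp add: zero_fps_def pole_fps_def fps_of_poly_diff fps_of_poly_smult del: zero_poly_simps)
  then show ?thesis unfolding defect_def inner_fps_def pole_0 using pole_fps_inverse[of as] by algebra
qed

lemma l2_basis: "l2 (basis i)" and l2_defect: "l2 defect" and l2_inner: "l2 inner_fps"
  unfolding basis_def defect_def inner_fps_def pole_0
  by (intro l2_zero_fps l2_inverse_pole_fps l2_fps_of_poly l2_1 as)+

lemma inner_fps_0: "inner_fps $ 0 = 0"
  by (simp add: inner_fps_def zero_fps_simps)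

lemma ip_inner_inner: "ip inner_fps inner_fps = 1"
proof -
  have "ip inner_fps inner_fps = ip 1 1" unfolding inner_fps_def by (rule ip_blaschke_isometry) (use as l2_1 in auto)
  then show ?thesis by (simp add: ip_one)
qed

lemma ip_basis_inner: assumes i: "i < N" shows "ip (basis i) inner_fps = 0"
proof -
  have "pole_fps (0 # as) * basis i = fps_of_poly (Wi i)" unfolding pole_0 basis_def using pole_fps_inverse[of as] by algebra
  moreover have "fps_shift (length (0 # as)) (fps_of_poly (Wi i)) = 0"
    unfolding fps_shift_eq_0_iff using degree_Wi[OF i] by (auto simp: coeff_eq_0)
  ultimately show ?thesis unfolding inner_fps_def
    using ip_zero_fps[OF l2_basis[of i], of "inverse (pole_fps (0 # as)) * 1" "0 # as"]
      l2_inverse_pole_fps[OF as l2_1] by (simp only: ip_0_left pole_0)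
qed

lemma cnj_circle: "cmod w = 1 \<Longrightarrow> w * cnj w = 1"
  using complex_norm_square[of w] by simp

text \<open>The defect is the inner function, orthogonal to the basis, minus a constant; pairing
  with a constant evaluates at 0, where \<open>X_basis\<close> gives the value.\<close>

lemma ip_basis_defect: assumes i: "i < N" shows "ip (basis i) defect = - cnj (z i)"
proof -
  have zi: "z i * cnj (z i) = 1" and n: "\<nu> * cnj \<nu> = 1" using cnj_circle circle[OF i] \<nu> by auto
  have "(fps_X * basis i) $ 0 = (fps_const (z i) * basis i + defect) $ 0" unfolding X_basis[OF i] ..
  then have "z i * basis i $ 0 = \<nu>" by (simp add: defect_eq inner_fps_0)
  moreover have "b = \<nu> * cnj (z i)" if "z i * b = \<nu>" for b using zi that by algebra
  ultimately have b0: "basis i $ 0 = \<nu> * cnj (z i)" by blast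
  have "ip (basis i) (fps_const \<nu> * 1) = cnj \<nu> * ip (basis i) 1" by (rule ip_cmult_right) (auto simp: l2_1 l2_basis)
  then have "ip (basis i) (fps_const \<nu>) = cnj (z i)"
    unfolding ip_one mult_1_right b0 using n by algebra
  then show ?thesis unfolding defect_eq using ip_basis_inner[OF i] by (simp add: ip_diff_right l2_inner l2_const l2_basis)
qed

lemma ip_defect_defect: "ip defect defect = 2"
proof -
  have n: "\<nu> * cnj \<nu> = 1" using cnj_circle \<nu> by auto
  have 1: "ip inner_fps (fps_const \<nu> * 1) = cnj \<nu> * ip inner_fps 1" by (rule ip_cmult_right) (auto simp: l2_1 l2_inner)
  then have 2: "ip inner_fps (fps_const \<nu>) = 0" by (simp add: ip_one inner_fps_0)
  then have 3: "ip (fps_const \<nu>) inner_fps = 0" using ip_cnj[OF l2_inner l2_const, of \<nu>] by simp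
  have "ip (fps_const \<nu>) (fps_const \<nu> * 1) = cnj \<nu> * ip (fps_const \<nu>) 1" by (rule ip_cmult_right) (auto simp: l2_1 l2_const)
  then have 4: "ip (fps_const \<nu>) (fps_const \<nu>) = 1" using n by (simp add: ip_one mult.commute)
  show ?thesis unfolding defect_eq
    by (simp add: ip_diff_left ip_diff_right l2_diff l2_inner l2_const 2 3 4 ip_inner_inner)
qed

text \<open>Multiplication by X is an isometry; in the expansion the defect terms cancel as - 1 - 1
  + 2, which leaves z i - z l times the inner product equal to 0.\<close>

lemma ip_basis_orthogonal: assumes il: "i < N" "l < N" "i \<noteq> l" shows "ip (basis i) (basis l) = 0"
proof -
  let ?I = "ip (basis i) (basis l)"
  have zi: "z i * cnj (z i) = 1" and zl: "z l * cnj (z l) = 1" using cnj_circle circle il by auto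
  have d: "ip defect (basis l) = - z l" using ip_cnj[OF l2_basis l2_defect, of l] ip_basis_defect[OF il(2)] by simp
  have "?I = ip (fps_const (z i) * basis i + defect) (fps_const (z l) * basis l + defect)"
    unfolding X_basis[OF il(1), symmetric] X_basis[OF il(2), symmetric] by (rule ip_X_X[symmetric]) (rule l2_basis)+
  also have "\<dots> = z i * cnj (z l) * ?I + z i * ip (basis i) defect + cnj (z l) * ip defect (basis l) + ip defect defect"
    by (simp add: ip_add_left ip_add_right ip_cmult_left ip_cmult_right l2_add l2_cmult l2_basis l2_defect distrib_left)
  finally have "?I = z i * cnj (z l) * ?I + z i * (- cnj (z i)) + cnj (z l) * (- z l) + 2"
    unfolding ip_basis_defect[OF il(1)] d ip_defect_defect .
  then have "(z i - z l) * ?I = 0" using zi zl by algebra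
  moreover have "z i \<noteq> z l" using inj il by (auto simp: inj_on_def)
  ultimately show ?thesis by simp
qed

definition weight :: "nat \<Rightarrow> real" where "weight i = Re (ip (basis i) (basis i))"

lemma ip_basis_self: "ip (basis i) (basis i) = of_real (weight i)"
  unfolding weight_def by (rule ip_self_real[OF l2_basis])

lemma weight_pos: assumes i: "i < N" shows "weight i > 0"
proof -
  have "basis i \<noteq> 0"
  proof
    assume "basis i = 0"
    then have "pole_fps as * basis i = 0" by simp
    then have "fps_of_poly (Wi i) = 0" unfolding basis_def using pole_fps_inverse[of as] by algebra
    then have "Wi i = 0" by (metis fps_of_poly_0 fps_of_poly_eq_iff)
    then show False using lead_Wi[OF i] by simp
  qed
  then have "weight i \<noteq> 0" using ip_self_eq_0[OF l2_basis, of i] ip_basis_self[of i] by auto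
  then show ?thesis using ip_self_nonneg[OF l2_basis, of i] by (simp add: weight_def)
qed

lemma ip_combination:
  "ip (\<Sum>i<N. fps_const (\<beta> i) * basis i) (\<Sum>i<N. fps_const (\<alpha> i) * basis i) = (\<Sum>i<N. \<beta> i * cnj (\<alpha> i) * of_real (weight i))"
proof -
  have "ip (\<Sum>i<N. fps_const (\<beta> i) * basis i) (\<Sum>i<N. fps_const (\<alpha> i) * basis i)
     = (\<Sum>i<N. ip (fps_const (\<beta> i) * basis i) (\<Sum>l<N. fps_const (\<alpha> l) * basis l))"
    by (rule ip_sum_left) (auto intro!: l2_sum l2_cmult l2_basis)
  also have "\<dots> = (\<Sum>i<N. \<Sum>l<N. ip (fps_const (\<beta> i) * basis i) (fps_const (\<alpha> l) * basis l))"
    by (intro sum.cong refl ip_sum_right) (auto intro!: l2_sum l2_cmult l2_basis)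
  also have "\<dots> = (\<Sum>i<N. \<Sum>l<N. if l = i then \<beta> i * cnj (\<alpha> i) * of_real (weight i) else 0)"
  proof (intro sum.cong refl)
    fix i l assume "i \<in> {..<N}" "l \<in> {..<N}"
    then show "ip (fps_const (\<beta> i) * basis i) (fps_const (\<alpha> l) * basis l) = (if l = i then \<beta> i * cnj (\<alpha> i) * of_real (weight i) else 0)"
      using ip_basis_orthogonal[of i l] by (auto simp: ip_cmult_left ip_cmult_right l2_cmult l2_basis ip_basis_self)
  qed
  also have "\<dots> = (\<Sum>i<N. \<beta> i * cnj (\<alpha> i) * of_real (weight i))" by simp
  finally show ?thesis .
qed

text \<open>A vanishing coefficient sum cancels the defect. By \<open>expansion\<close> such
  combinations cover the model space of B.\<close>

lemma X_combination:
  assumes "(\<Sum>i<N. \<alpha> i) = 0"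
  shows "fps_X * (\<Sum>i<N. fps_const (\<alpha> i) * basis i) = (\<Sum>i<N. fps_const (\<alpha> i * z i) * basis i)"
proof -
  have "fps_X * (\<Sum>i<N. fps_const (\<alpha> i) * basis i) = (\<Sum>i<N. fps_const (\<alpha> i) * (fps_X * basis i))"
    unfolding sum_distrib_left by (simp add: mult.left_commute)
  also have "\<dots> = (\<Sum>i<N. fps_const (\<alpha> i * z i) * basis i + fps_const (\<alpha> i) * defect)"
    by (intro sum.cong refl) (simp add: X_basis distrib_left mult.assoc[symmetric])
  also have "\<dots> = (\<Sum>i<N. fps_const (\<alpha> i * z i) * basis i) + (\<Sum>i<N. fps_const (\<alpha> i)) * defect"
    by (simp add: sum.distrib sum_distrib_right)
  also have "(\<Sum>i<N. fps_const (\<alpha> i)) = fps_const (\<Sum>i<N. \<alpha> i)" by (rule fps_ext) (simp add: fps_sum_nth)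
  finally show ?thesis using assms by simp
qed

text \<open>Lagrange interpolation of the numerator at the nodes; the coefficient sum is its
  coefficient at \<open>length as\<close>, which lies beyond its degree.\<close>

lemma expansion:
  assumes "\<And>m. m \<ge> length as \<Longrightarrow> (pole_fps as * x) $ m = 0"
  obtains \<alpha> where "x = (\<Sum>i<N. fps_const (\<alpha> i) * basis i)" "(\<Sum>i<N. \<alpha> i) = 0"
proof -
  define R where "R = truncate_fps (length as) (pole_fps as * x)"
  have R: "pole_fps as * x = fps_of_poly R"
    by (rule fps_ext) (use assms in \<open>simp add: R_def coeff_truncate_fps\<close>)
  have R0: "coeff R m = 0" if "m \<ge> length as" for m using that by (simp add: R_def)
  define \<alpha> where "\<alpha> i = poly R (z i) / poly (Wi i) (z i)" for i
  have "R - (\<Sum>i<N. smult (\<alpha> i) (Wi i)) = 0"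
  proof (rule poly_eq_0_of_roots[OF _ inj])
    fix m assume "N \<le> m"
    then show "coeff (R - (\<Sum>i<N. smult (\<alpha> i) (Wi i))) m = 0"
      using R0[of m] degree_Wi N by (auto simp: coeff_sum coeff_eq_0 intro!: sum.neutral)
  next
    fix l assume l: "l < N"
    have "poly (\<Sum>i<N. smult (\<alpha> i) (Wi i)) (z l) = (\<Sum>i<N. if i = l then poly R (z l) else 0)"
      unfolding poly_sum by (intro sum.cong refl) (use poly_Wi l in \<open>auto simp: \<alpha>_def\<close>)
    then show "poly (R - (\<Sum>i<N. smult (\<alpha> i) (Wi i))) (z l) = 0" using l by simp
  qed
  then have Rs: "R = (\<Sum>i<N. smult (\<alpha> i) (Wi i))" by simp
  have "coeff R (length as) = (\<Sum>i<N. \<alpha> i)"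
    unfolding Rs coeff_sum by (intro sum.cong refl) (use lead_Wi in auto)
  then have s: "(\<Sum>i<N. \<alpha> i) = 0" using R0 by simp
  have "x = inverse (pole_fps as) * fps_of_poly R" unfolding R[symmetric] using pole_fps_inverse[of as] by algebra
  also have "\<dots> = (\<Sum>i<N. fps_const (\<alpha> i) * basis i)"
    unfolding Rs fps_of_poly_sum fps_of_poly_smult basis_def sum_distrib_left by (simp add: mult.left_commute)
  finally show ?thesis using s that by blast
qed

text \<open>In the orthogonal basis the quadratic form is a weighted average of the nodes, so the
  numerical range lies in the hull of the polygon.\<close>

lemma num_range_convex_combination:
  assumes \<gamma>: "\<gamma> \<noteq> 0" and ne: "as \<noteq> []" and v: "v \<in> num_range_SB (blaschke \<gamma> as)"
  obtains p where "\<And>i. p i \<ge> 0" "(\<Sum>i<N. p i) = 1" "v = (\<Sum>i<N. of_real (p i) * z i)"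
proof -
  obtain x where x: "v = ip (fps_X * x) x" "\<And>m. m \<ge> length as \<Longrightarrow> (pole_fps as * x) $ m = 0" "ip x x = 1"
    using v unfolding num_range_SB_eq[OF \<gamma> as ne] by blast
  obtain \<alpha> where \<alpha>: "x = (\<Sum>i<N. fps_const (\<alpha> i) * basis i)" "(\<Sum>i<N. \<alpha> i) = 0" using expansion[OF x(2)] by blast
  \<comment> \<open>The absolute value keeps p nonnegative also at indices from N on.\<close>
  define p where "p i = (cmod (\<alpha> i))\<^sup>2 * \<bar>weight i\<bar>" for i
  have p: "complex_of_real (p i) = \<alpha> i * cnj (\<alpha> i) * of_real (weight i)" if "i < N" for i
    using weight_pos[OF that] unfolding p_def of_real_mult complex_norm_square by simp
  have "of_real (\<Sum>i<N. p i) = ip x x" unfolding \<alpha>(1) ip_combination of_real_sum by (intro sum.cong refl) (use p in auto)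
  then have "complex_of_real (\<Sum>i<N. p i) = of_real 1" using x(3) by simp
  then have s: "(\<Sum>i<N. p i) = 1" by (simp only: of_real_eq_iff)
  have "v = (\<Sum>i<N. \<alpha> i * z i * cnj (\<alpha> i) * of_real (weight i))"
    unfolding x(1) \<alpha>(1) X_combination[OF \<alpha>(2)] ip_combination ..
  also have "\<dots> = (\<Sum>i<N. of_real (p i) * z i)" by (intro sum.cong refl) (use p in \<open>simp add: mult_ac\<close>)
  finally show ?thesis using s that[of p] by (simp add: p_def)
qed

text \<open>A vector supported on two nodes with opposite coefficients has coefficient sum 0, and
  its value is a convex combination of just these two nodes.\<close>

lemma num_range_meets_side:
  assumes \<gamma>: "\<gamma> \<noteq> 0" and ne: "as \<noteq> []" and il: "i < N" "l < N" "i \<noteq> l"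
  obtains q r where "q \<ge> 0" "r \<ge> 0" "q + r = 1" "of_real q * z i + of_real r * z l \<in> num_range_SB (blaschke \<gamma> as)"
proof -
  define T where "T = sqrt (weight i + weight l)"
  have T: "T > 0" "T\<^sup>2 = weight i + weight l" using weight_pos il by (simp_all add: T_def add_pos_pos less_imp_le)
  define \<alpha> where "\<alpha> m = (if m = i then complex_of_real (1 / T) else if m = l then - complex_of_real (1 / T) else 0)" for m
  define x where "x = (\<Sum>m<N. fps_const (\<alpha> m) * basis m)"
  have split: "(\<Sum>m<N. g m) = g i + g l" if "\<And>m. m \<noteq> i \<Longrightarrow> m \<noteq> l \<Longrightarrow> g m = 0" for g :: "nat \<Rightarrow> 'b::comm_monoid_add"
  proof -
    have "(\<Sum>m<N. g m) = (\<Sum>m\<in>{i, l}. g m)" by (rule sum.mono_neutral_right) (use il that in auto)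
    then show ?thesis using il by simp
  qed
  have s: "(\<Sum>m<N. \<alpha> m) = 0" using split[of \<alpha>] il by (simp add: \<alpha>_def)
  have aa: "\<alpha> m * cnj (\<alpha> m) = of_real (1 / T\<^sup>2)" if "m = i \<or> m = l" for m
    using that by (auto simp: \<alpha>_def power2_eq_square)
  have x1: "ip x x = 1"
  proof -
    have "ip x x = (\<Sum>m<N. \<alpha> m * cnj (\<alpha> m) * of_real (weight m))" unfolding x_def ip_combination ..
    also have "\<dots> = of_real (1 / T\<^sup>2) * of_real (weight i) + of_real (1 / T\<^sup>2) * of_real (weight l)"
      by (subst split, simp add: \<alpha>_def, simp add: aa)
    also have "\<dots> = of_real ((weight i + weight l) / T\<^sup>2)" by (simp add: add_divide_distrib)
    finally show ?thesis unfolding T(2)[symmetric] using T(1) by simp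
  qed
  have Xx: "ip (fps_X * x) x = of_real (weight i / T\<^sup>2) * z i + of_real (weight l / T\<^sup>2) * z l"
  proof -
    have "ip (fps_X * x) x = (\<Sum>m<N. \<alpha> m * z m * cnj (\<alpha> m) * of_real (weight m))"
      unfolding x_def X_combination[OF s] ip_combination ..
    also have "\<dots> = (\<Sum>m<N. (\<alpha> m * cnj (\<alpha> m)) * (z m * of_real (weight m)))" by (simp add: mult_ac)
    also have "\<dots> = of_real (1 / T\<^sup>2) * (z i * of_real (weight i)) + of_real (1 / T\<^sup>2) * (z l * of_real (weight l))"
      by (subst split, simp add: \<alpha>_def, simp add: aa)
    finally show ?thesis by (simp add: mult_ac)
  qed
  have l2x: "l2 x" unfolding x_def by (intro l2_sum l2_cmult l2_basis) simp
  have "(pole_fps as * x) $ m = 0" if m: "m \<ge> length as" for m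
  proof -
    have e: "pole_fps as * (fps_const c * basis n) = fps_const c * fps_of_poly (Wi n)" for c n
      unfolding basis_def using pole_fps_inverse[of as] by algebra
    have "pole_fps as * x = (\<Sum>n<N. fps_const (\<alpha> n) * fps_of_poly (Wi n))" unfolding x_def sum_distrib_left e ..
    then have sum: "(pole_fps as * x) $ m = (\<Sum>n<N. \<alpha> n * coeff (Wi n) m)" by (simp add: fps_sum_nth)
    show ?thesis
    proof (cases "m = length as")
      case True
      then have "(\<Sum>n<N. \<alpha> n * coeff (Wi n) m) = (\<Sum>n<N. \<alpha> n)" by (intro sum.cong refl) (use lead_Wi in auto)
      then show ?thesis using sum s by simp
    next
      case False
      then have "(\<Sum>n<N. \<alpha> n * coeff (Wi n) m) = 0" by (intro sum.neutral) (use degree_Wi m in \<open>auto simp: coeff_eq_0\<close>)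
      then show ?thesis using sum by simp
    qed
  qed
  then have "ip (fps_X * x) x \<in> num_range_SB (blaschke \<gamma> as)" unfolding num_range_SB_eq[OF \<gamma> as ne] using l2x x1 by blast
  moreover have "weight i / T\<^sup>2 + weight l / T\<^sup>2 = 1"
    unfolding add_divide_distrib[symmetric] T(2)[symmetric] using T(1) by simp
  ultimately show ?thesis unfolding Xx using that[of "weight i / T\<^sup>2" "weight l / T\<^sup>2"] weight_pos il by (simp add: less_imp_le)
qed

end

section \<open>From the numerical range to the Poncelet conic\<close>

text \<open>Reflecting one focus in the line through \<open>y\<close> with normal \<open>cis \<phi>\<close> bounds the distance of
  that line from the centre.\<close>
lemma focal_disk_width:
  assumes y: "cmod (y - d) + cmod (y + d) \<le> 2 * a"
  shows "(Re (y * cis (- \<phi>)))\<^sup>2 \<le> a\<^sup>2 - (cmod d)\<^sup>2 + (Re (d * cis (- \<phi>)))\<^sup>2"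
proof -
  define Y E where "Y = y * cis (- \<phi>)" "E = d * cis (- \<phi>)"
  have "cmod (Y - E) = cmod ((y - d) * cis (- \<phi>))" "cmod (Y + E) = cmod ((y + d) * cis (- \<phi>))"
    by (simp_all only: Y_E_def left_diff_distrib distrib_right)
  then have n: "cmod (Y - E) = cmod (y - d)" "cmod (Y + E) = cmod (y + d)" by (simp_all add: norm_mult)
  have E: "(cmod E)\<^sup>2 = (cmod d)\<^sup>2" by (simp add: Y_E_def norm_mult)
  define E' where "E' = of_real (2 * Re Y) - cnj E"
  have "cmod (Y - E') = cmod (Y - E)"
  proof -
    have "Y - E' = - cnj (Y - E)" by (simp add: E'_def complex_eq_iff)
    then show ?thesis by (metis complex_mod_cnj norm_minus_cancel)
  qed
  then have "cmod (E' + E) \<le> 2 * a"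
    using norm_triangle_ineq4[of "Y + E" "Y - E'"] y n by (simp add: add.commute)
  then have "(cmod (E' + E))\<^sup>2 \<le> (2 * a)\<^sup>2" by (intro power_mono) auto
  moreover have "(cmod (E' + E))\<^sup>2 = 4 * (Re Y)\<^sup>2 + 4 * (Im E)\<^sup>2"
    unfolding cmod_power2 by (simp add: E'_def power2_eq_square)
  moreover have "(Im E)\<^sup>2 = (cmod d)\<^sup>2 - (Re E)\<^sup>2" using E cmod_power2[of E] by simp
  ultimately show ?thesis unfolding Y_E_def by (simp add: power_mult_distrib)
qed

text \<open>\<open>focal_disk_width\<close> bounds the support function from above, and
  \<open>ellipse_point\<close> attains the bound.\<close>

lemma elliptical_disk_support:
  assumes a: "cmod (f1 - f2) < 2 * a"
  defines "c \<equiv> (f1 + f2) / 2" and "d \<equiv> (f1 - f2) / 2"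
  defines "b \<equiv> sqrt (a\<^sup>2 - (cmod d)\<^sup>2)"
  assumes le: "\<And>x. cmod (x - f1) + cmod (x - f2) \<le> 2 * a \<Longrightarrow> Re (x * cis (- \<phi>)) \<le> h"
    and touch: "\<exists>x. cmod (x - f1) + cmod (x - f2) \<le> 2 * a \<and> Re (x * cis (- \<phi>)) = h"
  shows "b > 0" "h - Re (c * cis (- \<phi>)) = sqrt (b\<^sup>2 + (Re (d * cis (- \<phi>)))\<^sup>2)"
proof -
  have da: "cmod d < a" using a by (simp add: d_def norm_divide)
  have f: "f1 = c + d" "f2 = c - d" by (simp_all add: c_def d_def field_simps)
  have ad: "(cmod d)\<^sup>2 < a\<^sup>2" using da by (intro power_strict_mono) auto
  then show b: "b > 0" by (simp add: b_def)
  have b2: "b\<^sup>2 = a\<^sup>2 - (cmod d)\<^sup>2" using ad by (simp add: b_def)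
  have a2: "sqrt (b\<^sup>2 + (cmod d)\<^sup>2) = a" using da norm_ge_zero[of d] by (simp add: b2 del: norm_ge_zero)
  define w where "w = sqrt (b\<^sup>2 + (Re (d * cis (- \<phi>)))\<^sup>2)"
  have shift: "cmod (x - f1) + cmod (x - f2) = cmod ((x - c) - d) + cmod ((x - c) + d)" for x
    unfolding f by (simp add: algebra_simps)
  have "h - Re (c * cis (- \<phi>)) \<le> w"
  proof -
    obtain x where x: "cmod (x - f1) + cmod (x - f2) \<le> 2 * a" "Re (x * cis (- \<phi>)) = h" using touch by blast
    have "(Re ((x - c) * cis (- \<phi>)))\<^sup>2 \<le> b\<^sup>2 + (Re (d * cis (- \<phi>)))\<^sup>2"
      unfolding b2 by (rule focal_disk_width) (use x(1) shift in simp)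
    then have "Re ((x - c) * cis (- \<phi>)) \<le> w" unfolding w_def by (rule real_le_rsqrt)
    then show ?thesis using x(2) by (simp only: left_diff_distrib minus_complex.sel)
  qed
  moreover have "w \<le> h - Re (c * cis (- \<phi>))"
  proof -
    define x where "x = c + ellipse_point b d (cis \<phi>)"
    have "cmod (x - f1) + cmod (x - f2) \<le> 2 * a"
      unfolding shift x_def using ellipse_point_focal[OF _ b, of "cis \<phi>" d] a2 by simp
    then have "Re (x * cis (- \<phi>)) \<le> h" by (rule le)
    moreover have "ellipse_point b d (cis \<phi>) * cis (- \<phi>) = Complex w (Re (d * cis (- \<phi>)) * Im (d * cis (- \<phi>)) / w)"
    proof -
      have "cis \<phi> * v * cis (- \<phi>) = v" for v using cis_mult[of \<phi> "- \<phi>"] by (simp add: mult.commute mult.left_commute)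
      then show ?thesis unfolding ellipse_point_def cis_cnj w_def by blast
    qed
    ultimately show ?thesis by (simp only: x_def distrib_right plus_complex.sel complex.sel)
  qed
  ultimately show "h - Re (c * cis (- \<phi>)) = sqrt (b\<^sup>2 + (Re (d * cis (- \<phi>)))\<^sup>2)" unfolding w_def by linarith
qed

text \<open>Coefficients read off from (h - Re (c u))^2 = b^2 + (Re (d u))^2 through
  \<open>chord_form_support\<close>, scaled so that the coefficient C is 1.\<close>

definition focal_form :: "real \<Rightarrow> complex \<Rightarrow> complex \<Rightarrow> complex \<Rightarrow> complex \<Rightarrow> complex" where
  "focal_form b c d = chord_form (cnj (c\<^sup>2 - d\<^sup>2)) (- 2 * cnj c) 1 (2 + 2 * (cmod c)\<^sup>2 - 2 * (cmod d)\<^sup>2 - 4 * b\<^sup>2)"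

lemma focal_form_support:
  "focal_form b c d (cis (\<phi> - \<delta>)) (cis (\<phi> + \<delta>))
    = (cis \<phi>)\<^sup>2 * of_real (4 * ((cos \<delta> - Re (c * cis (- \<phi>)))\<^sup>2 - (b\<^sup>2 + (Re (d * cis (- \<phi>)))\<^sup>2)))"
proof -
  define h u where "h = cos \<delta>" "u = cis (- \<phi>)"
  have 1: "Re (- 2 * cnj c * cis \<phi>) = - 2 * Re (c * u)" by (simp add: h_u_def)
  have cu: "cmod (c * u) = cmod c" "cmod (d * u) = cmod d" by (simp_all add: h_u_def norm_mult)
  have "cnj (c\<^sup>2 - d\<^sup>2) * (cis \<phi>)\<^sup>2 = cnj ((c * u)\<^sup>2 - (d * u)\<^sup>2)" by (simp add: h_u_def power_mult_distrib left_diff_distrib cis_cnj)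
  then have 2: "Re (cnj (c\<^sup>2 - d\<^sup>2) * (cis \<phi>)\<^sup>2) = Re ((c * u)\<^sup>2) - Re ((d * u)\<^sup>2)" by (simp only: cnj.sel minus_complex.sel)
  have 3: "(Re (c * u))\<^sup>2 = ((cmod c)\<^sup>2 + Re ((c * u)\<^sup>2)) / 2" "(Re (d * u))\<^sup>2 = ((cmod d)\<^sup>2 + Re ((d * u)\<^sup>2)) / 2"
    using Re_power2_half[of "c * u"] Re_power2_half[of "d * u"] unfolding cu by auto
  have key: "4 * 1 * h\<^sup>2 + 4 * h * Re (- 2 * cnj c * cis \<phi>) + (2 + 2 * (cmod c)\<^sup>2 - 2 * (cmod d)\<^sup>2 - 4 * b\<^sup>2) - 2 * 1
       + 2 * Re (cnj (c\<^sup>2 - d\<^sup>2) * (cis \<phi>)\<^sup>2)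
     = 4 * ((h - Re (c * u))\<^sup>2 - (b\<^sup>2 + (Re (d * u))\<^sup>2))"
    unfolding 1 2 power2_diff 3 by (simp add: field_simps)
  show ?thesis unfolding focal_form_def chord_form_support h_u_def[symmetric] key ..
qed

context circle_cover
begin

text \<open>No point of the fibre lies strictly between t and \<open>step 1 t\<close>, so none lies
  beyond that chord.\<close>

lemma circle_arc_bound:
  assumes "1 < N" "i < N"
  shows "Re (cis (step i t) * cis (- mid 1 t)) \<le> cos (half 1 t)"
proof -
  define s where "s = step i t - mid 1 t"
  have c: "Re (cis (step i t) * cis (- mid 1 t)) = cos s" by (simp add: s_def cis_mult del: times_complex.sel)
  have hb: "0 < half 1 t" "half 1 t < pi" using half_bounds[of 1 t] assms by auto
  have m: "mid 1 t - half 1 t = t" "mid 1 t + half 1 t = step 1 t" by (rule mid_half)+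
  show ?thesis unfolding c
  proof (cases "i = 0")
    case True
    then have "s = - half 1 t" using m(1) by (simp add: s_def step_0)
    then show "cos s \<le> cos (half 1 t)" by simp
  next
    case False
    then have "step 1 t \<le> step i t" using step_less_iff[of i t 1] by (simp add: not_less[symmetric])
    then have s1: "half 1 t \<le> s" using m by (simp add: s_def)
    have "step i t < t + 2 * pi" using step_bounds[OF assms(2)] by blast
    then have s2: "s \<le> 2 * pi - half 1 t" using m by (simp add: s_def)
    show "cos s \<le> cos (half 1 t)"
    proof (cases "s \<le> pi")
      case True
      then show ?thesis using s1 hb by (intro cos_monotone_0_pi_le) auto
    next
      case False
      \<comment> \<open>Beyond pi the angle is reflected to 2 pi - s, back to the range where cos
        decreases.\<close>
      have "cos s = cos (2 * pi - s)" by (simp add: cos_diff)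
      also have "\<dots> \<le> cos (half 1 t)" using s2 hb False by (intro cos_monotone_0_pi_le) auto
      finally show ?thesis .
    qed
  qed
qed

lemma orbit_of_conic:
  assumes "\<And>t. chord_form A B C D (cis t) (cis (step 1 t)) = 0"
  shows "poncelet_orbit N A B C D (\<lambda>j. cis (step j t))"
  unfolding poncelet_orbit_def using assms[of "step j t" for j] by (simp add: cis_step_eq_iff step_step)

lemma has_poncelet_conicI:
  assumes "\<And>z. cmod z = 1 \<Longrightarrow> gauge_form A B C D z > 0" "\<And>t. chord_form A B C D (cis t) (cis (step 1 t)) = 0"
  shows "has_poncelet_conic N F"
proof -
  have "\<exists>y. y 0 = z \<and> poncelet_orbit N A B C D y \<and> (\<forall>j. F (y j) = F z)" if z: "cmod z = 1" for z
    using orbit_of_conic[OF assms(2), of "Arg z"] F_step[of _ "Arg z"] cis_Arg_unit[OF z]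
    by (intro exI[of _ "\<lambda>j. cis (step j (Arg z))"]) (simp add: step_0)
  then show ?thesis unfolding has_poncelet_conic_def using assms(1) by blast
qed

text \<open>The support function of the disk equals cos (half) at every side. As this is below 1, no
  tangent of the circle touches the disk, which gives the positivity of the gauge.\<close>

lemma conic_of_elliptical_disk:
  assumes N1: "1 < N" and E: "is_elliptical_disk E"
    and le: "\<And>t x. x \<in> E \<Longrightarrow> Re (x * cis (- mid 1 t)) \<le> cos (half 1 t)"
    and touch: "\<And>t. \<exists>x\<in>E. Re (x * cis (- mid 1 t)) = cos (half 1 t)"
  obtains A B C D where "\<And>z. cmod z = 1 \<Longrightarrow> gauge_form A B C D z > 0"
    "\<And>t. chord_form A B C D (cis t) (cis (step 1 t)) = 0"
proof -
  obtain f1 f2 a where a: "cmod (f1 - f2) < 2 * a" and E_eq: "E = {z. cmod (z - f1) + cmod (z - f2) \<le> 2 * a}"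
    using E unfolding is_elliptical_disk_def by blast
  define c d b where "c = (f1 + f2) / 2" "d = (f1 - f2) / 2" "b = sqrt (a\<^sup>2 - (cmod ((f1 - f2) / 2))\<^sup>2)"
  note cdb = this
  have supp: "cos (half 1 t) - Re (c * cis (- mid 1 t)) = sqrt (b\<^sup>2 + (Re (d * cis (- mid 1 t)))\<^sup>2)" for t
    using elliptical_disk_support(2)[OF a, of "mid 1 t" "cos (half 1 t)"] le[of _ t] touch[of t]
    unfolding E_eq cdb by blast
  let ?D = "2 + 2 * (cmod c)\<^sup>2 - 2 * (cmod d)\<^sup>2 - 4 * b\<^sup>2"
  show ?thesis
  proof (rule that[of "cnj (c\<^sup>2 - d\<^sup>2)" "- 2 * cnj c" 1 ?D])
    fix t
    have "focal_form b c d (cis (mid 1 t - half 1 t)) (cis (mid 1 t + half 1 t)) = 0"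
      unfolding focal_form_support supp by simp
    then show "chord_form (cnj (c\<^sup>2 - d\<^sup>2)) (- 2 * cnj c) 1 ?D (cis t) (cis (step 1 t)) = 0"
      unfolding mid_half focal_form_def .
  next
    fix z :: complex assume z: "cmod z = 1"
    obtain t where t: "mid 1 t = Arg z" using mid_surj[OF N1] by blast
    have zt: "z = cis (mid 1 t)" using t cis_Arg_unit[OF z] by simp
    define S where "S = sqrt (b\<^sup>2 + (Re (d * cis (- mid 1 t)))\<^sup>2)"
    have S2: "b\<^sup>2 + (Re (d * cis (- mid 1 t)))\<^sup>2 = S\<^sup>2" by (simp add: S_def)
    \<comment> \<open>The tangent of the circle at z, as the degenerate chord with half angle
      0.\<close>
    have "focal_form b c d z z = z\<^sup>2 * of_real (4 * ((1 - Re (c * cis (- mid 1 t)))\<^sup>2 - S\<^sup>2))"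
      using focal_form_support[of b c d "mid 1 t" 0] unfolding diff_zero add_0_right cos_zero zt[symmetric] S2 .
    then have "z\<^sup>2 * of_real (gauge_form (cnj (c\<^sup>2 - d\<^sup>2)) (- 2 * cnj c) 1 ?D z)
        = z\<^sup>2 * of_real (4 * ((1 - Re (c * cis (- mid 1 t)))\<^sup>2 - S\<^sup>2))"
      unfolding focal_form_def chord_form_diag[OF z, symmetric] .
    then have g: "gauge_form (cnj (c\<^sup>2 - d\<^sup>2)) (- 2 * cnj c) 1 ?D z = 4 * ((1 - Re (c * cis (- mid 1 t)))\<^sup>2 - S\<^sup>2)"
      using z by (metis mult_left_cancel norm_zero of_real_eq_iff power_eq_0_iff zero_neq_one)
    have "0 < half 1 t" "half 1 t < pi" using half_bounds[of 1 t] N1 by auto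
    then have "cos (half 1 t) < 1" using cos_monotone_0_pi[of 0 "half 1 t"] by simp
    then have "S < 1 - Re (c * cis (- mid 1 t))" using supp[of t] unfolding S_def by linarith
    moreover have "0 \<le> S" unfolding S_def by simp
    ultimately have "S\<^sup>2 < (1 - Re (c * cis (- mid 1 t)))\<^sup>2" by (intro power_strict_mono) auto
    then show "gauge_form (cnj (c\<^sup>2 - d\<^sup>2)) (- 2 * cnj c) 1 ?D z > 0" unfolding g by simp
  qed
qed

text \<open>The case j = M, where 2 j < N fails, is the half-turn and gives a point; smaller j give
  ellipses.\<close>

lemma lower_curves:
  assumes M: "N = 2 * M" "2 \<le> M" and pos: "\<And>z. cmod z = 1 \<Longrightarrow> gauge_form A B C D z > 0"
    and conic: "\<And>t. chord_form A B C D (cis t) (cis (step 1 t)) = 0" and j: "0 < j" "j \<le> M"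
  shows "is_ellipse (poncelet_curve F j) \<or> (\<exists>c. poncelet_curve F j = {c})"
proof -
  note orbit = orbit_of_conic[OF conic, unfolded M(1)]
  have orbits: "\<exists>y. y 0 = z \<and> poncelet_orbit (2 * M) A B C D y" if "cmod z = 1" for z
    using orbit[of "Arg z"] cis_Arg_unit[OF that] by (intro exI[of _ "\<lambda>j. cis (step j (Arg z))"]) (simp add: step_0)
  obtain x where x: "cmod x < 1" "\<And>y. poncelet_orbit (2 * M) A B C D y \<Longrightarrow> moeb (- x) (y M) = - moeb (- x) (y 0)"
    and conics: "\<And>j. \<exists>A' B' C' D'. (A' \<noteq> 0 \<or> B' \<noteq> 0 \<or> C' \<noteq> 0 \<or> D' \<noteq> 0) \<and>
       (\<forall>y. poncelet_orbit (2 * M) A B C D y \<longrightarrow> chord_form A' B' C' D' (y 0) (y j) = 0)"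
    by (rule poncelet_orbits_closed_form[OF M(2) pos orbits]) blast+
  show ?thesis
  proof (cases "j = M")
    case True
    have "moeb (- x) (cis (step j t)) = - moeb (- x) (cis t)" for t
      using x(2)[OF orbit[of t]] True by (simp add: step_0)
    then show ?thesis using involution_imp_point[of j x] x(1) j True M by auto
  next
    case False
    obtain A' B' C' D' where c: "A' \<noteq> 0 \<or> B' \<noteq> 0 \<or> C' \<noteq> 0 \<or> D' \<noteq> 0"
       "\<And>y. poncelet_orbit (2 * M) A B C D y \<Longrightarrow> chord_form A' B' C' D' (y 0) (y j) = 0" using conics[of j] by blast
    have "chord_form A' B' C' D' (cis t) (cis (step j t)) = 0" for t
      using c(2)[OF orbit[of t]] by (simp add: step_0)
    then show ?thesis using conic_imp_ellipse[OF j(1) _ c(1)] False j M by auto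
  qed
qed

end

lemma mult_blaschke: "(\<lambda>z. z * blaschke \<gamma> as z) = blaschke \<gamma> (0 # as)"
  by auto

theorem theorem3p3:
  fixes n :: nat and \<gamma> :: complex and as :: "complex list"
  assumes "n \<ge> 2"
    and "cmod \<gamma> = 1"
    and "length as = 2 ^ n - 1"
    and "\<forall>a\<in>set as. cmod a < 1"
    and "is_elliptical_disk (num_range_SB (blaschke \<gamma> as))"
  shows "(\<forall>j\<in>{2 .. 2 ^ n div 2}.
            is_ellipse (poncelet_curve (\<lambda>z. z * blaschke \<gamma> as z) j)
            \<or> (\<exists>c. poncelet_curve (\<lambda>z. z * blaschke \<gamma> as z) j = {c}))
       \<and> (\<exists>Cs :: (complex \<Rightarrow> complex) list. length Cs = n \<and> (\<forall>C\<in>set Cs. is_fbp 2 C)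
            \<and> (\<forall>z\<in>ball 0 1. z * blaschke \<gamma> as z = foldr (\<circ>) Cs id z))"
proof -
  let ?F = "blaschke \<gamma> (0 # as)"
  define N M :: nat where "N = 2 ^ n" "M = 2 ^ (n - 1)"
  have len: "length (0 # as) = N" using assms(3) by (simp add: N_M_def)
  have M: "N = 2 * M" "2 \<le> M" "2 ^ n div 2 = M"
    using assms(1) power_increasing[of 1 "n - 1" "2::nat"] by (cases n; simp add: N_M_def)+
  have ne: "as \<noteq> []" using len M by auto
  have \<gamma>: "\<gamma> \<noteq> 0" using assms(2) by auto
  have as0: "\<forall>a\<in>set (0 # as). cmod a < 1" using assms(4) by simp
  obtain L L' where L: "\<And>t. (L has_real_derivative L' t) (at t)" "\<And>t. L' t > 0"
    "\<And>t. L (t + 2 * pi) = L t + 2 * pi * N" "\<And>t. ?F (cis t) = cis (L t)"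
    using blaschke_lift[OF assms(2) as0] unfolding len by blast
  interpret circle_cover ?F L L' N
    by unfold_locales (use L M in auto)
  \<comment> \<open>The nodes are the vertices of the polygon through \<open>cis t\<close>; dividing
    by \<gamma> matches the constant 1 used in \<open>clark_basis\<close>.\<close>
  have clark: "clark_basis as (\<lambda>i. cis (step i t)) (?F (cis t) / \<gamma>) N" for t
  proof
    show "cmod (?F (cis t) / \<gamma>) = 1" using cmod_blaschke_circle[OF _ as0, of "cis t" \<gamma>] assms(2) by (simp add: norm_divide del: blaschke_simps)
    show "inj_on (\<lambda>i. cis (step i t)) {..<N}" by (rule inj_on_cis_step)
    fix i
    have "?F (cis (step i t)) = ?F (cis t)" by (rule F_step)
    moreover have "poly (pole_poly (0 # as)) (cis (step i t)) \<noteq> 0" by (rule poly_pole_poly_nonzero[OF as0]) simp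
    moreover have "pole_poly (0 # as) = pole_poly as" by simp
    ultimately show "poly (zero_poly (0 # as)) (cis (step i t)) = ?F (cis t) / \<gamma> * poly (pole_poly as) (cis (step i t))"
      using \<gamma> unfolding blaschke_eq_poly[of \<gamma> "0 # as" "cis (step i t)"] by (simp add: field_simps del: blaschke_simps zero_poly_simps)
  qed (use assms(4) len in auto)
  let ?E = "num_range_SB (blaschke \<gamma> as)"
  have le: "Re (x * cis (- mid 1 t)) \<le> cos (half 1 t)" if x: "x \<in> ?E" for x t
  proof -
    interpret clark: clark_basis as "\<lambda>i. cis (step i t)" "?F (cis t) / \<gamma>" N by (rule clark)
    obtain p where p: "\<And>i. p i \<ge> 0" "(\<Sum>i<N. p i) = 1" "x = (\<Sum>i<N. of_real (p i) * cis (step i t))"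
      using clark.num_range_convex_combination[OF \<gamma> ne x] by blast
    have "Re (x * cis (- mid 1 t)) = (\<Sum>i<N. p i * Re (cis (step i t) * cis (- mid 1 t)))"
      unfolding p(3) sum_distrib_right Re_sum by (simp add: mult.assoc algebra_simps)
    also have "\<dots> \<le> (\<Sum>i<N. p i * cos (half 1 t))"
      by (intro sum_mono mult_left_mono circle_arc_bound p) (use M in auto)
    also have "\<dots> = cos (half 1 t)" using p(2) by (simp flip: sum_distrib_right)
    finally show ?thesis .
  qed
  have touch: "\<exists>x\<in>?E. Re (x * cis (- mid 1 t)) = cos (half 1 t)" for t
  proof -
    interpret clark: clark_basis as "\<lambda>i. cis (step i t)" "?F (cis t) / \<gamma>" N by (rule clark)
    \<comment> \<open>Nodes 0 and 1 are the ends of the first side, whose line consists of the x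
      with \<open>Re (x * cis (- mid 1 t)) = cos (half 1 t)\<close>.\<close>
    obtain q r where qr: "q + r = 1" "of_real q * cis (step 0 t) + of_real r * cis (step 1 t) \<in> ?E"
      by (rule clark.num_range_meets_side[OF \<gamma> ne, of 0 1]) (use M in auto)
    have m: "t = mid 1 t - half 1 t" "step 1 t = mid 1 t + half 1 t" by (simp_all add: mid_half)
    have "Re (cis t * cis (- mid 1 t)) = cos (half 1 t)" unfolding cis_mult by (subst m(1)) simp
    moreover have "Re (cis (step 1 t) * cis (- mid 1 t)) = cos (half 1 t)" unfolding cis_mult m(2) by simp
    ultimately have "Re ((of_real q * cis (step 0 t) + of_real r * cis (step 1 t)) * cis (- mid 1 t)) = (q + r) * cos (half 1 t)"
      by (simp only: step_0 distrib_right mult.assoc plus_complex.sel times_complex.sel(1)[of "of_real q"]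
          times_complex.sel(1)[of "of_real r"] Re_complex_of_real Im_complex_of_real)
    then show ?thesis using qr by (intro bexI[OF _ qr(2)]) simp
  qed
  obtain A B C D where pos: "\<And>z. cmod z = 1 \<Longrightarrow> gauge_form A B C D z > 0"
    and conic: "\<And>t. chord_form A B C D (cis t) (cis (step 1 t)) = 0"
    using conic_of_elliptical_disk[OF _ assms(5) le touch] M by (metis Suc_1 Suc_le_lessD less_le_trans mult_2 nat_le_linear one_add_one trans_less_add1)
  have "is_ellipse (poncelet_curve ?F j) \<or> (\<exists>c. poncelet_curve ?F j = {c})" if "j \<in> {2..M}" for j
    using lower_curves[OF M(1,2) pos conic, of j] that by auto
  moreover have "\<exists>Cs. length Cs = n \<and> (\<forall>C\<in>set Cs. is_fbp 2 C) \<and> (\<forall>z\<in>ball 0 1. ?F z = foldr (\<circ>) Cs id z)"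
    by (rule blaschke_composition)
      (use assms as0 len has_poncelet_conicI[OF pos conic] in \<open>auto simp: N_M_def simp del: blaschke_simps\<close>)
  ultimately show ?thesis unfolding mult_blaschke M(3) by simp
qed

end
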